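(* Let $\gamma$ be an oval, let $F$ be its outer length billiard map, and fix an origin $O$ in the interior of $\gamma$. In polar coordinates $(\alpha,r)$ centered at $O$, consider the vector field $$X=-\frac{2w(\alpha)}{r}\,\frac{\partial}{\partial\alpha}$$ on $\mathbb{R}^2\setminus\{O\}$, and let $\Phi$ be its time-$1$ flow. Then there is a constant $C$, depending only on $\gamma$ and $O$, such that for every point $x$ in the exterior of $\gamma$, $$|F^2(x)-\Phi(x)|\le \frac{C}{|x|},$$ where $|x|$ denotes the distance from $x$ to $O$.
   Context: An oval is a smooth closed simple planar curve $\gamma$ with everywhere positive curvature; it bounds a compact strictly convex domain $K$. Orient $\gamma$ counterclockwise. For a point $A\in\mathbb{R}^2\setminus K$ there are exactly two lines through $A$ tangent to $\gamma$. The positive tangency point $x_+(A)$ is the one for which $x_+(A)-A$ is a positive multiple of the oriented tangent vector of $\gamma$ at $x_+(A)$. The negative tangency point $x_-(A)$ is the one for which $A-x_-(A)$ is a positive multiple of the oriented tangent vector of $\gamma$ at $x_-(A)$. Outer length billiard map $F:\mathbb{R}^2\setminus K\to\mathbb{R}^2\setminus K$. Let $\Sigma_A$ be the circle that is inscribed in the angle with vertex $A$ formed by the ray from $A$ through $x_+(A)$ and the ray from $A$ opposite to the ray from $A$ through $x_-(A)$, and that touches the first ray at $x_+(A)$. Then $\Sigma_A$ and $\gamma$ touch externally at $x_+(A)$. They have exactly three common tangent lines, two of which are the lines $Ax_+(A)$ and $Ax_-(A)$. $F(A)$ is the intersection point of the third common tangent line with the line $Ax_+(A)$. Width: for a direction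 $\alpha$, $w(\alpha)=w_\gamma(\alpha)$ is the distance between the two support lines of $\gamma$ parallel to the vector $(\cos\alpha,\sin\alpha)$. Note that $\partial/\partial\alpha$ has Euclidean length $r$, so $X$ moves points along circles centered at $O$ with speed $2w(\alpha)$. *)

theory Defs
  imports "HOL-Analysis.Analysis"
begin

text \<open>The plane is modelled by the complex numbers. An oval is given by a
parametrisation c :: real => complex which is L-periodic, injective on one
period (simple closed), C-infinity, and has positive signed curvature, i.e.
cross(c', c'') > 0 everywhere; this also fixes the counterclockwise orientation.\<close>

definition cross2 :: "complex \<Rightarrow> complex \<Rightarrow> real" where
  "cross2 a b = Im (cnj a * b)"

definition oval :: "(real \<Rightarrow> complex) \<Rightarrow> real \<Rightarrow> bool" where
  "oval c L \<longleftrightarrow> L > 0 \<and> (\<forall>t. c (t + L) = c t) \<and> inj_on c {0..<L} \<and>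
     (\<exists>D :: nat \<Rightarrow> real \<Rightarrow> complex. D 0 = c \<and>
        (\<forall>n t. (D n has_vector_derivative D (Suc n) t) (at t)) \<and>
        (\<forall>t. cross2 (D 1 t) (D 2 t) > 0))"

definition oval_domain :: "(real \<Rightarrow> complex) \<Rightarrow> real \<Rightarrow> complex set" where
  "oval_domain c L = convex hull (c ` {0..L})"

definition tangent_vec :: "(real \<Rightarrow> complex) \<Rightarrow> real \<Rightarrow> complex" where
  "tangent_vec c t = vector_derivative c (at t)"

definition pos_tangency :: "(real \<Rightarrow> complex) \<Rightarrow> complex \<Rightarrow> complex" where
  "pos_tangency c A = (THE x. \<exists>t. x = c t \<and>
      (\<exists>k>0. c t - A = of_real k * tangent_vec c t))"

definition neg_tangency :: "(real \<Rightarrow> complex) \<Rightarrow> complex \<Rightarrow> complex" where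
  "neg_tangency c A = (THE x. \<exists>t. x = c t \<and>
      (\<exists>k>0. A - c t = of_real k * tangent_vec c t))"

definition ray :: "complex \<Rightarrow> complex \<Rightarrow> complex set" where
  "ray A u = {A + of_real s * u | s. s \<ge> 0}"

definition line :: "complex \<Rightarrow> complex \<Rightarrow> complex set" where
  "line p v = {p + of_real s * v | s. True}"

definition angle_region :: "complex \<Rightarrow> complex \<Rightarrow> complex \<Rightarrow> complex set" where
  "angle_region A u v = {A + of_real s * u + of_real t * v | s t. s \<ge> 0 \<and> t \<ge> 0}"

definition inscribed_in_angle :: "complex \<Rightarrow> real \<Rightarrow> complex \<Rightarrow> complex \<Rightarrow> complex \<Rightarrow> bool" where
  "inscribed_in_angle Z \<rho> A u v \<longleftrightarrow> \<rho> > 0 \<and> cball Z \<rho> \<subseteq> angle_region A u v \<and>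
     ray A u \<inter> sphere Z \<rho> \<noteq> {} \<and> ray A v \<inter> sphere Z \<rho> \<noteq> {}"

definition Sigma_circle :: "(real \<Rightarrow> complex) \<Rightarrow> complex \<Rightarrow> complex \<times> real" where
  "Sigma_circle c A = (let P = pos_tangency c A; M = neg_tangency c A in
     (THE (Z, \<rho>). inscribed_in_angle Z \<rho> A (P - A) (A - M) \<and> P \<in> sphere Z \<rho>))"

definition common_tangents :: "(real \<Rightarrow> complex) \<Rightarrow> complex \<Rightarrow> real \<Rightarrow> complex set set" where
  "common_tangents c Z \<rho> = {l. (\<exists>t. l = line (c t) (tangent_vec c t)) \<and>
                               (\<exists>!p. p \<in> l \<inter> sphere Z \<rho>)}"

definition outer_length_billiard :: "(real \<Rightarrow> complex) \<Rightarrow> complex \<Rightarrow> complex" where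
  "outer_length_billiard c A = (let P = pos_tangency c A; M = neg_tangency c A;
       (Z, \<rho>) = Sigma_circle c A in
     (THE B. \<exists>l \<in> common_tangents c Z \<rho>. l \<noteq> line A (P - A) \<and> l \<noteq> line A (M - A) \<and>
             B \<in> l \<inter> line A (P - A)))"

text \<open>Width in direction alpha: distance between the two support lines of the
oval parallel to (cos alpha, sin alpha), i.e. with unit normal i * cis alpha.\<close>
definition width :: "(real \<Rightarrow> complex) \<Rightarrow> real \<Rightarrow> real \<Rightarrow> real" where
  "width c L \<alpha> = (let u = \<i> * cis \<alpha>; K = oval_domain c L in
     (SUP x\<in>K. x \<bullet> u) - (INF x\<in>K. x \<bullet> u))"

text \<open>The vector field X = -(2 w(alpha)/r) d/d alpha in polar coordinates
centred at Q; d/d alpha at p is the vector i*(p - Q).\<close>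
definition field_X :: "(real \<Rightarrow> complex) \<Rightarrow> real \<Rightarrow> complex \<Rightarrow> complex \<Rightarrow> complex" where
  "field_X c L Q p = - of_real (2 * width c L (Arg (p - Q)) / cmod (p - Q)) * (\<i> * (p - Q))"

definition time1_flow :: "(real \<Rightarrow> complex) \<Rightarrow> real \<Rightarrow> complex \<Rightarrow> complex \<Rightarrow> complex" where
  "time1_flow c L Q x = (THE y. \<exists>\<phi>. \<phi> 0 = x \<and> \<phi> 1 = y \<and>
      (\<forall>t\<in>{0..1}. \<phi> t \<noteq> Q \<and>
         (\<phi> has_vector_derivative field_X c L Q (\<phi> t)) (at t within {0..1})))"

end

theory Submission
  imports Defs
begin

text \<open>By Hopf's theorem on the turning number the tangent angle parametrises the oval: \<open>\<gamma>' s = \<rho> s * cis s\<close>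
  with \<open>\<rho>\<close> bounded between positive constants. An exterior point is determined by the tangent angles
  \<open>\<phi> < \<theta> < \<phi> + pi\<close> of its negative and positive tangency points, and the billiard map sends \<open>(\<phi>, \<theta>)\<close> to
  \<open>(\<theta>, \<psi>)\<close>, where \<open>\<psi>\<close> is found by equating two expressions for the radius of the circle.
  For \<open>\<epsilon> = pi - (\<theta> - \<phi>)\<close> and \<open>\<eta> = pi - (\<psi> - \<theta>)\<close> small, the length of the step along the line with direction
  \<open>cis \<theta>\<close> is \<open>2 * w / \<epsilon> + w' + O(\<epsilon>)\<close>, and also \<open>2 * w / \<eta> - w' + O(\<eta>)\<close>, with the width \<open>w\<close> and its derivative taken
  at \<open>\<theta>\<close>. Two consecutive steps thus have equal lengths up to \<open>O(\<eta>)\<close> and almost opposite directions, and they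
  add up to \<open>2 * w * \<i> * cis \<theta> + O(\<eta>)\<close>, which is the value of the field up to \<open>O(1 / r)\<close>. Along the time-1 flow the
  field changes by \<open>O(1 / r)\<close> only. Near the oval it suffices that both maps move points by a bounded amount.\<close>

section \<open>Hopf's theorem on the turning number\<close>

text \<open>The circle of radius \<open>R\<close> for \<open>(\<phi>, \<theta>)\<close> has its
  centre on the outer normal at \<open>\<gamma> \<theta>\<close>. It touches the tangent line at
  angle \<open>s\<close> exactly if the signed distance
  \<open>height s \<theta> - R * cos (s - \<theta>)\<close> is \<open>R\<close> or
  \<open>- R\<close>. The value \<open>- R\<close> occurs only at \<theta> itself; the value
  \<open>R\<close> means \<open>R = height s \<theta> / (1 + cos (s - \<theta>))\<close>. The right
  side, called \<open>ratio \<theta> s\<close>, is strictly monotone on either side of \<theta>, so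
  the map is described by the equation \<open>ratio \<theta> \<psi> = ratio \<theta> \<phi>\<close>.
  Its symmetry in \<phi> and \<psi> yields the second expansion of a step length from the first.
  Step lengths are of order r, yet the error must be O(1/r). Both steps are therefore expanded in
  the angle \<eta> of the vertex they share, so that the large terms cancel. Taylor expansions stop
  at second order, where the remainder contains \<open>\<rho>\<close> but not its derivative. All
  notions of the statement are definite descriptions, so tangency points, circle, third tangent and
  flow line each need existence and uniqueness.\<close>

lemma cross2_expand: "cross2 a b = Re a * Im b - Im a * Re b"
  by (simp add: cross2_def)

lemma antiderivative_exists:
  fixes f :: "real \<Rightarrow> 'a::euclidean_space"
  assumes "continuous_on UNIV f"
  obtains F where "\<And>x. (F has_vector_derivative f x) (at x)"
proof -
  have "\<exists>F. \<forall>x :: real. - \<infinity> < ereal x \<longrightarrow> ereal x < \<infinity> \<longrightarrow> (F has_vector_derivative f x) (at x)"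
    using assms by (intro einterval_antiderivative) (auto simp: continuous_on_eq_continuous_at)
  then show ?thesis using that by auto
qed

text \<open>Serves twice: to invert the tangent angle of the oval, and to solve the angular equation
  of the flow by separation of variables.\<close>

lemma inverse_function_exists:
  fixes g g' :: "real \<Rightarrow> real"
  assumes g: "\<And>x. (g has_real_derivative g' x) (at x)" and pos: "\<And>x. g' x > 0"
    and lo: "\<And>y. \<exists>x. g x \<le> y" and hi: "\<And>y. \<exists>x. y \<le> g x"
  obtains h where "\<And>x. h (g x) = x" "\<And>y. g (h y) = y"
    "\<And>y. (h has_real_derivative 1 / g' (h y)) (at y)"
proof -
  have mono: "g x < g y" if "x < y" for x y
    by (rule DERIV_pos_imp_increasing[OF that]) (use g pos in blast)
  have cont: "continuous_on S g" for S
    using g by (intro continuous_at_imp_continuous_on ballI DERIV_isCont) auto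
  have inj: "inj g"
    by (rule injI) (metis mono less_irrefl linorder_neqE)
  have surj: "\<exists>x. g x = y" for y
  proof -
    obtain a b where ab: "g a \<le> y" "y \<le> g b" using lo hi by blast
    then have "a \<le> b" using mono[of b a] by linarith
    then show ?thesis using IVT'[OF ab _ cont] by blast
  qed
  define h where "h = inv g"
  have hg: "h (g x) = x" for x by (simp add: h_def inj)
  have gh: "g (h y) = y" for y 
    unfolding h_def using surj[of y] by (intro f_inv_into_f) auto
  have "isCont h (g x)" for x
    by (rule isCont_inverse_function[of 1 x h g]) (simp_all add: hg DERIV_isCont[OF g])
  then have ch: "isCont h y" for y by (metis gh)
  have "(h has_real_derivative inverse (g' (h y))) (at y)" for y
    by (rule DERIV_inverse_function[OF g, of h y "y - 1" "y + 1"])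
      (simp_all add: less_imp_neq[OF pos[of "h y"], symmetric] gh ch)
  then show ?thesis using that[of h] hg gh by (simp add: inverse_eq_divide)
qed

lemma cis_eq_imp_int_multiple: "cis s = cis t \<Longrightarrow> \<exists>n::int. s = t + 2 * pi * n"
proof -
  assume "cis s = cis t"
  then have "exp (\<i> * s) = exp (\<i> * t)" by (simp add: cis_conv_exp)
  then obtain n :: int where "\<i> * s = \<i> * t + (of_int (2 * n) * pi) * \<i>" unfolding exp_eq by blast
  then have "Im (\<i> * s) = Im (\<i> * t + (of_int (2 * n) * pi) * \<i>)" by simp
  then show ?thesis by (intro exI[of _ n]) simp
qed

lemma periodic_int:
  fixes f :: "real \<Rightarrow> 'a" and n :: int
  assumes "\<And>x. f (x + p) = f x"
  shows "f (x + p * n) = f x"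
proof -
  have nat: "f (x + p * real k) = f x" for k x
  proof (induction k arbitrary: x)
    case (Suc k)
    have "f (x + p * real (Suc k)) = f ((x + p * real k) + p)" by (simp add: algebra_simps)
    then show ?case using assms Suc by simp
  qed simp
  show ?thesis
  proof (cases "n \<ge> 0")
    case True
    then show ?thesis using nat[of x "nat n"] by simp
  next
    case False
    then show ?thesis using nat[of "x + p * n" "nat (- n)"] by simp
  qed
qed

text \<open>The difference \<open>f - g\<close> takes its values among the logarithms of
  \<open>k\<close>. Distinct ones are at least \<open>2 * pi\<close> apart, so a continuous choice
  on an interval is constant.\<close>

lemma log_increment_unique:
  fixes f g :: "real \<Rightarrow> complex"
  assumes "a \<le> b" and cf: "continuous_on {a..b} f" and cg: "continuous_on {a..b} g"
    and eq: "\<And>x. x \<in> {a..b} \<Longrightarrow> exp (f x) = k * exp (g x)" and k: "k \<noteq> 0"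
  shows "f b - f a = g b - g a"
proof -
  define u where "u = (\<lambda>x. f x - g x)"
  have e: "exp (u x) = k" if "x \<in> {a..b}" for x
    using eq[OF that] by (simp add: u_def exp_diff)
  have "u constant_on {a..b}"
  proof (rule continuous_discrete_range_constant)
    show "connected {a..b}" by simp
    show "continuous_on {a..b} u" unfolding u_def by (intro continuous_intros cf cg)
    show "\<exists>e>0. \<forall>y. y \<in> {a..b} \<and> u y \<noteq> u x \<longrightarrow> e \<le> norm (u y - u x)" if x: "x \<in> {a..b}" for x
    proof (intro exI[of _ 1] conjI allI impI)
      fix y assume y: "y \<in> {a..b} \<and> u y \<noteq> u x"
      then have "exp (u y) = exp (u x)" using e x by simp
      then have "\<not> \<bar>Im (u y) - Im (u x)\<bar> < 2 * pi" using y exp_complex_eqI by blast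
      then have "1 \<le> \<bar>Im (u y - u x)\<bar>" using pi_gt3 by simp
      then show "1 \<le> norm (u y - u x)" using abs_Im_le_cmod order_trans by blast
    qed simp
  qed
  then have "u a = u b" using \<open>a \<le> b\<close> by (auto simp: constant_on_def)
  then show ?thesis by (simp add: u_def algebra_simps)
qed

text \<open>The closed right half-plane without 0 avoids the cut of \<open>Ln\<close>, so
  \<open>Ln (k * g x)\<close> is a continuous logarithm up to a constant. Boundary values must be
  allowed, because the secant direction starts and ends there.\<close>

lemma log_increment_half_plane:
  fixes f g :: "real \<Rightarrow> complex"
  assumes "a \<le> b" and cf: "continuous_on {a..b} f" and cg: "continuous_on {a..b} g"
    and eq: "\<And>x. x \<in> {a..b} \<Longrightarrow> exp (f x) = g x" and k: "k \<noteq> 0"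
    and pos: "\<And>x. x \<in> {a..b} \<Longrightarrow> 0 \<le> Re (k * g x)"
  shows "f b - f a = Ln (k * g b) - Ln (k * g a)"
proof (rule log_increment_unique[where k = "inverse k"])
  have nz: "k * g x \<noteq> 0" if "x \<in> {a..b}" for x using eq[OF that, symmetric] k by simp
  show "continuous_on {a..b} (\<lambda>x. Ln (k * g x))"
  proof (intro continuous_intros cg)
    fix x assume x: "x \<in> {a..b}"
    show "k * g x \<notin> \<real>\<^sub>\<le>\<^sub>0"
      using nz[OF x] pos[OF x] by (auto simp: complex_nonpos_Reals_iff complex_eq_iff simp del: times_complex.sel)
  qed
  show "exp (f x) = inverse k * exp (Ln (k * g x))" if "x \<in> {a..b}" for x
    using eq[OF that] nz[OF that] k by simp
qed (use assms in auto)

text \<open>The mean of \<open>c'\<close> over the segment from \<open>s\<close> to \<open>t\<close>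
  extends the difference quotient continuously to the diagonal.\<close>

lemma secant_quotient:
  fixes c c' :: "real \<Rightarrow> complex"
  assumes c: "\<And>t. (c has_vector_derivative c' t) (at t)" and cont: "continuous_on UNIV c'"
  defines "k \<equiv> \<lambda>(s, t). integral {0..1} (\<lambda>x. c' (s + x * (t - s)))"
  shows "continuous_on UNIV k" "of_real (t - s) * k (s, t) = c t - c s" "k (s, s) = c' s"
proof -
  have "continuous_on UNIV (\<lambda>p. integral (cbox 0 1) (\<lambda>x. c' (fst p + x * (snd p - fst p))))"
    by (rule integral_continuous_on_param)
      (auto intro!: continuous_on_compose2[OF cont] continuous_intros simp: split_beta)
  then show "continuous_on UNIV k" by (simp add: k_def split_beta)
  show "k (s, s) = c' s" by (simp add: k_def)
  have "((\<lambda>x. of_real (t - s) * c' (s + x * (t - s))) has_integral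
           (c (s + 1 * (t - s)) - c (s + 0 * (t - s)))) {0..1}"
  proof (rule fundamental_theorem_of_calculus)
    fix x :: real
    have "((\<lambda>x. s + x * (t - s)) has_vector_derivative (t - s)) (at x)"
      by (auto intro!: derivative_eq_intros simp: has_real_derivative_iff_has_vector_derivative[symmetric])
    from vector_diff_chain_at[OF this c]
    show "((\<lambda>x. c (s + x * (t - s))) has_vector_derivative of_real (t - s) * c' (s + x * (t - s)))
        (at x within {0..1})"
      by (auto simp: o_def scaleR_conv_of_real intro: has_vector_derivative_at_within)
  qed simp
  from integral_unique[OF this]
  have "integral {0..1} (\<lambda>x. of_real (t - s) * c' (s + x * (t - s))) = c t - c s" by simp
  then show "of_real (t - s) * k (s, t) = c t - c s"
    by (simp add: k_def)
qed

text \<open>Hopf's secant argument. The function \<open>k (s, t) - k (s, t - L)\<close> is a positive multiple of the secant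
  \<open>c t - c s\<close> for \<open>0 < t - s < L\<close>, it equals \<open>c' s\<close> on the diagonal and \<open>- c' s\<close> for \<open>t = s + L\<close>; so it is a
  zero-free extension of the secant direction to the closed triangle. Starting at a lowest point, the
  argument changes by half a turn along each leg of the triangle.\<close>

lemma turning_number_simple_closed:
  fixes c c' \<Lambda> :: "real \<Rightarrow> complex"
  assumes "L > 0" and per: "\<And>t. c (t + L) = c t" and inj: "inj_on c {0..<L}"
    and c: "\<And>t. (c has_vector_derivative c' t) (at t)" and cont: "continuous_on UNIV c'"
    and \<Lambda>: "continuous_on UNIV \<Lambda>" "\<And>t. exp (\<Lambda> t) = c' t"
  obtains t0 where "\<bar>Im (\<Lambda> (t0 + L) - \<Lambda> t0)\<bar> = 2 * pi"
proof -
  define k where "k = (\<lambda>(s, t). integral {0..1} (\<lambda>x. c' (s + x * (t - s))))"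
  have kc: "continuous_on UNIV k" and kq: "\<And>s t. of_real (t - s) * k (s, t) = c t - c s"
    and kd: "\<And>s. k (s, s) = c' s"
    unfolding k_def using secant_quotient[OF c cont] by blast+
  have perm: "c (t - L) = c t" for t using per[of "t - L"] by simp
  have perc': "c' (t + L) = c' t" for t
  proof -
    have "((\<lambda>x. x + L) has_vector_derivative 1) (at t)"
      by (auto intro!: derivative_eq_intros simp: has_real_derivative_iff_has_vector_derivative[symmetric])
    from vector_diff_chain_at[OF this c]
    have "(c has_vector_derivative c' (t + L)) (at t)" by (simp add: o_def per)
    then show ?thesis using c vector_derivative_at by metis
  qed
  define g where "g = (\<lambda>p. k p - k (fst p, snd p - L))"
  have gc: "continuous_on S g" for S
    unfolding g_def
    by (intro continuous_intros continuous_on_compose2[OF kc] continuous_on_subset[OF kc]) auto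
  have k0: "k (s, s - L) = 0" "k (s, s + L) = 0" for s
    using kq[of "s - L" s] kq[of "s + L" s] \<open>L > 0\<close> perm per by simp_all
  have gd: "g (s, s) = c' s" for s by (simp add: g_def kd k0)
  have gL: "g (s, s + L) = - c' s" for s by (simp add: g_def kd k0)
  \<comment> \<open>The denominators \<open>t - s\<close> and \<open>t - s - L\<close> have opposite
    signs, so the difference of the two quotients is a positive multiple of the secant.\<close>
  have gs: "g (s, t) = of_real (1 / (t - s) + 1 / (L - (t - s))) * (c t - c s)"
    if "s < t" "t < s + L" for s t
  proof -
    have "k (s, t) = (c t - c s) / of_real (t - s)"
      using kq[of t s] that by (simp add: field_simps)
    moreover have "k (s, t - L) = (c t - c s) / of_real (t - L - s)"
      using kq[of "t - L" s] that perm[of t] by (simp add: field_simps del: of_real_diff)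
    moreover have "of_real (t - L - s) = - (of_real (L - (t - s)) :: complex)" by simp
    ultimately show ?thesis
      unfolding g_def fst_conv snd_conv by (simp only: divide_minus_right) (simp add: ring_distribs divide_inverse)
  qed
  have c'nz: "c' t \<noteq> 0" for t using \<Lambda>(2)[of t] by (metis exp_not_eq_zero)
  have cinj: "c s \<noteq> c t" if "s < t" "t < s + L" for s t
  proof
    assume eq: "c s = c t"
    define n where "n = \<lfloor>s / L\<rfloor>"
    define s' where "s' = s + L * of_int (- n)"
    define t' where "t' = t + L * of_int (- n)"
    have s': "0 \<le> s'" "s' < L"
      using floor_divide_lower[OF \<open>L > 0\<close>, of s] floor_divide_upper[OF \<open>L > 0\<close>, of s]
      by (simp_all add: s'_def n_def algebra_simps)
    have eq': "c s' = c t'"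
      unfolding s'_def t'_def periodic_int[of c L, OF per] by (rule eq)
    have st: "s' < t'" "t' < s' + L" using that by (auto simp: s'_def t'_def)
    show False
    proof (cases "t' < L")
      case True
      then show False using inj_onD[OF inj eq'] s' st by auto
    next
      case False
      then have "c s' = c (t' - L)" using eq' perm by simp
      then show False using inj_onD[OF inj, of s' "t' - L"] s' st False by auto
    qed
  qed
  obtain t0 where t0: "\<And>t. Im (c t0) \<le> Im (c t)"
  proof -
    have cc: "continuous_on {0..L} (\<lambda>t. Im (c t))"
      using c by (intro continuous_intros) (meson continuous_at_imp_continuous_on has_vector_derivative_continuous)
    obtain t0 where t0: "t0 \<in> {0..L}" "\<And>t. t \<in> {0..L} \<Longrightarrow> Im (c t0) \<le> Im (c t)"
      using continuous_attains_inf[OF _ _ cc] \<open>L > 0\<close> by auto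
    have "Im (c t0) \<le> Im (c t)" for t
    proof -
      have "t + L * of_int (- \<lfloor>t / L\<rfloor>) \<in> {0..L}"
        using floor_divide_lower[OF \<open>L > 0\<close>, of t] floor_divide_upper[OF \<open>L > 0\<close>, of t]
        by (simp add: algebra_simps)
      from t0(2)[OF this] show ?thesis by (simp only: periodic_int[of c L, OF per])
    qed
    then show ?thesis using that by blast
  qed
  have im0: "Im (c' t0) = 0"
  proof -
    have "((\<lambda>t. Im (c t)) has_real_derivative Im (c' t0)) (at t0)"
      using bounded_linear.has_vector_derivative[OF bounded_linear_Im c]
      by (simp add: has_real_derivative_iff_has_vector_derivative)
    then show ?thesis by (rule DERIV_local_min[of _ _ _ 1]) (use t0 in auto)
  qed
  \<comment> \<open>An intersection of half-planes is convex, hence contractible; this supplies a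
    continuous logarithm of the zero-free \<open>g\<close> on the triangle.\<close>
  define T where "T = {p. t0 \<le> fst p \<and> fst p \<le> snd p \<and> snd p \<le> t0 + L}"
  have T: "T = {p. inner (-1, 0) p \<le> - t0} \<inter> {p. inner (1, -1) p \<le> 0} \<inter> {p. inner (0, 1) p \<le> t0 + L}"
    by (auto simp: T_def inner_prod_def)
  have "convex T"
    unfolding T by (intro convex_Int convex_halfspace_le)
  have gnz: "g p \<noteq> 0" if "p \<in> T" for p
  proof -
    obtain s t where p: "p = (s, t)" by fastforce
    have st: "t0 \<le> s" "s \<le> t" "t \<le> t0 + L" using that by (auto simp: T_def p)
    consider "s = t" | "s < t" "t < s + L" | "t = s + L" using st by linarith
    then show ?thesis
    proof cases
      case 2
      then have "1 / (t - s) + 1 / (L - (t - s)) > 0" by (simp add: add_pos_pos)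
      then show ?thesis unfolding p gs[OF 2] using cinj[OF 2] by (metis eq_iff_diff_eq_0 mult_eq_0_iff of_real_eq_0_iff less_irrefl)
    qed (auto simp: p gd gL c'nz)
  qed
  obtain h where h: "continuous_on T h" "\<And>p. p \<in> T \<Longrightarrow> g p = exp (h p)"
    using continuous_logarithm_on_contractible[OF gc convex_imp_contractible[OF \<open>convex T\<close>]] gnz by metis
  have ge0: "0 \<le> Im (g (t0, t))" if "t \<in> {t0..t0 + L}" for t
  proof -
    consider "t = t0" | "t0 < t" "t < t0 + L" | "t = t0 + L" using \<open>t \<in> _\<close> by fastforce
    then show ?thesis
    proof cases
      case 2
      then have "1 / (t - t0) + 1 / (L - (t - t0)) > 0" by (simp add: add_pos_pos)
      moreover have "Im (c t - c t0) \<ge> 0" using t0[of t] by simp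
      ultimately show ?thesis unfolding gs[OF 2] by simp
    qed (use im0 in \<open>auto simp: gd gL\<close>)
  qed
  have le0: "Im (g (s, t0 + L)) \<le> 0" if "s \<in> {t0..t0 + L}" for s
  proof -
    consider "s = t0" | "s < t0 + L" "t0 + L < s + L" | "s = t0 + L" using \<open>s \<in> _\<close> by fastforce
    then show ?thesis
    proof cases
      case 2
      then have "1 / (t0 + L - s) + 1 / (L - (t0 + L - s)) > 0" by (simp add: add_pos_pos)
      moreover have "Im (c (t0 + L) - c s) \<le> 0" using t0[of s] per by simp
      ultimately show ?thesis unfolding gs[OF 2] by (simp add: mult_le_0_iff)
    qed (use im0 perc' in \<open>auto simp: gd gL\<close>)
  qed
  have sub: "(\<lambda>t. (t0, t)) ` {t0..t0 + L} \<subseteq> T" "(\<lambda>s. (s, t0 + L)) ` {t0..t0 + L} \<subseteq> T"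
    "(\<lambda>s. (s, s)) ` {t0..t0 + L} \<subseteq> T"
    by (auto simp: T_def)
  have mem: "(t0, t) \<in> T" "(t, t0 + L) \<in> T" "(t, t) \<in> T" if "t \<in> {t0..t0 + L}" for t
    using that by (auto simp: T_def)
  have leg1: "h (t0, t0 + L) - h (t0, t0) = Ln (- \<i> * g (t0, t0 + L)) - Ln (- \<i> * g (t0, t0))"
    by (rule log_increment_half_plane)
      (use \<open>L > 0\<close> ge0 sub mem h(2)[symmetric] in \<open>auto intro!: continuous_on_compose2[OF h(1)] continuous_on_compose2[OF gc[of UNIV]] continuous_intros\<close>)
  have leg2: "h (t0 + L, t0 + L) - h (t0, t0 + L) = Ln (\<i> * g (t0 + L, t0 + L)) - Ln (\<i> * g (t0, t0 + L))"
    by (rule log_increment_half_plane)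
      (use \<open>L > 0\<close> le0 sub mem h(2)[symmetric] in \<open>auto intro!: continuous_on_compose2[OF h(1)] continuous_on_compose2[OF gc[of UNIV]] continuous_intros\<close>)
  have diag: "h (t0 + L, t0 + L) - h (t0, t0) = \<Lambda> (t0 + L) - \<Lambda> t0"
    by (rule log_increment_unique[where k = 1])
      (use \<open>L > 0\<close> sub mem h(2)[symmetric] gd \<Lambda> in \<open>auto intro!: continuous_on_compose2[OF h(1)] continuous_on_subset[OF \<Lambda>(1)] continuous_intros\<close>)
  define x where "x = Re (c' t0)"
  have cx: "c' t0 = of_real x" using im0 by (simp add: x_def complex_eq_iff)
  have "x \<noteq> 0" using c'nz[of t0] cx by auto
  \<comment> \<open>Since \<open>g (t0, t0 + L) = - c' t0\<close>, both legs contribute the same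
    increment: half a turn, in a sense that depends on the sign of \<open>x\<close>.\<close>
  have "\<Lambda> (t0 + L) - \<Lambda> t0 = 2 * (Ln (\<i> * of_real x) - Ln (- \<i> * of_real x))"
    using arg_cong2[OF leg1 leg2, of "(+)"] diag by (simp add: gd gL perc' cx)
  moreover have "\<bar>Im (Ln (\<i> * of_real x) - Ln (- \<i> * of_real x))\<bar> = pi"
  proof -
    have *: "\<bar>Im (Ln (\<i> * of_real x) - Ln (- \<i> * of_real x))\<bar> = pi" if "x > 0" for x
    proof -
      have "Im (Ln (of_real x * \<i>)) = pi / 2" "Im (Ln (of_real x * (- \<i>))) = - pi / 2"
        using Ln_times_of_real[OF that, of \<i>] Ln_times_of_real[OF that, of "-\<i>"] that
        by (simp_all flip: Ln_of_real)
      then have "Im (Ln (\<i> * of_real x)) = pi / 2" "Im (Ln (- \<i> * of_real x)) = - pi / 2"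
        by (simp_all only: mult.commute)
      then show ?thesis by (simp only: minus_complex.sel) simp
    qed
    show ?thesis
    proof (cases "x > 0")
      case False
      then show ?thesis using *[of "-x"] \<open>x \<noteq> 0\<close> by simp
    qed (use * in blast)
  qed
  ultimately have "\<bar>Im (\<Lambda> (t0 + L) - \<Lambda> t0)\<bar> = 2 * pi"
    by (simp add: abs_mult)
  then show ?thesis using that by blast
qed

text \<open>The tangent angle \<open>\<Theta>\<close> has positive derivative and grows by exactly
  \<open>2 * pi\<close> per period, so it can be inverted, and \<open>c\<close> composed with its
  inverse has period \<open>2 * pi\<close>.\<close>

lemma oval_angle_parametrisation:
  assumes "oval c L"
  obtains \<gamma> :: "real \<Rightarrow> complex" and \<rho> \<Theta> v :: "real \<Rightarrow> real" and m M :: real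
  where "\<And>s. (\<gamma> has_vector_derivative of_real (\<rho> s) * cis s) (at s)"
    "\<And>s. \<gamma> (s + 2 * pi) = \<gamma> s" "0 < m" "\<And>s. m \<le> \<rho> s" "\<And>s. \<rho> s \<le> M"
    "\<And>t. c t = \<gamma> (\<Theta> t)" "\<And>t. tangent_vec c t = of_real (v t) * cis (\<Theta> t)" "\<And>t. v t > 0"
    "surj \<Theta>" "oval_domain c L = convex hull (range \<gamma>)"
proof -
  obtain D :: "nat \<Rightarrow> real \<Rightarrow> complex" where L: "L > 0" and per: "\<And>t. c (t + L) = c t"
    and inj: "inj_on c {0..<L}" and D0: "D 0 = c"
    and D: "\<And>n t. (D n has_vector_derivative D (Suc n) t) (at t)"
    and curv: "\<And>t. cross2 (D 1 t) (D 2 t) > 0"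
    using assms unfolding oval_def by blast
  have c: "(c has_vector_derivative D 1 t) (at t)" for t using D[of 0] by (simp add: D0)
  have c1: "(D 1 has_vector_derivative D 2 t) (at t)" for t using D[of 1] by (simp add: numeral_2_eq_2)
  have contD: "continuous_on UNIV (D n)" for n
    using D by (meson continuous_at_imp_continuous_on has_vector_derivative_continuous)
  have nz: "D 1 t \<noteq> 0" for t using curv[of t] by (auto simp: cross2_def)
  have tv: "tangent_vec c t = D 1 t" for t
    unfolding tangent_vec_def using c by (rule vector_derivative_at)
  have shift: "((\<lambda>x. x + L) has_vector_derivative 1) (at t)" for t
    by (auto intro!: derivative_eq_intros simp: has_real_derivative_iff_has_vector_derivative[symmetric])
  have per1: "D 1 (t + L) = D 1 t" for t
  proof -
    have "(c has_vector_derivative D 1 (t + L)) (at t)"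
      using vector_diff_chain_at[OF shift[of t] c] by (simp add: o_def per)
    then show ?thesis using c vector_derivative_at by metis
  qed
  have per2: "D 2 (t + L) = D 2 t" for t
  proof -
    have "(D 1 has_vector_derivative D 2 (t + L)) (at t)"
      using vector_diff_chain_at[OF shift[of t] c1] by (simp add: o_def per1[unfolded One_nat_def])
    then show ?thesis using c1 vector_derivative_at by metis
  qed
  \<comment> \<open>A logarithm of the velocity \<open>D 1\<close> must have derivative
    \<open>D 2 t / D 1 t\<close>. The imaginary part of this quotient is the angular speed of the
    tangent.\<close>
  obtain F where F: "\<And>t. (F has_vector_derivative D 2 t / D 1 t) (at t)"
    using antiderivative_exists[of "\<lambda>t. D 2 t / D 1 t"] contD nz
    by (metis continuous_on_divide)
  define \<Lambda> where "\<Lambda> = (\<lambda>t. F t + (Ln (D 1 0) - F 0))"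
  have dL: "(\<Lambda> has_vector_derivative D 2 t / D 1 t) (at t)" for t
    unfolding \<Lambda>_def using has_vector_derivative_add[OF F has_vector_derivative_const] by simp
  have eL: "exp (\<Lambda> t) = D 1 t" for t
  proof -
    have "((\<lambda>t. D 1 t * exp (- \<Lambda> t)) has_derivative (\<lambda>h. 0)) (at t)" for t
    proof -
      have "((\<lambda>t. exp (- \<Lambda> t)) has_vector_derivative - (D 2 t / D 1 t) * exp (- \<Lambda> t)) (at t)"
        using field_vector_diff_chain_at[OF has_vector_derivative_minus[OF dL] DERIV_exp]
        by (simp add: o_def)
      from has_vector_derivative_mult[OF c1 this]
      show ?thesis using nz by (simp add: has_vector_derivative_def)
    qed
    then have "\<exists>k. \<forall>t\<in>UNIV. D 1 t * exp (- \<Lambda> t) = k"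
      by (intro has_derivative_zero_constant) auto
    then obtain k where k: "\<And>t. D 1 t * exp (- \<Lambda> t) = k" by blast
    have "k = 1" using k[of 0] nz by (simp add: \<Lambda>_def exp_minus)
    then show ?thesis using k[of t] by (simp add: exp_minus field_simps)
  qed
  define \<Theta> where "\<Theta> = (\<lambda>t. Im (\<Lambda> t))"
  define v where "v = (\<lambda>t. exp (Re (\<Lambda> t)))"
  define \<kappa> where "\<kappa> = (\<lambda>t. Im (D 2 t / D 1 t))"
  have D1: "D 1 t = of_real (v t) * cis (\<Theta> t)" for t
    unfolding eL[symmetric] v_def \<Theta>_def by (metis exp_eq_polar exp_of_real)
  have kpos: "\<kappa> t > 0" for t
  proof -
    have "\<kappa> t = cross2 (D 1 t) (D 2 t) / (cmod (D 1 t))\<^sup>2"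
      by (simp add: \<kappa>_def Im_divide cross2_expand cmod_power2 algebra_simps)
    then show ?thesis using curv nz by simp
  qed
  have kper: "\<kappa> (t + L) = \<kappa> t" for t by (simp only: \<kappa>_def per1 per2)
  have kcont: "continuous_on UNIV \<kappa>"
    unfolding \<kappa>_def by (intro continuous_intros contD) (use nz in blast)
  have Th: "(\<Theta> has_real_derivative \<kappa> t) (at t)" for t
    unfolding \<Theta>_def \<kappa>_def using bounded_linear.has_vector_derivative[OF bounded_linear_Im dL]
    by (simp add: has_real_derivative_iff_has_vector_derivative)
  have Lcont: "continuous_on UNIV \<Lambda>"
    using dL by (meson continuous_at_imp_continuous_on has_vector_derivative_continuous)
  obtain t0 where t0: "\<bar>Im (\<Lambda> (t0 + L) - \<Lambda> t0)\<bar> = 2 * pi"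
    using turning_number_simple_closed[OF L per inj c contD Lcont eL] by blast
  have Th_mono: "\<Theta> s < \<Theta> t" if "s < t" for s t
    by (rule DERIV_pos_imp_increasing[OF that]) (use Th kpos in blast)
  \<comment> \<open>Hopf's theorem gives the absolute value of the increment at one point;
    monotonicity of \<open>\<Theta>\<close> fixes its sign, and periodicity of
    \<open>\<kappa>\<close> makes the increment constant.\<close>
  have Tper: "\<Theta> (t + L) = \<Theta> t + 2 * pi" for t
  proof -
    have "((\<lambda>t. \<Theta> (t + L) - \<Theta> t) has_real_derivative 0) (at t)" for t
      using DERIV_diff[OF DERIV_shift[THEN iffD1, OF Th[of "t + L"]] Th[of t]] kper
      by simp
    then have "\<Theta> (t + L) - \<Theta> t = \<Theta> (t0 + L) - \<Theta> t0"
      using DERIV_isconst_all[of "\<lambda>t. \<Theta> (t + L) - \<Theta> t"] by blast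
    then show ?thesis using t0 Th_mono[of t0 "t0 + L"] L by (simp add: \<Theta>_def)
  qed
  \<comment> \<open>The function \<open>\<Theta> t - 2 * pi * t / L\<close> is periodic.\<close>
  have Tn: "\<Theta> (L * of_int n) = \<Theta> 0 + 2 * pi * of_int n" for n :: int
    using periodic_int[of "\<lambda>t. \<Theta> t - 2 * pi * t / L" L 0 n] Tper L by (simp add: field_simps)
  have lo: "\<exists>x. \<Theta> x \<le> y" and hi: "\<exists>x. y \<le> \<Theta> x" for y
  proof -
    have "\<Theta> (L * of_int \<lfloor>(y - \<Theta> 0) / (2 * pi)\<rfloor>) \<le> y"
      unfolding Tn using floor_divide_lower[of "2 * pi" "y - \<Theta> 0"] pi_gt_zero by (simp add: algebra_simps)
    then show "\<exists>x. \<Theta> x \<le> y" by blast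
    have "y \<le> \<Theta> (L * of_int \<lceil>(y - \<Theta> 0) / (2 * pi)\<rceil>)"
      unfolding Tn using ceiling_divide_upper[of "2 * pi" "y - \<Theta> 0"] pi_gt_zero by (simp add: algebra_simps)
    then show "\<exists>x. y \<le> \<Theta> x" by blast
  qed
  obtain \<tau> where \<tau>: "\<And>t. \<tau> (\<Theta> t) = t" "\<And>s. \<Theta> (\<tau> s) = s"
    "\<And>s. (\<tau> has_real_derivative 1 / \<kappa> (\<tau> s)) (at s)"
    using inverse_function_exists[OF Th kpos lo hi] by blast
  define \<gamma> where "\<gamma> = (\<lambda>s. c (\<tau> s))"
  \<comment> \<open>Speed over angular speed is the radius of curvature. By continuity and
    periodicity it attains a positive minimum and a maximum, which become \<open>m\<close> and
    \<open>M\<close>.\<close>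
  define q where "q = (\<lambda>t. v t / \<kappa> t)"
  define \<rho> where "\<rho> = (\<lambda>s. q (\<tau> s))"
  have d\<gamma>: "(\<gamma> has_vector_derivative of_real (\<rho> s) * cis s) (at s)" for s
  proof -
    have "(\<tau> has_vector_derivative 1 / \<kappa> (\<tau> s)) (at s)"
      using \<tau>(3) by (simp add: has_real_derivative_iff_has_vector_derivative)
    from vector_diff_chain_at[OF this c] show ?thesis
      by (simp add: \<gamma>_def \<rho>_def q_def o_def D1[unfolded One_nat_def] \<tau>(2) scaleR_conv_of_real)
  qed
  have tper: "\<tau> (s + 2 * pi) = \<tau> s + L" for s
    by (metis \<tau>(1) \<tau>(2) Tper)
  have vper: "v (t + L) = v t" for t
  proof -
    have "v t = cmod (D 1 t)" for t unfolding v_def eL[symmetric] by simp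
    then show ?thesis by (simp only: per1)
  qed
  have qper: "q (t + L) = q t" for t by (simp add: q_def vper kper)
  have qpos: "q t > 0" for t using kpos by (simp add: q_def v_def)
  have qcont: "continuous_on {0..L} q"
    unfolding q_def v_def
    by (intro continuous_intros continuous_on_subset[OF kcont] continuous_on_subset[OF Lcont])
      (use kpos less_imp_neq in \<open>auto simp: less_imp_neq[OF kpos, symmetric]\<close>)
  obtain t1 where t1: "\<And>t. t \<in> {0..L} \<Longrightarrow> q t1 \<le> q t"
    using continuous_attains_inf[OF _ _ qcont] L by (auto simp del: atLeastAtMost_iff)
  obtain t2 where t2: "\<And>t. t \<in> {0..L} \<Longrightarrow> q t \<le> q t2"
    using continuous_attains_sup[OF _ _ qcont] L by (auto simp del: atLeastAtMost_iff)
  have red: "t + L * of_int (- \<lfloor>t / L\<rfloor>) \<in> {0..L}" for t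
    using floor_divide_lower[OF L, of t] floor_divide_upper[OF L, of t] by (simp add: algebra_simps)
  have qb: "q t1 \<le> q t" "q t \<le> q t2" for t
    using t1[OF red[of t]] t2[OF red[of t]] unfolding periodic_int[of q L, OF qper] by auto
  have img: "c ` {0..L} = range \<gamma>"
  proof
    show "c ` {0..L} \<subseteq> range \<gamma>" by (auto simp: \<gamma>_def image_iff) (metis \<tau>(1))
    show "range \<gamma> \<subseteq> c ` {0..L}"
    proof
      fix x assume "x \<in> range \<gamma>"
      then obtain s where "x = c (\<tau> s)" by (auto simp: \<gamma>_def)
      also have "\<dots> = c (\<tau> s + L * of_int (- \<lfloor>\<tau> s / L\<rfloor>))" by (rule periodic_int[of c L, OF per, symmetric])
      finally show "x \<in> c ` {0..L}" using red by blast
    qed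
  qed
  show ?thesis
  proof (rule that[of \<gamma> \<rho> "q t1" "q t2" \<Theta> v])
    show "surj \<Theta>" using \<tau>(2) by (metis surjI)
    show "oval_domain c L = convex hull range \<gamma>" by (simp only: oval_domain_def img)
  qed (use d\<gamma> tper qpos qb D1 tv \<tau> in \<open>auto simp: \<gamma>_def \<rho>_def per v_def\<close>)
qed

section \<open>Convex curves parametrised by the tangent angle\<close>

lemma cross2_linear:
  "cross2 a (x + y) = cross2 a x + cross2 a y" "cross2 a (x - y) = cross2 a x - cross2 a y"
  "cross2 a (of_real k * x) = k * cross2 a x" "cross2 a (- x) = - cross2 a x"
  "cross2 (a + b) x = cross2 a x + cross2 b x" "cross2 (a - b) x = cross2 a x - cross2 b x"
  "cross2 (- a) x = - cross2 a x"
  by (auto simp: cross2_expand algebra_simps)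

lemma cross2_cis: "cross2 (cis a) (cis b) = sin (b - a)"
  by (simp add: cross2_expand sin_diff algebra_simps)

lemma cross2_i_cis: "cross2 (cis a) (\<i> * cis b) = cos (b - a)"
  by (simp add: cross2_expand cos_diff algebra_simps)

lemma cross2_cis_self [simp]: "cross2 (cis a) (cis a) = 0"
  by (simp add: cross2_cis)

lemma abs_cross2_le: "\<bar>cross2 a b\<bar> \<le> cmod a * cmod b"
  unfolding cross2_def by (metis abs_Im_le_cmod complex_mod_cnj norm_mult)

lemma cis_plus_pi: "cis (a + pi) = - cis a" by (simp add: complex_eq_iff)

lemma cross2_zero_imp_multiple:
  assumes "cross2 (cis a) x = 0"
  shows "x = of_real (Re (cnj (cis a) * x)) * cis a"
proof -
  have "cnj (cis a) * x = of_real (Re (cnj (cis a) * x))"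
    using assms by (simp add: cross2_def complex_eq_iff)
  then have "cis a * (cnj (cis a) * x) = of_real (Re (cnj (cis a) * x)) * cis a"
    by (metis mult.commute)
  moreover have "cis a * (cnj (cis a) * x) = x"
    by (simp add: cis_cnj mult.assoc[symmetric] cis_mult)
  ultimately show ?thesis by simp
qed

lemma cos_eq_1_imp_cis: "cos (s - t) = 1 \<Longrightarrow> cis s = cis t"
proof -
  assume "cos (s - t) = 1"
  then obtain n :: int where "s - t = n * (2 * pi)" unfolding cos_one_2pi_int by auto
  then have s: "s = t + 2 * pi * n" by (simp add: algebra_simps)
  show ?thesis unfolding s by (rule periodic_int) (simp add: complex_eq_iff)
qed

text \<open>With the tangent angle as parameter, \<open>\<rho>\<close> is the radius of curvature;
  circles of radius \<open>m\<close> and \<open>M\<close> serve as comparison curves.\<close>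

locale angle_curve =
  fixes \<gamma> :: "real \<Rightarrow> complex" and \<rho> :: "real \<Rightarrow> real" and m M :: real
  assumes deriv: "\<And>s. (\<gamma> has_vector_derivative of_real (\<rho> s) * cis s) (at s)"
    and per: "\<And>s. \<gamma> (s + 2 * pi) = \<gamma> s"
    and m_pos: "0 < m" and m_le: "\<And>s. m \<le> \<rho> s" and le_M: "\<And>s. \<rho> s \<le> M"
begin

lemma M_pos: "0 < M" using m_pos m_le[of 0] le_M[of 0] by linarith

lemma rho_pos: "0 < \<rho> s" using m_pos m_le[of s] by linarith

lemma gamma_cis_cong: "cis s = cis t \<Longrightarrow> \<gamma> s = \<gamma> t"
  using cis_eq_imp_int_multiple periodic_int[of \<gamma> "2 * pi", OF per] by metis

definition px :: "real \<Rightarrow> real" where "px s = Re (\<gamma> s)"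

definition py :: "real \<Rightarrow> real" where "py s = Im (\<gamma> s)"

lemma px_deriv: "(px has_real_derivative \<rho> s * cos s) (at s)"
  and py_deriv: "(py has_real_derivative \<rho> s * sin s) (at s)"
  using bounded_linear.has_vector_derivative[OF bounded_linear_Re deriv[of s]]
    bounded_linear.has_vector_derivative[OF bounded_linear_Im deriv[of s]]
  by (simp_all add: has_real_derivative_iff_has_vector_derivative px_def[abs_def] py_def[abs_def])

text \<open>\<open>height \<psi> s\<close> is the distance of \<open>\<gamma> s\<close> from the tangent line at \<open>\<gamma> \<psi>\<close>, and \<open>shadow \<psi> s\<close> is
  the coordinate of its projection to that line.\<close>

definition height :: "real \<Rightarrow> real \<Rightarrow> real" where
  "height \<psi> s = cross2 (cis \<psi>) (\<gamma> s - \<gamma> \<psi>)"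

definition shadow :: "real \<Rightarrow> real \<Rightarrow> real" where
  "shadow \<psi> s = Re (cnj (cis \<psi>) * (\<gamma> s - \<gamma> \<psi>))"

lemma height_expand: "height \<psi> s = cos \<psi> * (py s - py \<psi>) - sin \<psi> * (px s - px \<psi>)"
  by (simp add: height_def cross2_expand px_def py_def)

lemma shadow_expand: "shadow \<psi> s = cos \<psi> * (px s - px \<psi>) + sin \<psi> * (py s - py \<psi>)"
  by (simp add: shadow_def px_def py_def)

lemma height_deriv2: "(height \<psi> has_real_derivative \<rho> s * sin (s - \<psi>)) (at s)"
  unfolding height_expand[abs_def]
  by (auto intro!: derivative_eq_intros px_deriv py_deriv simp: sin_diff algebra_simps)

text \<open>The foot point \<open>\<gamma> \<psi>\<close> moves parallel to
  \<open>cis \<psi>\<close> and does not affect the height to first order; the turning of the frame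
  exchanges height and shadow. Hence the second derivative in \<open>\<psi>\<close> is
  \<open>\<rho> \<psi> - height \<psi> s\<close>.\<close>

lemma height_deriv1: "((\<lambda>\<psi>. height \<psi> s) has_real_derivative - shadow \<psi> s) (at \<psi>)"
  unfolding height_expand[abs_def] shadow_expand
  by (auto intro!: derivative_eq_intros px_deriv py_deriv simp: algebra_simps)

lemma shadow_deriv1: "((\<lambda>\<psi>. shadow \<psi> s) has_real_derivative height \<psi> s - \<rho> \<psi>) (at \<psi>)"
proof -
  have "((\<lambda>\<psi>. shadow \<psi> s) has_real_derivative
      height \<psi> s - (cos \<psi> * (\<rho> \<psi> * cos \<psi>) + sin \<psi> * (\<rho> \<psi> * sin \<psi>))) (at \<psi>)"
    unfolding shadow_expand[abs_def] height_expand
    by (auto intro!: derivative_eq_intros px_deriv py_deriv simp: algebra_simps)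
  moreover have "cos \<psi> * (\<rho> \<psi> * cos \<psi>) + sin \<psi> * (\<rho> \<psi> * sin \<psi>) = \<rho> \<psi> * ((sin \<psi>)\<^sup>2 + (cos \<psi>)\<^sup>2)"
    by (simp only: power2_eq_square ring_distribs mult_ac add_ac)
  ultimately show ?thesis by simp
qed

lemma angle_reduce: "\<exists>n::int. \<psi> - pi \<le> s + 2 * pi * n \<and> s + 2 * pi * n \<le> \<psi> + pi"
proof
  define n where "n = \<lfloor>(\<psi> + pi - s) / (2 * pi)\<rfloor>"
  have p: "(0::real) < 2 * pi" by simp
  have "n * (2 * pi) \<le> \<psi> + pi - s" "\<psi> + pi - s < (of_int n + 1) * (2 * pi)"
    unfolding n_def using floor_divide_lower[OF p] floor_divide_upper[OF p] by blast+
  then show "\<psi> - pi \<le> s + 2 * pi * n \<and> s + 2 * pi * n \<le> \<psi> + pi" by (simp add: algebra_simps)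
qed

text \<open>A circle of radius \<open>k\<close> has height \<open>k * (1 - cos (s - \<psi>))\<close>
  above its tangent. The derivatives in \<open>s\<close> are compared for \<open>s\<close> within
  \<open>pi\<close> of \<open>\<psi>\<close>, where \<open>sin (s - \<psi>)\<close> has the sign of
  \<open>s - \<psi>\<close>; periodicity does the rest.\<close>

lemma height_ge: "m * (1 - cos (s - \<psi>)) \<le> height \<psi> s"
  and height_le: "height \<psi> s \<le> M * (1 - cos (s - \<psi>))"
proof -
  have *: "m * (1 - cos (s - \<psi>)) \<le> height \<psi> s \<and> height \<psi> s \<le> M * (1 - cos (s - \<psi>))"
    if "\<psi> - pi \<le> s" "s \<le> \<psi> + pi" for s
  proof -
    have d1: "((\<lambda>s. height \<psi> s - m * (1 - cos (s - \<psi>))) has_real_derivative (\<rho> x - m) * sin (x - \<psi>)) (at x)"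
      and d2: "((\<lambda>s. M * (1 - cos (s - \<psi>)) - height \<psi> s) has_real_derivative (M - \<rho> x) * sin (x - \<psi>)) (at x)" for x
      by (auto intro!: derivative_eq_intros height_deriv2 simp: algebra_simps)
    have h0: "height \<psi> \<psi> = 0" by (simp add: height_def cross2_expand)
    show ?thesis
    proof (cases "\<psi> \<le> s")
      case True
      have sg: "0 \<le> sin (x - \<psi>)" if "\<psi> \<le> x" "x \<le> s" for x
        using that \<open>s \<le> \<psi> + pi\<close> by (intro sin_ge_zero) auto
      have "height \<psi> \<psi> - m * (1 - cos (\<psi> - \<psi>)) \<le> height \<psi> s - m * (1 - cos (s - \<psi>))"
        by (rule DERIV_nonneg_imp_nondecreasing[OF True]) (use d1 sg m_le in fastforce)
      moreover have "M * (1 - cos (\<psi> - \<psi>)) - height \<psi> \<psi> \<le> M * (1 - cos (s - \<psi>)) - height \<psi> s"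
        by (rule DERIV_nonneg_imp_nondecreasing[OF True]) (use d2 sg le_M in fastforce)
      ultimately show ?thesis using h0 by simp
    next
      case False
      then have le: "s \<le> \<psi>" by simp
      have sg: "sin (x - \<psi>) \<le> 0" if "s \<le> x" "x \<le> \<psi>" for x
        using that \<open>\<psi> - pi \<le> s\<close> sin_ge_zero[of "\<psi> - x"] sin_minus[of "\<psi> - x"] by simp
      have "height \<psi> s - m * (1 - cos (s - \<psi>)) \<ge> height \<psi> \<psi> - m * (1 - cos (\<psi> - \<psi>))"
        by (rule DERIV_nonpos_imp_nonincreasing[OF le]) (use d1 sg m_le in \<open>fastforce intro: mult_nonneg_nonpos\<close>)
      moreover have "M * (1 - cos (s - \<psi>)) - height \<psi> s \<ge> M * (1 - cos (\<psi> - \<psi>)) - height \<psi> \<psi>"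
        by (rule DERIV_nonpos_imp_nonincreasing[OF le]) (use d2 sg le_M in \<open>fastforce intro: mult_nonneg_nonpos\<close>)
      ultimately show ?thesis using h0 by simp
    qed
  qed
  obtain n :: int where n: "\<psi> - pi \<le> s + 2 * pi * n" "s + 2 * pi * n \<le> \<psi> + pi"
    using angle_reduce by blast
  have "height \<psi> (s + 2 * pi * n) = height \<psi> s"
    by (simp add: height_def periodic_int[of \<gamma> "2 * pi", OF per])
  moreover have "cos (s + 2 * pi * n - \<psi>) = cos (s - \<psi>)"
    using periodic_int[of "\<lambda>s. cos (s - \<psi>)" "2 * pi" s n]
    by (metis (no_types, opaque_lifting) add_diff_eq cos_periodic diff_add_eq)
  ultimately show "m * (1 - cos (s - \<psi>)) \<le> height \<psi> s" "height \<psi> s \<le> M * (1 - cos (s - \<psi>))"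
    using *[OF n] by simp_all
qed

lemma height_le_2M: "height \<psi> s \<le> 2 * M"
proof -
  have "M * (1 - cos (s - \<psi>)) \<le> M * 2"
    using M_pos cos_ge_minus_one[of "s - \<psi>"] by (intro mult_left_mono) auto
  then show ?thesis using height_le[of \<psi> s] by simp
qed

lemma height_nonneg: "0 \<le> height \<psi> s"
proof -
  have "0 \<le> m * (1 - cos (s - \<psi>))" using m_pos by simp
  then show ?thesis using height_ge order_trans by blast
qed

lemma height_pos: "cis s \<noteq> cis \<psi> \<Longrightarrow> 0 < height \<psi> s"
proof -
  assume "cis s \<noteq> cis \<psi>"
  then have "cos (s - \<psi>) < 1" using cos_eq_1_imp_cis cos_le_one by (metis order_less_le)
  then have "0 < m * (1 - cos (s - \<psi>))" using m_pos by simp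
  then show ?thesis using height_ge less_le_trans by blast
qed

lemma height_pos_of_abs: "0 < \<bar>s - \<psi>\<bar> \<Longrightarrow> \<bar>s - \<psi>\<bar> < 2 * pi \<Longrightarrow> 0 < height \<psi> s"
proof (rule height_pos, rule notI)
  assume *: "0 < \<bar>s - \<psi>\<bar>" "\<bar>s - \<psi>\<bar> < 2 * pi" and "cis s = cis \<psi>"
  then obtain n :: int where n: "s = \<psi> + 2 * pi * n" using cis_eq_imp_int_multiple by blast
  then have "\<bar>of_int n\<bar> < (1::real)" "n \<noteq> 0" using * by (auto simp: abs_mult)
  then show False by (metis of_int_abs of_int_less_1_iff abs_not_less_zero zero_less_abs_iff zless_imp_add1_zle not_less add_0)
qed

abbreviation "body \<equiv> convex hull (range \<gamma>)"

lemma body_halfplane: "x \<in> body \<Longrightarrow> cross2 (cis \<psi>) (\<gamma> \<psi>) \<le> cross2 (cis \<psi>) x"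
proof -
  assume x: "x \<in> body"
  have "body \<subseteq> {x. cross2 (cis \<psi>) (\<gamma> \<psi>) \<le> cross2 (cis \<psi>) x}"
  proof (rule hull_minimal)
    show "range \<gamma> \<subseteq> {x. cross2 (cis \<psi>) (\<gamma> \<psi>) \<le> cross2 (cis \<psi>) x}"
      using height_nonneg[of \<psi>] by (auto simp: height_def cross2_linear)
    have "{x. cross2 (cis \<psi>) (\<gamma> \<psi>) \<le> cross2 (cis \<psi>) x} = {x. inner (\<i> * cis \<psi>) x \<ge> cross2 (cis \<psi>) (\<gamma> \<psi>)}"
      by (auto simp: cross2_expand inner_complex_def)
    then show "convex {x. cross2 (cis \<psi>) (\<gamma> \<psi>) \<le> cross2 (cis \<psi>) x}"
      by (simp add: convex_halfspace_ge)
  qed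
  then show ?thesis using x by blast
qed

text \<open>The tangents at \<open>\<alpha>\<close> and \<open>\<alpha> + pi\<close> are parallel
  and enclose the oval, so this is the distance between two support lines.\<close>

definition wid :: "real \<Rightarrow> real" where "wid \<alpha> = height \<alpha> (\<alpha> + pi)"

lemma wid_eq: "wid \<alpha> = cross2 (cis \<alpha>) (\<gamma> (\<alpha> + pi) - \<gamma> \<alpha>)"
  by (simp add: wid_def height_def)

lemma wid_pos: "0 < wid \<alpha>"
  unfolding wid_def by (rule height_pos_of_abs) auto

lemma wid_le: "wid \<alpha> \<le> 2 * M"
  using height_le[of \<alpha> "\<alpha> + pi"] by (simp add: wid_def)

lemma width_eq_wid:
  assumes "oval_domain c L = body"
  shows "width c L \<alpha> = wid \<alpha>"
proof -
  have inn: "x \<bullet> (\<i> * cis \<alpha>) = cross2 (cis \<alpha>) x" for x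
    by (simp add: cross2_expand inner_complex_def algebra_simps)
  have mem: "\<gamma> s \<in> body" for s by (simp add: hull_inc)
  have up: "cross2 (cis \<alpha>) x \<le> cross2 (cis \<alpha>) (\<gamma> (\<alpha> + pi))" if "x \<in> body" for x
    using body_halfplane[OF that, of "\<alpha> + pi"] by (simp add: cis_plus_pi cross2_linear)
  have "(SUP x\<in>body. cross2 (cis \<alpha>) x) = cross2 (cis \<alpha>) (\<gamma> (\<alpha> + pi))"
    using mem up by (intro cSup_eq_maximum) auto
  moreover have "(INF x\<in>body. cross2 (cis \<alpha>) x) = cross2 (cis \<alpha>) (\<gamma> \<alpha>)"
    using mem body_halfplane by (intro cInf_eq_minimum) auto
  ultimately show ?thesis
    by (simp add: width_def assms inn wid_eq cross2_linear)
qed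

text \<open>Heights above any tangent lie between 0 and \<open>2 * M\<close>; two perpendicular
  directions bound both coordinates of the chord.\<close>

lemma gamma_diff_bound: "cmod (\<gamma> s - \<gamma> t) \<le> 4 * M"
proof -
  have "\<bar>cross2 (cis 0) (\<gamma> s - \<gamma> t)\<bar> \<le> 2 * M" "\<bar>cross2 (cis (pi / 2)) (\<gamma> s - \<gamma> t)\<bar> \<le> 2 * M"
  proof -
    have "\<bar>cross2 (cis \<alpha>) (\<gamma> s - \<gamma> t)\<bar> \<le> 2 * M" for \<alpha>
    proof -
      have b: "0 \<le> height \<alpha> x" "height \<alpha> x \<le> 2 * M" for x by (rule height_nonneg, rule height_le_2M)
      show ?thesis using b[of s] b[of t] by (simp add: height_def cross2_linear abs_le_iff)
    qed
    then show "\<bar>cross2 (cis 0) (\<gamma> s - \<gamma> t)\<bar> \<le> 2 * M" "\<bar>cross2 (cis (pi / 2)) (\<gamma> s - \<gamma> t)\<bar> \<le> 2 * M" by blast+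
  qed
  then have "\<bar>Im (\<gamma> s - \<gamma> t)\<bar> \<le> 2 * M" "\<bar>Re (\<gamma> s - \<gamma> t)\<bar> \<le> 2 * M"
    by (simp_all add: cross2_expand)
  then show ?thesis using cmod_le[of "\<gamma> s - \<gamma> t"] by linarith
qed

text \<open>The chord that realises the width at \<open>\<alpha>\<close> has at most the width at
  \<open>\<beta>\<close> as its extent normal to \<open>cis \<beta>\<close>. Stating the bound
  through \<open>cis\<close> shows at once that the width depends only on the direction.\<close>

lemma wid_lipschitz: "\<bar>wid \<alpha> - wid \<beta>\<bar> \<le> 4 * M * cmod (cis \<alpha> - cis \<beta>)"
proof -
  have "wid \<alpha> - wid \<beta> \<le> 4 * M * cmod (cis \<alpha> - cis \<beta>)" for \<alpha> \<beta>
  proof -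
    have "cross2 (cis \<beta>) (\<gamma> (\<alpha> + pi) - \<gamma> \<alpha>) \<le> wid \<beta>"
      using height_nonneg[of \<beta> \<alpha>] height_nonneg[of "\<beta> + pi" "\<alpha> + pi"]
      by (simp add: wid_eq height_def cis_plus_pi cross2_linear)
    then have "wid \<alpha> - wid \<beta> \<le> cross2 (cis \<alpha> - cis \<beta>) (\<gamma> (\<alpha> + pi) - \<gamma> \<alpha>)"
      by (simp add: wid_eq cross2_linear)
    also have "\<dots> \<le> cmod (cis \<alpha> - cis \<beta>) * cmod (\<gamma> (\<alpha> + pi) - \<gamma> \<alpha>)"
      using abs_cross2_le abs_le_D1 by blast
    also have "\<dots> \<le> cmod (cis \<alpha> - cis \<beta>) * (4 * M)"
      by (intro mult_left_mono gamma_diff_bound) simp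
    finally show ?thesis by (simp add: mult.commute)
  qed
  from this[of \<alpha> \<beta>] this[of \<beta> \<alpha>] show ?thesis by (simp add: abs_le_iff norm_minus_commute)
qed

end

section \<open>Half-planes, angles and tangent lines of circles\<close>

lemma cross2_decompose: "of_real (cross2 a b) * z = of_real (cross2 a z) * b - of_real (cross2 b z) * a"
  by (simp add: cross2_expand complex_eq_iff algebra_simps)

lemma cross2_i_self: "cmod n = 1 \<Longrightarrow> cross2 n (\<i> * n) = 1"
proof -
  assume "cmod n = 1"
  then have "(Re n)\<^sup>2 + (Im n)\<^sup>2 = 1" using cmod_power2[of n] by simp
  then show ?thesis by (simp add: cross2_expand power2_eq_square)
qed

text \<open>The inward unit normal is \<open>\<i> * n\<close>, so the critical point of the disc is
  \<open>Z - of_real r * (\<i> * n)\<close>.\<close>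

lemma cball_subset_halfplane_iff:
  assumes n: "cmod n = 1" and r: "r \<ge> 0"
  shows "cball Z r \<subseteq> {x. 0 \<le> cross2 n (x - A)} \<longleftrightarrow> r \<le> cross2 n (Z - A)"
proof
  assume sub: "cball Z r \<subseteq> {x. 0 \<le> cross2 n (x - A)}"
  have "Z - of_real r * (\<i> * n) \<in> cball Z r"
    using n r by (simp add: dist_norm norm_mult)
  then have "0 \<le> cross2 n (Z - of_real r * (\<i> * n) - A)" using sub by blast
  also have "\<dots> = cross2 n (Z - A) - r"
    unfolding cross2_linear cross2_i_self[OF n] by simp
  finally show "r \<le> cross2 n (Z - A)" by simp
next
  assume le: "r \<le> cross2 n (Z - A)"
  show "cball Z r \<subseteq> {x. 0 \<le> cross2 n (x - A)}"
  proof
    fix x assume "x \<in> cball Z r"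
    then have "cmod (x - Z) \<le> r" by (simp add: dist_norm norm_minus_commute)
    then have "\<bar>cross2 n (x - Z)\<bar> \<le> r" using abs_cross2_le[of n "x - Z"] n by simp
    then show "x \<in> {x. 0 \<le> cross2 n (x - A)}" using le by (simp add: cross2_linear)
  qed
qed

lemma angle_region_eq:
  assumes sin: "0 < sin (\<theta> - \<phi>)" and a: "0 < a" and p: "0 < p"
  shows "angle_region A (of_real a * cis \<theta>) (of_real p * cis \<phi>)
    = {x. 0 \<le> cross2 (- cis \<theta>) (x - A)} \<inter> {x. 0 \<le> cross2 (cis \<phi>) (x - A)}"
proof (intro set_eqI iffI)
  have sin': "sin (\<phi> - \<theta>) = - sin (\<theta> - \<phi>)" using sin_minus[of "\<theta> - \<phi>"] by simp
  {
    fix x assume "x \<in> angle_region A (of_real a * cis \<theta>) (of_real p * cis \<phi>)"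
    then obtain s t where st: "s \<ge> 0" "t \<ge> 0" and x: "x - A = of_real s * (of_real a * cis \<theta>) + of_real t * (of_real p * cis \<phi>)"
      unfolding angle_region_def by (auto simp: algebra_simps)
    show "x \<in> {x. 0 \<le> cross2 (- cis \<theta>) (x - A)} \<inter> {x. 0 \<le> cross2 (cis \<phi>) (x - A)}"
      unfolding mem_Collect_eq Int_iff x using st a p sin
      by (simp add: cross2_linear cross2_cis sin')
  next
    fix x assume "x \<in> {x. 0 \<le> cross2 (- cis \<theta>) (x - A)} \<inter> {x. 0 \<le> cross2 (cis \<phi>) (x - A)}"
    then have h: "cross2 (cis \<theta>) (x - A) \<le> 0" "0 \<le> cross2 (cis \<phi>) (x - A)" by (auto simp: cross2_linear)
    define s where "s = cross2 (cis \<phi>) (x - A) / (a * sin (\<theta> - \<phi>))"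
    define t where "t = - cross2 (cis \<theta>) (x - A) / (p * sin (\<theta> - \<phi>))"
    have "s \<ge> 0" "t \<ge> 0" using h a p sin by (simp_all add: s_def t_def divide_nonpos_pos)
    moreover have "x = A + of_real s * (of_real a * cis \<theta>) + of_real t * (of_real p * cis \<phi>)"
    proof -
      \<comment> \<open>Cramer's rule in the basis \<open>cis \<phi>\<close>,
        \<open>cis \<theta>\<close>, whose determinant is
        \<open>sin (\<theta> - \<phi>)\<close>.\<close>
      have "x - A = of_real (cross2 (cis \<phi>) (x - A) / sin (\<theta> - \<phi>)) * cis \<theta>
          - of_real (cross2 (cis \<theta>) (x - A) / sin (\<theta> - \<phi>)) * cis \<phi>"
        using cross2_decompose[of "cis \<phi>" "cis \<theta>" "x - A"] sin
        unfolding cross2_cis by (simp add: field_simps del: of_real_diff)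
      moreover have "cross2 (cis \<phi>) (x - A) / sin (\<theta> - \<phi>) = s * a"
        "cross2 (cis \<theta>) (x - A) / sin (\<theta> - \<phi>) = - t * p"
        using a p sin by (simp_all add: s_def t_def)
      ultimately show ?thesis by (simp add: algebra_simps)
    qed
    ultimately show "x \<in> angle_region A (of_real a * cis \<theta>) (of_real p * cis \<phi>)"
      unfolding angle_region_def by blast
  }
qed

lemma line_scale: "k \<noteq> 0 \<Longrightarrow> line q (of_real k * u) = line q u"
proof -
  assume k: "k \<noteq> 0"
  have "q + of_real s * u = q + of_real (s / k) * (of_real k * u)" for s using k by simp
  moreover have "q + of_real s * (of_real k * u) = q + of_real (s * k) * u" for s by simp
  ultimately show ?thesis unfolding line_def by blast
qed

lemma line_shift: "line (q + of_real x * u) u = line q u"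
proof -
  have "q + of_real x * u + of_real s * u = q + of_real (x + s) * u"
    "q + of_real s * u = q + of_real x * u + of_real (s - x) * u" for s
    by (simp_all add: algebra_simps)
  then show ?thesis unfolding line_def by blast
qed

lemma in_line_cis_iff: "p \<in> line q (cis s) \<longleftrightarrow> cross2 (cis s) (p - q) = 0"
proof
  assume "cross2 (cis s) (p - q) = 0"
  then have "p = q + of_real (Re (cnj (cis s) * (p - q))) * cis s"
    using cross2_zero_imp_multiple[of s "p - q"] by (simp add: algebra_simps)
  then show "p \<in> line q (cis s)" unfolding line_def by blast
next
  assume "p \<in> line q (cis s)"
  then obtain x where "p = q + of_real x * cis s" unfolding line_def by blast
  then show "cross2 (cis s) (p - q) = 0" by (simp add: cross2_linear)
qed

text \<open>By Pythagoras the points of the line on the circle are the roots of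
  \<open>(x - h)\<^sup>2 + d\<^sup>2 = R\<^sup>2\<close>, where \<open>h\<close> locates the foot of
  the centre and \<open>d\<close> is its signed distance.\<close>

lemma line_tangent_to_circle_iff:
  assumes "R > 0"
  shows "(\<exists>!p. p \<in> line q (cis s) \<inter> sphere Z R) \<longleftrightarrow> \<bar>cross2 (cis s) (Z - q)\<bar> = R"
proof -
  define h where "h = Re (cnj (cis s) * (Z - q))"
  define d where "d = cross2 (cis s) (Z - q)"
  have dist: "(dist Z (q + of_real x * cis s))\<^sup>2 = (x - h)\<^sup>2 + d\<^sup>2" for x
  proof -
    have "dist Z (q + of_real x * cis s) = cmod (cnj (cis s) * (Z - q - of_real x * cis s))"
      by (simp add: dist_norm norm_mult diff_diff_eq)
    also have "cnj (cis s) * (Z - q - of_real x * cis s) = cnj (cis s) * (Z - q) - of_real x"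
      by (simp add: right_diff_distrib cis_cnj cis_mult mult.left_commute)
    also have "\<dots> = Complex (h - x) d"
      by (simp add: complex_eq_iff h_def d_def cross2_def)
    finally show ?thesis by (simp add: cmod_power2 power2_commute)
  qed
  have on: "q + of_real x * cis s \<in> sphere Z R \<longleftrightarrow> (x - h)\<^sup>2 + d\<^sup>2 = R\<^sup>2" for x
    using dist[of x] assms by (simp add: power2_eq_iff_nonneg flip: dist)
  have inj: "q + of_real x * cis s = q + of_real y * cis s \<longleftrightarrow> x = y" for x y by simp
  have "(\<exists>!p. p \<in> line q (cis s) \<inter> sphere Z R) \<longleftrightarrow> (\<exists>!x. (x - h)\<^sup>2 + d\<^sup>2 = R\<^sup>2)"
    (is "?l \<longleftrightarrow> ?r")
  proof
    assume ?l
    then obtain p where p: "p \<in> line q (cis s)" "p \<in> sphere Z R"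
      and u: "\<And>p'. p' \<in> line q (cis s) \<Longrightarrow> p' \<in> sphere Z R \<Longrightarrow> p' = p" by blast
    obtain x where x: "p = q + of_real x * cis s" using p(1) unfolding line_def by blast
    show ?r
    proof (rule ex1I[of _ x])
      show "(x - h)\<^sup>2 + d\<^sup>2 = R\<^sup>2" using p(2) on x by simp
      fix y assume "(y - h)\<^sup>2 + d\<^sup>2 = R\<^sup>2"
      then have "q + of_real y * cis s = p" using u on unfolding line_def by blast
      then show "y = x" using x by simp
    qed
  next
    assume ?r
    then obtain x where x: "(x - h)\<^sup>2 + d\<^sup>2 = R\<^sup>2" and u: "\<And>y. (y - h)\<^sup>2 + d\<^sup>2 = R\<^sup>2 \<Longrightarrow> y = x" by blast
    show ?l
    proof (rule ex1I[of _ "q + of_real x * cis s"])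
      show "q + of_real x * cis s \<in> line q (cis s) \<inter> sphere Z R" using on x unfolding line_def by blast
      fix p assume p: "p \<in> line q (cis s) \<inter> sphere Z R"
      then obtain y where y: "p = q + of_real y * cis s" unfolding line_def by blast
      then have "y = x" using u on p by blast
      then show "p = q + of_real x * cis s" using y by simp
    qed
  qed
  also have "\<dots> \<longleftrightarrow> R\<^sup>2 = d\<^sup>2"
  proof
    assume "\<exists>!x. (x - h)\<^sup>2 + d\<^sup>2 = R\<^sup>2"
    then obtain x where x: "(x - h)\<^sup>2 + d\<^sup>2 = R\<^sup>2" and u: "\<And>y. (y - h)\<^sup>2 + d\<^sup>2 = R\<^sup>2 \<Longrightarrow> y = x" by blast
    \<comment> \<open>The mirror image of a root in the foot \<open>h\<close> is again a root, so a
      single root must be \<open>h\<close>.\<close>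
    have "(2 * h - x - h)\<^sup>2 + d\<^sup>2 = R\<^sup>2" using x by (simp add: power2_eq_square algebra_simps)
    then have "2 * h - x = x" by (rule u)
    then show "R\<^sup>2 = d\<^sup>2" using x by simp
  qed auto
  also have "\<dots> \<longleftrightarrow> \<bar>d\<bar> = R" using assms
    by (metis abs_of_pos power2_abs power2_eq_iff_nonneg abs_ge_zero less_imp_le)
  finally show ?thesis by (simp add: d_def)
qed

section \<open>Exterior points as intersections of two tangent lines\<close>

context angle_curve
begin

text \<open>The length of the tangent segment from the vertex to \<open>\<gamma> \<theta>\<close>: a
  point that far along this tangent is
  \<open>len_pos \<phi> \<theta> * sin (\<theta> - \<phi>)\<close> away from the tangent at
  \<open>\<gamma> \<phi>\<close>. The analogue for \<open>\<gamma> \<phi>\<close> is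
  \<open>len_neg\<close>.\<close>

definition len_pos :: "real \<Rightarrow> real \<Rightarrow> real" where
  "len_pos \<phi> \<theta> = height \<phi> \<theta> / sin (\<theta> - \<phi>)"

definition len_neg :: "real \<Rightarrow> real \<Rightarrow> real" where
  "len_neg \<phi> \<theta> = height \<theta> \<phi> / sin (\<theta> - \<phi>)"

text \<open>The exterior point whose negative and positive tangency points are \<open>\<gamma> \<phi>\<close> and \<open>\<gamma> \<theta>\<close>.\<close>

definition vertex :: "real \<Rightarrow> real \<Rightarrow> complex" where
  "vertex \<phi> \<theta> = \<gamma> \<theta> - of_real (len_pos \<phi> \<theta>) * cis \<theta>"

lemma sin_pos_between: "\<phi> < \<theta> \<Longrightarrow> \<theta> < \<phi> + pi \<Longrightarrow> 0 < sin (\<theta> - \<phi>)"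
  by (rule sin_gt_zero) auto

lemma len_pos_pos: "\<phi> < \<theta> \<Longrightarrow> \<theta> < \<phi> + pi \<Longrightarrow> 0 < len_pos \<phi> \<theta>"
  and len_neg_pos: "\<phi> < \<theta> \<Longrightarrow> \<theta> < \<phi> + pi \<Longrightarrow> 0 < len_neg \<phi> \<theta>"
  unfolding len_pos_def len_neg_def using sin_pos_between height_pos_of_abs by auto

lemma vertex_neg:
  assumes "\<phi> < \<theta>" "\<theta> < \<phi> + pi"
  shows "vertex \<phi> \<theta> = \<gamma> \<phi> + of_real (len_neg \<phi> \<theta>) * cis \<phi>"
proof -
  have s: "0 < sin (\<theta> - \<phi>)" using assms by (rule sin_pos_between)
  have sin': "sin (\<phi> - \<theta>) = - sin (\<theta> - \<phi>)" using sin_minus[of "\<theta> - \<phi>"] by simp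
  have "cross2 (cis \<phi>) (vertex \<phi> \<theta> - \<gamma> \<phi>) = height \<phi> \<theta> - len_pos \<phi> \<theta> * sin (\<theta> - \<phi>)"
    by (simp add: vertex_def height_def cross2_linear cross2_cis)
  then have "cross2 (cis \<phi>) (vertex \<phi> \<theta> - \<gamma> \<phi>) = 0" using s by (simp add: len_pos_def)
  then obtain k where k: "vertex \<phi> \<theta> - \<gamma> \<phi> = of_real k * cis \<phi>"
    using cross2_zero_imp_multiple by blast
  have "0 = cross2 (cis \<theta>) (vertex \<phi> \<theta> - \<gamma> \<theta>)"
    by (simp add: vertex_def cross2_linear)
  also have "vertex \<phi> \<theta> - \<gamma> \<theta> = \<gamma> \<phi> - \<gamma> \<theta> + of_real k * cis \<phi>" using k by (simp add: algebra_simps)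
  also have "cross2 (cis \<theta>) \<dots> = height \<theta> \<phi> - k * sin (\<theta> - \<phi>)"
    by (simp add: height_def cross2_linear cross2_cis sin')
  finally have "k = len_neg \<phi> \<theta>" using s by (simp add: len_neg_def field_simps)
  then show ?thesis using k by (simp add: algebra_simps)
qed

lemma continuous_gamma: "continuous_on S \<gamma>"
  using deriv by (meson continuous_at_imp_continuous_on has_vector_derivative_continuous)

lemma closed_body: "closed body"
proof -
  have "range \<gamma> \<subseteq> \<gamma> ` {-pi..pi}"
  proof
    fix x assume "x \<in> range \<gamma>"
    then obtain s where x: "x = \<gamma> s" by blast
    obtain n :: int where "0 - pi \<le> s + 2 * pi * n" "s + 2 * pi * n \<le> 0 + pi"
      using angle_reduce[of 0 s] by blast
    moreover have "x = \<gamma> (s + 2 * pi * n)" by (simp add: x periodic_int[of \<gamma> "2 * pi", OF per])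
    ultimately show "x \<in> \<gamma> ` {-pi..pi}" by auto
  qed
  then have "range \<gamma> = \<gamma> ` {-pi..pi}" by blast
  then show ?thesis using compact_convex_hull[OF compact_continuous_image[OF continuous_gamma, of "{-pi..pi}"]]
    by (simp add: compact_imp_closed)
qed

text \<open>A line separating \<open>A\<close> from the body has a normal that is a positive
  multiple of \<open>\<i> * cis s\<close> for some \<open>s\<close>; the tangent with this normal
  separates as well.\<close>

lemma exterior_separated:
  assumes "A \<notin> body"
  obtains s where "cross2 (cis s) (A - \<gamma> s) < 0"
proof -
  obtain a b where ab: "a \<bullet> A < b" "\<And>x. x \<in> body \<Longrightarrow> a \<bullet> x > b"
    using separating_hyperplane_closed_point[OF convex_convex_hull closed_body assms] by blast
  define s where "s = Arg a - pi / 2"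
  have "a = of_real (cmod a) * cis (Arg a)" using rcis_cmod_Arg[of a] by (simp add: rcis_def)
  also have "cis (Arg a) = \<i> * cis s" by (simp add: s_def complex_eq_iff cos_diff sin_diff)
  finally have a: "a = of_real (cmod a) * (\<i> * cis s)" .
  have "\<gamma> s \<in> body" by (simp add: hull_inc)
  then have "a \<bullet> (A - \<gamma> s) < 0" using ab(1) ab(2)[of "\<gamma> s"] by (simp add: inner_diff_right)
  also have "a \<bullet> (A - \<gamma> s) = cmod a * cross2 (cis s) (A - \<gamma> s)"
    by (subst a) (simp add: inner_complex_def cross2_expand algebra_simps)
  finally have "cross2 (cis s) (A - \<gamma> s) < 0"
    by (metis mult_less_0_iff norm_ge_zero not_less)
  then show ?thesis using that by blast
qed

text \<open>The signed distance \<open>f x\<close> of \<open>A\<close> from the tangent at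
  \<open>\<gamma> x\<close> is negative at some \<open>s\<close> and positive at
  \<open>s + pi\<close> and \<open>s - pi\<close>. Its zeros on the two sides of \<open>s\<close>
  are the tangents through \<open>A\<close>.\<close>

lemma exterior_is_vertex:
  assumes "A \<notin> body"
  obtains \<phi> \<theta> where "\<phi> < \<theta>" "\<theta> < \<phi> + pi" "A = vertex \<phi> \<theta>"
proof -
  define f where "f = (\<lambda>x. cross2 (cis x) (A - \<gamma> x))"
  obtain s where s: "f s < 0" using exterior_separated[OF assms] f_def by blast
  have cont: "continuous_on S f" for S
    unfolding f_def cross2_def by (intro continuous_intros continuous_gamma)
  have g: "\<gamma> (s - pi) = \<gamma> (s + pi)" using per[of "s - pi"] by (simp add: algebra_simps)
  have c: "cis (s - pi) = - cis s" by (simp add: complex_eq_iff)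
  have "f (s + pi) = wid s - f s" "f (s - pi) = wid s - f s"
    by (simp_all add: f_def wid_eq cis_plus_pi c g cross2_linear)
  then have e: "0 < f (s + pi)" "0 < f (s - pi)" using s wid_pos[of s] by auto
  obtain \<theta> where \<theta>: "s \<le> \<theta>" "\<theta> \<le> s + pi" "f \<theta> = 0"
    using IVT'[of f s 0 "s + pi"] s e cont by (metis less_imp_le pi_ge_zero le_add_same_cancel1)
  obtain \<phi> where \<phi>: "s - pi \<le> \<phi>" "\<phi> \<le> s" "f \<phi> = 0"
    using IVT2'[of f s 0 "s - pi"] s e cont by (metis less_imp_le pi_ge_zero diff_le_eq le_add_same_cancel1)
  have st: "s < \<theta>" "\<theta> < s + pi" "\<phi> < s" using \<theta> \<phi> s e by (metis less_irrefl order_less_le)+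
  obtain k where k: "A - \<gamma> \<theta> = of_real k * cis \<theta>"
    using cross2_zero_imp_multiple[of \<theta> "A - \<gamma> \<theta>"] \<theta>(3) f_def by blast
  have fk: "f x = height x \<theta> + k * sin (\<theta> - x)" for x
  proof -
    have "A - \<gamma> x = (\<gamma> \<theta> - \<gamma> x) + of_real k * cis \<theta>" using k by (simp add: algebra_simps)
    then show ?thesis by (simp add: f_def height_def cross2_linear cross2_cis)
  qed
  have "k * sin (\<theta> - s) < 0" using s fk[of s] height_nonneg[of s \<theta>] by linarith
  then have k0: "k < 0" using sin_pos_between[OF st(1,2)] by (simp add: mult_less_0_iff)
  have b: "0 < \<theta> - \<phi>" "\<theta> - \<phi> < 2 * pi" using st \<phi>(1) by auto
  then have "0 < height \<phi> \<theta>" by (intro height_pos_of_abs) auto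
  then have "k * sin (\<theta> - \<phi>) < 0" using fk[of \<phi>] \<phi>(3) by linarith
  \<comment> \<open>The zeros are so far known only to differ by less than \<open>2 * pi\<close>;
    the positive sine places them less than \<open>pi\<close> apart.\<close>
  then have sp: "0 < sin (\<theta> - \<phi>)" using k0 by (simp add: mult_less_0_iff)
  have lt: "\<theta> < \<phi> + pi"
  proof (rule ccontr)
    assume "\<not> \<theta> < \<phi> + pi"
    then have "sin (\<theta> - \<phi>) \<le> 0" using b by (intro sin_le_zero) auto
    then show False using sp by simp
  qed
  have "- k = len_pos \<phi> \<theta>" using fk[of \<phi>] \<phi>(3) sp by (simp add: len_pos_def field_simps)
  then have "k = - len_pos \<phi> \<theta>" by simp
  then have "A = vertex \<phi> \<theta>" using k by (simp add: vertex_def algebra_simps)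
  then show ?thesis using that b lt by auto
qed

text \<open>If the tangency points differed, each would lie strictly inside the half-plane of the
  other's tangent. This makes \<open>l * sin (t - s)\<close> and \<open>k * sin (s - t)\<close> both
  positive, which is impossible for \<open>k\<close>, \<open>l\<close> of equal sign.\<close>

lemma tangency_point_unique:
  assumes "\<gamma> s - A = of_real k * cis s" "\<gamma> t - A = of_real l * cis t" and kl: "0 < k * l"
  shows "\<gamma> s = \<gamma> t"
proof (rule ccontr)
  assume "\<gamma> s \<noteq> \<gamma> t"
  then have ne: "cis s \<noteq> cis t" using gamma_cis_cong by blast
  have e: "\<gamma> t - \<gamma> s = of_real l * cis t - of_real k * cis s" using assms(1,2) by (simp add: algebra_simps)
  have e': "\<gamma> s - \<gamma> t = of_real k * cis s - of_real l * cis t" using assms(1,2) by (simp add: algebra_simps)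
  have "0 < height s t" "0 < height t s" using height_pos ne by metis+
  then have "0 < l * sin (t - s)" "0 < k * sin (s - t)"
    unfolding height_def e e' by (simp_all add: cross2_linear cross2_cis)
  moreover have "sin (s - t) = - sin (t - s)" using sin_minus[of "t - s"] by simp
  ultimately show False using kl by (auto simp: zero_less_mult_iff mult_less_0_iff)
qed

section \<open>Radii of circles touching two tangent lines\<close>

lemma chord_pos:
  assumes "a < b" "b < a + pi"
  shows "0 < cos ((a + b) / 2) * (px b - px a) + sin ((a + b) / 2) * (py b - py a)"
proof -
  \<comment> \<open>Along an arc of less than half a turn every tangent makes an acute angle with
    the mean direction.\<close>
  define \<mu> where "\<mu> = (a + b) / 2"
  have "cos \<mu> * px a + sin \<mu> * py a < cos \<mu> * px b + sin \<mu> * py b"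
  proof (rule DERIV_pos_imp_increasing[OF assms(1)])
    fix x assume x: "a \<le> x" "x \<le> b"
    have "((\<lambda>x. cos \<mu> * px x + sin \<mu> * py x) has_real_derivative \<rho> x * cos (x - \<mu>)) (at x)"
      by (auto intro!: derivative_eq_intros px_deriv py_deriv simp: cos_diff algebra_simps)
    moreover have "0 < cos (x - \<mu>)"
      using x assms by (intro cos_gt_zero_pi) (auto simp: \<mu>_def field_simps)
    ultimately show "\<exists>y. ((\<lambda>x. cos \<mu> * px x + sin \<mu> * py x) has_real_derivative y) (at x) \<and> 0 < y"
      using rho_pos mult_pos_pos by blast
  qed
  then show ?thesis by (simp add: \<mu>_def algebra_simps)
qed

text \<open>The radius of the circle that touches the tangent at \<open>\<gamma> \<theta>\<close> in
  \<open>\<gamma> \<theta>\<close> from outside and also touches the tangent at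
  \<open>\<gamma> \<psi>\<close>. The angle \<open>\<psi>\<close> may lie on either side of
  \<open>\<theta>\<close>.\<close>

definition ratio :: "real \<Rightarrow> real \<Rightarrow> real" where
  "ratio \<theta> \<psi> = height \<psi> \<theta> / (1 + cos (\<psi> - \<theta>))"

lemma one_plus_cos_pos: "\<bar>x\<bar> < pi \<Longrightarrow> 0 < 1 + cos x"
proof -
  assume "\<bar>x\<bar> < pi"
  then have "cos pi < cos \<bar>x\<bar>" by (intro cos_monotone_0_pi) auto
  then show ?thesis by simp
qed

text \<open>Half-angle formulas pull out a factor \<open>2 * cos ((\<psi> - \<theta>) / 2)\<close>;
  what remains is the chord projected on the mean tangent direction. Its sign is known from
  \<open>chord_pos\<close> and gives monotonicity on either side of \<open>\<theta>\<close>.\<close>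

lemma ratio_deriv:
  assumes "\<bar>\<psi> - \<theta>\<bar> < pi"
  defines "\<mu> \<equiv> (\<psi> + \<theta>) / 2"
  shows "(ratio \<theta> has_real_derivative
    2 * cos ((\<psi> - \<theta>) / 2) * (cos \<mu> * (px \<psi> - px \<theta>) + sin \<mu> * (py \<psi> - py \<theta>)) / (1 + cos (\<psi> - \<theta>))\<^sup>2) (at \<psi>)"
proof -
  define x where "x = (\<psi> - \<theta>) / 2"
  have nz: "1 + cos (\<psi> - \<theta>) \<noteq> 0" using one_plus_cos_pos[OF assms(1)] by simp
  have "((\<lambda>\<psi>. height \<psi> \<theta> / (1 + cos (\<psi> - \<theta>))) has_real_derivative
    ((- shadow \<psi> \<theta>) * (1 + cos (\<psi> - \<theta>)) + height \<psi> \<theta> * sin (\<psi> - \<theta>)) / (1 + cos (\<psi> - \<theta>))\<^sup>2) (at \<psi>)"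
    using nz by (auto intro!: derivative_eq_intros height_deriv1 simp: power2_eq_square)
  moreover have "(- shadow \<psi> \<theta>) * (1 + cos (\<psi> - \<theta>)) + height \<psi> \<theta> * sin (\<psi> - \<theta>)
      = 2 * cos x * (cos \<mu> * (px \<psi> - px \<theta>) + sin \<mu> * (py \<psi> - py \<theta>))"
  proof -
    have x2: "\<psi> - \<theta> = 2 * x" and mu: "\<mu> = \<psi> - x" by (auto simp: x_def \<mu>_def field_simps)
    have c: "1 + cos (\<psi> - \<theta>) = 2 * cos x * cos x" unfolding x2 cos_double_cos by (simp add: power2_eq_square)
    have s: "sin (\<psi> - \<theta>) = 2 * cos x * sin x" unfolding x2 sin_double by simp
    have cm: "cos \<mu> = cos \<psi> * cos x + sin \<psi> * sin x" and sm: "sin \<mu> = sin \<psi> * cos x - cos \<psi> * sin x"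
      unfolding mu by (simp_all add: cos_diff sin_diff)
    show ?thesis unfolding c s cm sm shadow_expand height_expand
      by (simp add: algebra_simps)
  qed
  ultimately show ?thesis unfolding ratio_def[abs_def] x_def by simp
qed

lemma ratio_increasing:
  assumes "\<theta> < a" "a < b" "b < \<theta> + pi"
  shows "ratio \<theta> a < ratio \<theta> b"
proof (rule DERIV_pos_imp_increasing[OF assms(2)])
  fix x assume x: "a \<le> x" "x \<le> b"
  have "0 < cos ((x - \<theta>) / 2)" using x assms by (intro cos_gt_zero_pi) (auto simp: field_simps)
  moreover have "0 < cos ((x + \<theta>) / 2) * (px x - px \<theta>) + sin ((x + \<theta>) / 2) * (py x - py \<theta>)"
    using chord_pos[of \<theta> x] x assms by (simp add: add.commute)
  moreover have "0 < (1 + cos (x - \<theta>))\<^sup>2" using one_plus_cos_pos[of "x - \<theta>"] x assms by auto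
  ultimately have "0 < 2 * cos ((x - \<theta>) / 2) *
      (cos ((x + \<theta>) / 2) * (px x - px \<theta>) + sin ((x + \<theta>) / 2) * (py x - py \<theta>)) / (1 + cos (x - \<theta>))\<^sup>2"
    by simp
  moreover have "\<bar>x - \<theta>\<bar> < pi" using x assms by auto
  ultimately show "\<exists>y. (ratio \<theta> has_real_derivative y) (at x) \<and> 0 < y"
    using ratio_deriv by blast
qed

lemma ratio_decreasing:
  assumes "\<theta> - pi < a" "a < b" "b < \<theta>"
  shows "ratio \<theta> b < ratio \<theta> a"
proof (rule DERIV_neg_imp_decreasing[OF assms(2)])
  fix x assume x: "a \<le> x" "x \<le> b"
  have "0 < cos ((x - \<theta>) / 2)" using x assms by (intro cos_gt_zero_pi) (auto simp: field_simps)
  moreover have "0 < cos ((x + \<theta>) / 2) * (px \<theta> - px x) + sin ((x + \<theta>) / 2) * (py \<theta> - py x)"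
    using chord_pos[of x \<theta>] x assms by simp
  then have "cos ((x + \<theta>) / 2) * (px x - px \<theta>) + sin ((x + \<theta>) / 2) * (py x - py \<theta>) < 0"
    by (simp add: algebra_simps)
  moreover have "0 < (1 + cos (x - \<theta>))\<^sup>2" using one_plus_cos_pos[of "x - \<theta>"] x assms by auto
  ultimately have "2 * cos ((x - \<theta>) / 2) *
      (cos ((x + \<theta>) / 2) * (px x - px \<theta>) + sin ((x + \<theta>) / 2) * (py x - py \<theta>)) / (1 + cos (x - \<theta>))\<^sup>2 < 0"
    by (simp add: mult_pos_neg divide_neg_pos)
  moreover have "\<bar>x - \<theta>\<bar> < pi" using x assms by auto
  ultimately show "\<exists>y. (ratio \<theta> has_real_derivative y) (at x) \<and> y < 0"
    using ratio_deriv by blast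
qed

lemma ratio_eq_iff: "\<bar>\<psi> - \<theta>\<bar> < pi \<Longrightarrow> ratio \<theta> \<psi> = R \<longleftrightarrow> height \<psi> \<theta> = R * (1 + cos (\<psi> - \<theta>))"
  using one_plus_cos_pos[of "\<psi> - \<theta>"] by (auto simp: ratio_def field_simps)

lemma ratio_attained:
  assumes "R > 0"
  obtains \<psi> where "\<theta> < \<psi>" "\<psi> < \<theta> + pi" "ratio \<theta> \<psi> = R"
proof -
  \<comment> \<open>The denominator of \<open>ratio\<close> vanishes at
    \<open>\<theta> + pi\<close>, so the intermediate value theorem is applied to the equation
    cleared of it.\<close>
  define e where "e = (\<lambda>\<psi>. height \<psi> \<theta> - R * (1 + cos (\<psi> - \<theta>)))"
  have cont: "continuous_on S e" for S
    unfolding e_def using height_deriv1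
    by (intro continuous_intros) (meson DERIV_isCont continuous_at_imp_continuous_on)
  have "height \<theta> \<theta> = 0" by (simp add: height_def cross2_expand)
  then have a: "e \<theta> < 0" using assms by (simp add: e_def)
  have b: "0 < e (\<theta> + pi)" unfolding e_def using height_pos_of_abs[of \<theta> "\<theta> + pi"] by simp
  obtain \<psi> where \<psi>: "\<theta> \<le> \<psi>" "\<psi> \<le> \<theta> + pi" "e \<psi> = 0"
    using IVT'[of e \<theta> 0 "\<theta> + pi"] a b cont by (metis less_imp_le pi_ge_zero le_add_same_cancel1)
  moreover have "\<psi> \<noteq> \<theta>" "\<psi> \<noteq> \<theta> + pi" using \<psi>(3) a b by auto
  ultimately show ?thesis using that[of \<psi>] ratio_eq_iff[of \<psi> \<theta> R] by (simp add: e_def)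
qed

end

section \<open>The outer length billiard map\<close>

text \<open>Links the given parametrisation with the angular one. Surjectivity of
  \<open>\<Theta>\<close> turns quantifiers over curve parameters in the definitions into
  quantifiers over angles.\<close>

locale oval_chart = angle_curve +
  fixes c :: "real \<Rightarrow> complex" and \<Theta> v :: "real \<Rightarrow> real"
  assumes c_eq: "\<And>t. c t = \<gamma> (\<Theta> t)"
    and tangent_eq: "\<And>t. tangent_vec c t = of_real (v t) * cis (\<Theta> t)"
    and v_pos: "\<And>t. 0 < v t"
    and surj: "surj \<Theta>"
begin

lemma tangent_scaled:
  "(\<exists>k>0. z = of_real k * tangent_vec c t) \<longleftrightarrow> (\<exists>k>0. z = of_real k * cis (\<Theta> t))"
proof
  assume "\<exists>k>0. z = of_real k * tangent_vec c t"
  then obtain k where "k > 0" "z = of_real (k * v t) * cis (\<Theta> t)" by (auto simp: tangent_eq)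
  then show "\<exists>k>0. z = of_real k * cis (\<Theta> t)" using v_pos[of t] by (metis mult_pos_pos)
next
  assume "\<exists>k>0. z = of_real k * cis (\<Theta> t)"
  then obtain k where "k > 0" "z = of_real k * cis (\<Theta> t)" by blast
  then have "z = of_real (k / v t) * tangent_vec c t" "k / v t > 0"
    using v_pos[of t] by (auto simp: tangent_eq)
  then show "\<exists>k>0. z = of_real k * tangent_vec c t" by blast
qed

lemma ex_chart: "(\<exists>t. P (\<Theta> t)) \<longleftrightarrow> (\<exists>s. P s)"
  using surj by (metis surjD)

lemma pos_tangency_eq:
  "pos_tangency c A = (THE x. \<exists>s. x = \<gamma> s \<and> (\<exists>k>0. \<gamma> s - A = of_real k * cis s))"
  unfolding pos_tangency_def tangent_scaled c_eq
  by (subst ex_chart[where P = "\<lambda>s. _ = \<gamma> s \<and> (\<exists>k>0. \<gamma> s - A = of_real k * cis s)"]) (rule refl)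

lemma neg_tangency_eq:
  "neg_tangency c A = (THE x. \<exists>s. x = \<gamma> s \<and> (\<exists>k>0. A - \<gamma> s = of_real k * cis s))"
  unfolding neg_tangency_def tangent_scaled c_eq
  by (subst ex_chart[where P = "\<lambda>s. _ = \<gamma> s \<and> (\<exists>k>0. A - \<gamma> s = of_real k * cis s)"]) (rule refl)

lemma pos_tangency_vertex:
  assumes "\<phi> < \<theta>" "\<theta> < \<phi> + pi"
  shows "pos_tangency c (vertex \<phi> \<theta>) = \<gamma> \<theta>"
proof -
  have *: "\<gamma> \<theta> - vertex \<phi> \<theta> = of_real (len_pos \<phi> \<theta>) * cis \<theta>" by (simp add: vertex_def)
  show ?thesis unfolding pos_tangency_eq
  proof (rule the_equality)
    show "\<exists>s. \<gamma> \<theta> = \<gamma> s \<and> (\<exists>k>0. \<gamma> s - vertex \<phi> \<theta> = of_real k * cis s)"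
      using * len_pos_pos[OF assms] by blast
    show "x = \<gamma> \<theta>" if x: "\<exists>s. x = \<gamma> s \<and> (\<exists>k>0. \<gamma> s - vertex \<phi> \<theta> = of_real k * cis s)" for x
    proof -
      obtain s k where k: "x = \<gamma> s" "k > 0" "\<gamma> s - vertex \<phi> \<theta> = of_real k * cis s" using x by blast
      show ?thesis unfolding k(1)
        by (rule tangency_point_unique[OF k(3) *]) (use k(2) len_pos_pos[OF assms] in simp)
    qed
  qed
qed

lemma neg_tangency_vertex:
  assumes "\<phi> < \<theta>" "\<theta> < \<phi> + pi"
  shows "neg_tangency c (vertex \<phi> \<theta>) = \<gamma> \<phi>"
proof -
  have *: "\<gamma> \<phi> - vertex \<phi> \<theta> = of_real (- len_neg \<phi> \<theta>) * cis \<phi>" by (simp add: vertex_neg[OF assms])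
  show ?thesis unfolding neg_tangency_eq
  proof (rule the_equality)
    have "vertex \<phi> \<theta> - \<gamma> \<phi> = of_real (len_neg \<phi> \<theta>) * cis \<phi>" by (simp add: vertex_neg[OF assms])
    then show "\<exists>s. \<gamma> \<phi> = \<gamma> s \<and> (\<exists>k>0. vertex \<phi> \<theta> - \<gamma> s = of_real k * cis s)"
      using len_neg_pos[OF assms] by blast
    fix x assume "\<exists>s. x = \<gamma> s \<and> (\<exists>k>0. vertex \<phi> \<theta> - \<gamma> s = of_real k * cis s)"
    then obtain s k where x: "x = \<gamma> s" and k: "k > 0" "vertex \<phi> \<theta> - \<gamma> s = of_real k * cis s" by blast
    from k(2) have "\<gamma> s - vertex \<phi> \<theta> = of_real (- k) * cis s"
      by (metis minus_diff_eq mult_minus_left of_real_minus)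
    then show "x = \<gamma> \<phi>"
      unfolding x by (rule tangency_point_unique[OF _ *]) (use k len_neg_pos[OF assms] in simp)
  qed
qed

text \<open>Touching the first ray at \<open>\<gamma> \<theta>\<close> forces the centre onto the
  normal there. The distance of the centre from the second ray must then equal the radius, which is
  the equation \<open>R * (1 + cos (\<theta> - \<phi>)) = a * sin (\<theta> -
  \<phi>)\<close>.\<close>

lemma Sigma_circle_vertex:
  assumes "\<phi> < \<theta>" "\<theta> < \<phi> + pi"
  defines "R \<equiv> ratio \<theta> \<phi>"
  shows "Sigma_circle c (vertex \<phi> \<theta>) = (\<gamma> \<theta> - of_real R * (\<i> * cis \<theta>), R)"
proof -
  let ?A = "vertex \<phi> \<theta>"
  define a where "a = len_pos \<phi> \<theta>"
  define p where "p = len_neg \<phi> \<theta>"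
  have a: "0 < a" and p: "0 < p" unfolding a_def p_def by (rule len_pos_pos[OF assms(1,2)], rule len_neg_pos[OF assms(1,2)])
  have s: "0 < sin (\<theta> - \<phi>)" using assms by (intro sin_pos_between)
  have cp: "0 < 1 + cos (\<theta> - \<phi>)" using assms by (intro one_plus_cos_pos) auto
  have cc: "cos (\<phi> - \<theta>) = cos (\<theta> - \<phi>)" using cos_minus[of "\<theta> - \<phi>"] by simp
  have asin: "a * sin (\<theta> - \<phi>) = height \<phi> \<theta>" using s by (simp add: a_def len_pos_def)
  have R: "R * (1 + cos (\<theta> - \<phi>)) = a * sin (\<theta> - \<phi>)"
    using cp by (simp add: R_def ratio_def cc asin)
  have Rpos: "0 < R" using R a s cp by (metis mult_pos_pos zero_less_mult_pos2)
  have PA: "\<gamma> \<theta> - ?A = of_real a * cis \<theta>" by (simp add: vertex_def a_def)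
  have AM: "?A - \<gamma> \<phi> = of_real p * cis \<phi>" by (simp add: vertex_neg[OF assms(1,2)] p_def)
  define Z0 where "Z0 = \<gamma> \<theta> - of_real R * (\<i> * cis \<theta>)"
  have reg: "cball Z r \<subseteq> angle_region ?A (of_real a * cis \<theta>) (of_real p * cis \<phi>) \<longleftrightarrow>
      r \<le> cross2 (- cis \<theta>) (Z - ?A) \<and> r \<le> cross2 (cis \<phi>) (Z - ?A)" if "r > 0" for Z r
    unfolding angle_region_eq[OF s a p] using that by (simp add: cball_subset_halfplane_iff)
  have ZA: "Z0 - ?A = of_real a * cis \<theta> - of_real R * (\<i> * cis \<theta>)"
    using PA by (simp add: Z0_def algebra_simps)
  have c1: "cross2 (- cis \<theta>) (Z0 - ?A) = R"
    unfolding ZA cross2_linear cross2_cis cross2_i_cis by simp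
  have c2: "cross2 (cis \<phi>) (Z0 - ?A) = R"
    unfolding ZA cross2_linear cross2_cis cross2_i_cis using R by (simp add: algebra_simps)
  have ex: "inscribed_in_angle Z0 R ?A (of_real a * cis \<theta>) (of_real p * cis \<phi>) \<and> \<gamma> \<theta> \<in> sphere Z0 R"
    unfolding inscribed_in_angle_def
  proof (intro conjI)
    show P: "\<gamma> \<theta> \<in> sphere Z0 R" using Rpos by (simp add: Z0_def dist_norm norm_mult)
    show "cball Z0 R \<subseteq> angle_region ?A (of_real a * cis \<theta>) (of_real p * cis \<phi>)"
      using reg[OF Rpos] c1 c2 by simp
    have "\<gamma> \<theta> = ?A + of_real 1 * (of_real a * cis \<theta>)" using PA by (simp add: algebra_simps)
    then have "\<gamma> \<theta> \<in> ray ?A (of_real a * cis \<theta>)" unfolding ray_def using zero_le_one by blast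
    then show "ray ?A (of_real a * cis \<theta>) \<inter> sphere Z0 R \<noteq> {}" using P by blast
    \<comment> \<open>The foot of the centre on the second line. It lies on the ray because its
      position is \<open>a\<close>: both tangent segments from the vertex are equally long.\<close>
    define y where "y = Z0 - of_real R * (\<i> * cis \<phi>)"
    have "cross2 (cis \<phi>) (y - ?A) = cross2 (cis \<phi>) (Z0 - ?A) - R"
      unfolding y_def cross2_linear cross2_i_cis by simp
    then have "cross2 (cis \<phi>) (y - ?A) = 0" using c2 by simp
    from cross2_zero_imp_multiple[OF this]
    have "y - ?A = of_real (Re (cnj (cis \<phi>) * (y - ?A))) * cis \<phi>" .
    also have "Re (cnj (cis \<phi>) * (y - ?A)) = a"
    proof -
      have "y - ?A = of_real a * cis \<theta> - of_real R * (\<i> * cis \<theta>) - of_real R * (\<i> * cis \<phi>)"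
        using ZA by (simp add: y_def algebra_simps)
      then have "Re (cnj (cis \<phi>) * (y - ?A)) = Re (cnj (cis \<phi>) *
          (of_real a * cis \<theta> - of_real R * (\<i> * cis \<theta>) - of_real R * (\<i> * cis \<phi>)))" by (rule arg_cong)
      then have "Re (cnj (cis \<phi>) * (y - ?A)) = a * cos (\<theta> - \<phi>) + R * sin (\<theta> - \<phi>)"
        by (simp only: minus_complex.sel times_complex.sel cnj.sel cis.sel Re_complex_of_real Im_complex_of_real
              imaginary_unit.sel) (simp add: cos_diff sin_diff algebra_simps)
      moreover have "(1 + cos (\<theta> - \<phi>)) * (a * cos (\<theta> - \<phi>) + R * sin (\<theta> - \<phi>)) = (1 + cos (\<theta> - \<phi>)) * a"
      proof -
        have "(1 + cos (\<theta> - \<phi>)) * (a * cos (\<theta> - \<phi>) + R * sin (\<theta> - \<phi>))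
          = a * cos (\<theta> - \<phi>) * (1 + cos (\<theta> - \<phi>)) + (R * (1 + cos (\<theta> - \<phi>))) * sin (\<theta> - \<phi>)"
          by (simp add: algebra_simps)
        also have "\<dots> = a * (cos (\<theta> - \<phi>) + ((cos (\<theta> - \<phi>))\<^sup>2 + (sin (\<theta> - \<phi>))\<^sup>2))"
          unfolding R by (simp only: power2_eq_square) (simp only: algebra_simps)
        finally show ?thesis by (simp add: algebra_simps)
      qed
      ultimately show ?thesis using cp by simp
    qed
    finally have "y = ?A + of_real (a / p) * (of_real p * cis \<phi>)" using p by (simp add: algebra_simps)
    moreover have "0 \<le> a / p" using a p by simp
    ultimately have "y \<in> ray ?A (of_real p * cis \<phi>)" unfolding ray_def by blast
    moreover have "y \<in> sphere Z0 R" using Rpos by (simp add: y_def dist_norm norm_mult)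
    ultimately show "ray ?A (of_real p * cis \<phi>) \<inter> sphere Z0 R \<noteq> {}" by blast
  qed (rule Rpos)
  have uniq: "Z = Z0 \<and> r = R"
    if ins: "inscribed_in_angle Z r ?A (of_real a * cis \<theta>) (of_real p * cis \<phi>)" and P: "\<gamma> \<theta> \<in> sphere Z r" for Z r
  proof -
    have r: "r > 0" and sub: "cball Z r \<subseteq> angle_region ?A (of_real a * cis \<theta>) (of_real p * cis \<phi>)"
      and ray: "ray ?A (of_real p * cis \<phi>) \<inter> sphere Z r \<noteq> {}"
      using ins by (auto simp: inscribed_in_angle_def)
    have l1: "cross2 (cis \<theta>) (Z - ?A) \<le> - r" and l2: "r \<le> cross2 (cis \<phi>) (Z - ?A)"
      using reg[OF r] sub by (auto simp: cross2_linear)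
    \<comment> \<open>In the frame of the first ray the centre has distance \<open>r\<close> from
      \<open>\<gamma> \<theta>\<close> and depth at least \<open>r\<close>, which leaves only the
      point straight below.\<close>
    define q where "q = cnj (cis \<theta>) * (Z - \<gamma> \<theta>)"
    have nq: "cmod q = r" using P by (simp add: q_def norm_mult dist_norm)
    have "Im q = cross2 (cis \<theta>) (Z - \<gamma> \<theta>)" by (simp add: q_def cross2_def)
    also have "Z - \<gamma> \<theta> = (Z - ?A) - of_real a * cis \<theta>" using PA by (simp add: algebra_simps)
    also have "cross2 (cis \<theta>) \<dots> = cross2 (cis \<theta>) (Z - ?A)"
      unfolding cross2_linear(2)[of _ "Z - ?A"] cross2_linear(3) by simp
    finally have iq: "Im q \<le> - r" using l1 by simp
    have "\<bar>Im q\<bar> \<le> r" using abs_Im_le_cmod[of q] nq by simp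
    then have iq: "Im q = - r" using iq by linarith
    then have "Re q = 0" using nq r cmod_power2[of q] by simp
    then have "q = - (\<i> * of_real r)" using iq by (simp add: complex_eq_iff)
    then have "cis \<theta> * q = - (of_real r * (\<i> * cis \<theta>))" by simp
    moreover have "cis \<theta> * q = Z - \<gamma> \<theta>"
      by (simp add: q_def cis_cnj mult.assoc[symmetric] cis_mult)
    ultimately have Z: "Z = \<gamma> \<theta> - of_real r * (\<i> * cis \<theta>)" by (simp add: algebra_simps)
    obtain y where y: "y \<in> ray ?A (of_real p * cis \<phi>)" "y \<in> sphere Z r" using ray by blast
    obtain t where "y = ?A + of_real t * (of_real p * cis \<phi>)" using y(1) unfolding ray_def by blast
    then have t: "y - ?A = of_real t * (of_real p * cis \<phi>)" by simp
    have "Z - ?A = (Z - y) + of_real t * (of_real p * cis \<phi>)" unfolding t[symmetric] by simp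
    then have "cross2 (cis \<phi>) (Z - ?A) = cross2 (cis \<phi>) (Z - y)"
      by (simp only: cross2_linear(1,3) cross2_cis_self mult_zero_right add_0_right)
    \<comment> \<open>A point of the second ray on the circle bounds the distance above; the
      inclusion of the disc in the angle bounds it below.\<close>
    also have "\<dots> \<le> r" using abs_cross2_le[of "cis \<phi>" "Z - y"] y(2) by (simp add: dist_norm)
    finally have "cross2 (cis \<phi>) (Z - ?A) = r" using l2 by simp
    moreover have "Z - ?A = of_real a * cis \<theta> - of_real r * (\<i> * cis \<theta>)" using PA Z by (simp add: algebra_simps)
    ultimately have "a * sin (\<theta> - \<phi>) - r * cos (\<theta> - \<phi>) = r"
      by (simp only: cross2_linear cross2_cis cross2_i_cis)
    then have "r * (1 + cos (\<theta> - \<phi>)) = R * (1 + cos (\<theta> - \<phi>))" unfolding R by (simp add: algebra_simps)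
    then have "r = R" using cp by simp
    then show ?thesis using Z by (simp add: Z0_def)
  qed
  show ?thesis
    unfolding Sigma_circle_def Let_def pos_tangency_vertex[OF assms(1,2)] neg_tangency_vertex[OF assms(1,2)] PA AM
      Z0_def[symmetric]
    by (rule the_equality) (use ex uniq in auto)
qed

lemma common_tangents_eq:
  assumes "R > 0"
  shows "common_tangents c Z R = {line (\<gamma> s) (cis s) | s. \<bar>cross2 (cis s) (Z - \<gamma> s)\<bar> = R}"
proof -
  have l: "line (c t) (tangent_vec c t) = line (\<gamma> (\<Theta> t)) (cis (\<Theta> t))" for t
    unfolding c_eq tangent_eq using v_pos[of t] by (intro line_scale) simp
  have "(\<exists>t. l = line (c t) (tangent_vec c t)) \<longleftrightarrow> (\<exists>s. l = line (\<gamma> s) (cis s))" for l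
    unfolding l by (rule ex_chart[where P = "\<lambda>s. l = line (\<gamma> s) (cis s)"])
  then have "common_tangents c Z R =
      {l. (\<exists>s. l = line (\<gamma> s) (cis s)) \<and> (\<exists>!p. p \<in> l \<inter> sphere Z R)}"
    unfolding common_tangents_def by simp
  also have "\<dots> = {line (\<gamma> s) (cis s) | s. \<exists>!p. p \<in> line (\<gamma> s) (cis s) \<inter> sphere Z R}" by blast
  finally show ?thesis unfolding line_tangent_to_circle_iff[OF assms] .
qed

text \<open>Among angles within \<open>pi\<close> of \<open>\<theta>\<close>, only
  \<open>\<theta>\<close>, \<open>\<phi>\<close> and \<open>\<psi>\<close> give common tangents. The
  third line meets the tangent at \<open>\<gamma> \<theta>\<close> in exactly one point, since
  \<open>sin (\<theta> - \<psi>)\<close> is nonzero.\<close>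

lemma outer_length_billiard_vertex:
  assumes "\<phi> < \<theta>" "\<theta> < \<phi> + pi"
  obtains \<psi> where "\<theta> < \<psi>" "\<psi> < \<theta> + pi" "ratio \<theta> \<psi> = ratio \<theta> \<phi>"
    "outer_length_billiard c (vertex \<phi> \<theta>) = vertex \<theta> \<psi>"
proof -
  let ?A = "vertex \<phi> \<theta>"
  define R where "R = ratio \<theta> \<phi>"
  have cp: "0 < 1 + cos (\<phi> - \<theta>)" using assms by (intro one_plus_cos_pos) auto
  have "0 < height \<phi> \<theta>" using assms by (intro height_pos_of_abs) auto
  then have Rpos: "0 < R" using cp by (simp add: R_def ratio_def)
  obtain \<psi> where \<psi>: "\<theta> < \<psi>" "\<psi> < \<theta> + pi" "ratio \<theta> \<psi> = R" using ratio_attained[OF Rpos] by blast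
  define Z where "Z = \<gamma> \<theta> - of_real R * (\<i> * cis \<theta>)"
  have lP: "line ?A (\<gamma> \<theta> - ?A) = line (\<gamma> \<theta>) (cis \<theta>)"
  proof -
    have PA: "\<gamma> \<theta> - ?A = of_real (len_pos \<phi> \<theta>) * cis \<theta>" by (simp add: vertex_def)
    have A: "?A = \<gamma> \<theta> + of_real (- len_pos \<phi> \<theta>) * cis \<theta>" by (simp add: vertex_def)
    have "line ?A (\<gamma> \<theta> - ?A) = line ?A (cis \<theta>)"
      unfolding PA using len_pos_pos[OF assms] by (intro line_scale) simp
    also have "\<dots> = line (\<gamma> \<theta>) (cis \<theta>)" unfolding A by (rule line_shift)
    finally show ?thesis .
  qed
  have lM: "line ?A (\<gamma> \<phi> - ?A) = line (\<gamma> \<phi>) (cis \<phi>)"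
  proof -
    have PA: "\<gamma> \<phi> - ?A = of_real (- len_neg \<phi> \<theta>) * cis \<phi>" by (simp add: vertex_neg[OF assms])
    have "line ?A (\<gamma> \<phi> - ?A) = line ?A (cis \<phi>)"
      unfolding PA using len_neg_pos[OF assms] by (intro line_scale) simp
    also have "\<dots> = line (\<gamma> \<phi>) (cis \<phi>)" unfolding vertex_neg[OF assms] by (rule line_shift)
    finally show ?thesis .
  qed
  have g: "cross2 (cis s) (Z - \<gamma> s) = height s \<theta> - R * cos (s - \<theta>)" for s
  proof -
    have "Z - \<gamma> s = (\<gamma> \<theta> - \<gamma> s) - of_real R * (\<i> * cis \<theta>)" by (simp add: Z_def)
    then have "cross2 (cis s) (Z - \<gamma> s) = height s \<theta> - R * cos (\<theta> - s)"
      by (simp only: height_def cross2_linear(2)[of _ "\<gamma> \<theta> - \<gamma> s"] cross2_linear(3) cross2_i_cis)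
    then show ?thesis using cos_minus[of "\<theta> - s"] by simp
  qed
  have tangent: "s \<in> {\<theta>, \<phi>, \<psi>}" if s: "\<theta> - pi \<le> s" "s \<le> \<theta> + pi" and t: "\<bar>cross2 (cis s) (Z - \<gamma> s)\<bar> = R" for s
  proof (rule ccontr)
    assume ne: "s \<notin> {\<theta>, \<phi>, \<psi>}"
    then have hp: "0 < height s \<theta>" using s by (intro height_pos_of_abs) auto
    \<comment> \<open>Oval and circle on opposite sides of the line: this would make the height of
      \<open>\<gamma> \<theta>\<close> nonpositive.\<close>
    have "cross2 (cis s) (Z - \<gamma> s) \<noteq> - R"
    proof
      assume "cross2 (cis s) (Z - \<gamma> s) = - R"
      then have "height s \<theta> = - (R * (1 - cos (s - \<theta>)))" unfolding g by (simp add: algebra_simps)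
      moreover have "0 \<le> R * (1 - cos (s - \<theta>))" using Rpos by simp
      ultimately show False using hp by linarith
    qed
    then have h: "height s \<theta> = R * (1 + cos (s - \<theta>))" using t unfolding g by (simp add: algebra_simps abs_if split: if_splits)
    have "s \<noteq> \<theta> + pi" "s \<noteq> \<theta> - pi" using h hp by auto
    then have lt: "\<bar>s - \<theta>\<bar> < pi" using s by (simp add: abs_less_iff)
    then have r: "ratio \<theta> s = R" using h ratio_eq_iff by blast
    consider "s < \<theta>" "s < \<phi>" | "s < \<theta>" "\<phi> < s" | "\<theta> < s" "s < \<psi>" | "\<theta> < s" "\<psi> < s" using ne by fastforce
    then show False
      using ratio_decreasing[of \<theta> s \<phi>] ratio_decreasing[of \<theta> \<phi> s] ratio_increasing[of \<theta> s \<psi>]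
        ratio_increasing[of \<theta> \<psi> s] lt r \<psi> assms R_def
      by cases (auto simp: abs_less_iff)
  qed
  have mem: "vertex \<theta> \<psi> \<in> line (\<gamma> \<psi>) (cis \<psi>)" "vertex \<theta> \<psi> \<in> line (\<gamma> \<theta>) (cis \<theta>)"
  proof -
    have "vertex \<theta> \<psi> = \<gamma> \<psi> + of_real (- len_pos \<theta> \<psi>) * cis \<psi>" by (simp add: vertex_def)
    then show "vertex \<theta> \<psi> \<in> line (\<gamma> \<psi>) (cis \<psi>)" unfolding line_def by blast
    show "vertex \<theta> \<psi> \<in> line (\<gamma> \<theta>) (cis \<theta>)" using vertex_neg[OF \<psi>(1,2)] unfolding line_def by blast
  qed
  have ne: "line (\<gamma> \<psi>) (cis \<psi>) \<noteq> line (\<gamma> s) (cis s)" if "0 < \<bar>s - \<psi>\<bar>" "\<bar>s - \<psi>\<bar> < 2 * pi" for s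
  proof
    assume "line (\<gamma> \<psi>) (cis \<psi>) = line (\<gamma> s) (cis s)"
    moreover have "\<gamma> s \<in> line (\<gamma> s) (cis s)" by (simp add: in_line_cis_iff cross2_def)
    ultimately have "height \<psi> s = 0" by (metis in_line_cis_iff height_def)
    then show False using height_pos_of_abs[OF that] by simp
  qed
  have "outer_length_billiard c ?A = vertex \<theta> \<psi>"
    unfolding outer_length_billiard_def Let_def Sigma_circle_vertex[OF assms] pos_tangency_vertex[OF assms]
      neg_tangency_vertex[OF assms] R_def[symmetric] Z_def[symmetric] prod.case lP lM common_tangents_eq[OF Rpos]
  proof (rule the_equality)
    have "\<bar>cross2 (cis \<psi>) (Z - \<gamma> \<psi>)\<bar> = R"
      unfolding g using ratio_eq_iff[of \<psi> \<theta> R] \<psi> Rpos by (simp add: algebra_simps)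
    moreover have "line (\<gamma> \<psi>) (cis \<psi>) \<noteq> line (\<gamma> \<theta>) (cis \<theta>)" "line (\<gamma> \<psi>) (cis \<psi>) \<noteq> line (\<gamma> \<phi>) (cis \<phi>)"
      by (rule ne; use \<psi> assms in simp)+
    ultimately show "\<exists>l\<in>{line (\<gamma> s) (cis s) |s. \<bar>cross2 (cis s) (Z - \<gamma> s)\<bar> = R}.
        l \<noteq> line (\<gamma> \<theta>) (cis \<theta>) \<and> l \<noteq> line (\<gamma> \<phi>) (cis \<phi>) \<and> vertex \<theta> \<psi> \<in> l \<inter> line (\<gamma> \<theta>) (cis \<theta>)"
      using mem by blast
  next
    fix B assume "\<exists>l\<in>{line (\<gamma> s) (cis s) |s. \<bar>cross2 (cis s) (Z - \<gamma> s)\<bar> = R}.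
        l \<noteq> line (\<gamma> \<theta>) (cis \<theta>) \<and> l \<noteq> line (\<gamma> \<phi>) (cis \<phi>) \<and> B \<in> l \<inter> line (\<gamma> \<theta>) (cis \<theta>)"
    then obtain s where s: "\<bar>cross2 (cis s) (Z - \<gamma> s)\<bar> = R" "line (\<gamma> s) (cis s) \<noteq> line (\<gamma> \<theta>) (cis \<theta>)"
      "line (\<gamma> s) (cis s) \<noteq> line (\<gamma> \<phi>) (cis \<phi>)" "B \<in> line (\<gamma> s) (cis s)" "B \<in> line (\<gamma> \<theta>) (cis \<theta>)" by blast
    obtain n :: int where n: "\<theta> - pi \<le> s + 2 * pi * n" "s + 2 * pi * n \<le> \<theta> + pi" using angle_reduce by blast
    have cn: "cis (s + 2 * pi * n) = cis s" by (rule periodic_int) (simp add: complex_eq_iff)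
    have gn: "\<gamma> (s + 2 * pi * n) = \<gamma> s" by (rule gamma_cis_cong[OF cn])
    have "s + 2 * pi * n \<in> {\<theta>, \<phi>, \<psi>}" by (rule tangent[OF n]) (simp only: cn gn s(1))
    then have "s + 2 * pi * n = \<psi>" using s(2,3) cn gn by auto
    then have Bl: "B \<in> line (\<gamma> \<psi>) (cis \<psi>)" using s(4) cn gn by simp
    obtain x where x: "B = \<gamma> \<theta> + of_real x * cis \<theta>" using s(5) unfolding line_def by blast
    have V: "vertex \<theta> \<psi> = \<gamma> \<theta> + of_real (len_neg \<theta> \<psi>) * cis \<theta>" by (rule vertex_neg[OF \<psi>(1,2)])
    have "cross2 (cis \<psi>) (B - \<gamma> \<psi>) = 0" "cross2 (cis \<psi>) (vertex \<theta> \<psi> - \<gamma> \<psi>) = 0"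
      using Bl mem by (simp_all add: in_line_cis_iff)
    then have "x * sin (\<theta> - \<psi>) = len_neg \<theta> \<psi> * sin (\<theta> - \<psi>)"
      unfolding x V cross2_linear cross2_cis by linarith
    moreover have "sin (\<theta> - \<psi>) \<noteq> 0"
      using sin_pos_between[OF \<psi>(1,2)] sin_minus[of "\<psi> - \<theta>"] by simp
    ultimately show "B = vertex \<theta> \<psi>" unfolding x V by simp
  qed
  then show ?thesis using that[of \<psi>] \<psi> R_def by simp
qed

end

section \<open>The flow of the vector field\<close>

lemma vector_derivative_bound:
  fixes f :: "real \<Rightarrow> 'a::real_normed_vector"
  assumes d: "\<And>t. t \<in> {0..1} \<Longrightarrow> (f has_vector_derivative f' t) (at t within {0..1})"
    and b: "\<And>t. t \<in> {0..1} \<Longrightarrow> norm (f' t) \<le> B" and t: "t \<in> {0..1}"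
  shows "norm (f t - f 0) \<le> B"
proof -
  have "norm (f t - f 0) \<le> B * norm (t - 0)"
  proof (rule differentiable_bound[of "{0..1}" f "\<lambda>t h. h *\<^sub>R f' t"])
    show "onorm (\<lambda>h. h *\<^sub>R f' x) \<le> B" if "x \<in> {0..1}" for x
      by (rule onorm_le) (use b[OF that] in \<open>simp add: mult.commute[of B] mult_left_mono\<close>)
  qed (use d t in \<open>auto simp: has_vector_derivative_def\<close>)
  also have "\<dots> \<le> B * 1"
    using t order_trans[OF norm_ge_zero b[OF t]] by (intro mult_left_mono) auto
  finally show ?thesis by simp
qed

context angle_curve
begin

lemma wid_cis_cong: "cis \<alpha> = cis \<beta> \<Longrightarrow> wid \<alpha> = wid \<beta>"
  using wid_lipschitz[of \<alpha> \<beta>] by simp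

lemma continuous_wid: "continuous_on S wid"
proof -
  have "continuous_on S (\<lambda>\<alpha>. \<gamma> (\<alpha> + pi))"
    by (rule continuous_on_compose2[OF continuous_gamma[of UNIV]]) (auto intro!: continuous_intros)
  then show ?thesis
    unfolding wid_eq[abs_def] cross2_def by (intro continuous_intros continuous_gamma)
qed

text \<open>Separation of variables: with \<open>G\<close> an antiderivative of
  \<open>1 / wid\<close>, the solution is the inverse of \<open>G\<close> applied to
  \<open>G \<alpha> - 2 * t / r\<close>. The slope of \<open>G\<close> is at least
  \<open>1 / (2 * M)\<close>, so \<open>G\<close> is onto the real line.\<close>

lemma angular_flow_exists:
  assumes "r > 0"
  obtains \<beta> where "\<beta> 0 = \<alpha>" "\<And>t. (\<beta> has_real_derivative - 2 * wid (\<beta> t) / r) (at t)"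
proof -
  have nz: "wid x \<noteq> 0" for x using wid_pos[of x] by simp
  have "continuous_on UNIV (\<lambda>x. 1 / wid x)" by (intro continuous_intros continuous_wid) (simp add: nz)
  then obtain G where G: "\<And>x. (G has_vector_derivative 1 / wid x) (at x)"
    using antiderivative_exists by blast
  then have G': "(G has_real_derivative 1 / wid x) (at x)" for x
    by (simp add: has_real_derivative_iff_has_vector_derivative)
  have ge: "1 / (2 * M) \<le> 1 / wid x" for x
    using wid_pos[of x] wid_le[of x] by (simp add: frac_le)
  have incr: "G a - a / (2 * M) \<le> G b - b / (2 * M)" if "a \<le> b" for a b
  proof (rule DERIV_nonneg_imp_nondecreasing[OF that])
    fix x
    have "((\<lambda>x. G x - x / (2 * M)) has_real_derivative 1 / wid x - 1 / (2 * M)) (at x)"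
      using M_pos by (auto intro!: derivative_eq_intros G')
    then show "\<exists>y. ((\<lambda>x. G x - x / (2 * M)) has_real_derivative y) (at x) \<and> 0 \<le> y"
      using ge[of x] by (meson diff_ge_0_iff_ge)
  qed
  have lo: "\<exists>x. G x \<le> y" and hi: "\<exists>x. y \<le> G x" for y
  proof -
    define d where "d = 2 * M * \<bar>y - G 0\<bar>"
    have d: "0 \<le> d" "d / (2 * M) = \<bar>y - G 0\<bar>" using M_pos by (auto simp: d_def)
    have "G (- d) \<le> y" using incr[of "- d" 0] d by simp
    then show "\<exists>x. G x \<le> y" by blast
    have "y \<le> G d" using incr[of 0 d] d by simp
    then show "\<exists>x. y \<le> G x" by blast
  qed
  have pos: "0 < 1 / wid x" for x using wid_pos by simp
  show ?thesis
  proof (rule inverse_function_exists[OF G' pos lo hi])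
    fix h assume h: "\<And>x. h (G x) = x" "\<And>y. (h has_real_derivative 1 / (1 / wid (h y))) (at y)"
    define \<beta> where "\<beta> = (\<lambda>t. h (G \<alpha> - 2 * t / r))"
    have "\<beta> 0 = \<alpha>" by (simp add: \<beta>_def h)
    moreover have "(\<beta> has_real_derivative - 2 * wid (\<beta> t) / r) (at t)" for t
    proof -
      have "((\<lambda>t. G \<alpha> - 2 * t / r) has_real_derivative - 2 / r) (at t)"
        using assms by (auto intro!: derivative_eq_intros)
      from DERIV_chain2[OF h(2) this] show ?thesis unfolding \<beta>_def by (simp add: mult.commute)
    qed
    ultimately show ?thesis using that by blast
  qed
qed

end

section \<open>The vector field and its time-1 map\<close>

locale oval_field = angle_curve +
  fixes c :: "real \<Rightarrow> complex" and L :: real and Q :: complex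
  assumes domain: "oval_domain c L = body"
begin

abbreviation "X \<equiv> field_X c L Q"

text \<open>Any polar angle of \<open>p - Q\<close> may replace the principal argument, so the jump
  of \<open>Arg\<close> never matters.\<close>

lemma field_polar:
  assumes "p - Q = of_real r * cis \<alpha>" "r > 0"
  shows "X p = - of_real (2 * wid \<alpha>) * (\<i> * cis \<alpha>)"
proof -
  have n: "cmod (p - Q) = r" using assms by (simp add: norm_mult)
  have "p \<noteq> Q" using n assms(2) by auto
  then have "p - Q = of_real (cmod (p - Q)) * cis (Arg (p - Q))"
    using rcis_cmod_Arg[of "p - Q"] by (simp add: rcis_def)
  then have "cis (Arg (p - Q)) = cis \<alpha>" using assms n by (metis mult_cancel_left of_real_eq_0_iff less_irrefl)
  then have w: "wid (Arg (p - Q)) = wid \<alpha>" by (rule wid_cis_cong)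
  show ?thesis
    unfolding field_X_def width_eq_wid[OF domain] w n unfolding assms(1) using assms(2) by simp
qed

lemma polar_exists:
  assumes "p \<noteq> Q"
  obtains \<alpha> where "p - Q = of_real (cmod (p - Q)) * cis \<alpha>"
  using rcis_cmod_Arg[of "p - Q"] by (metis rcis_def)

lemma field_norm: "p \<noteq> Q \<Longrightarrow> cmod (X p) \<le> 4 * M"
proof -
  assume "p \<noteq> Q"
  then obtain \<alpha> where "p - Q = of_real (cmod (p - Q)) * cis \<alpha>" using polar_exists by blast
  then have "X p = - of_real (2 * wid \<alpha>) * (\<i> * cis \<alpha>)" using field_polar \<open>p \<noteq> Q\<close> by simp
  then show ?thesis using wid_le[of \<alpha>] wid_pos[of \<alpha>] by (simp add: norm_mult)
qed

lemma field_lipschitz_polar: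
  "cmod (of_real (2 * wid \<alpha>) * (\<i> * cis \<alpha>) - of_real (2 * wid \<beta>) * (\<i> * cis \<beta>)) \<le> 12 * M * cmod (cis \<alpha> - cis \<beta>)"
proof -
  have "of_real (2 * wid \<alpha>) * (\<i> * cis \<alpha>) - of_real (2 * wid \<beta>) * (\<i> * cis \<beta>) =
      of_real (2 * (wid \<alpha> - wid \<beta>)) * (\<i> * cis \<alpha>) + of_real (2 * wid \<beta>) * (\<i> * (cis \<alpha> - cis \<beta>))"
    by (simp add: algebra_simps)
  also have "cmod \<dots> \<le> 2 * \<bar>wid \<alpha> - wid \<beta>\<bar> + 2 * \<bar>wid \<beta>\<bar> * cmod (cis \<alpha> - cis \<beta>)"
    by (rule order_trans[OF norm_triangle_ineq])
      (simp only: norm_mult norm_of_real norm_ii norm_cis abs_mult abs_numeral mult_1 mult_1_right order_refl)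
  also have "\<dots> \<le> 2 * (4 * M * cmod (cis \<alpha> - cis \<beta>)) + 2 * (2 * M) * cmod (cis \<alpha> - cis \<beta>)"
    using wid_lipschitz[of \<alpha> \<beta>] wid_le[of \<beta>] wid_pos[of \<beta>] by (intro add_mono mult_left_mono mult_right_mono) auto
  finally show ?thesis by (simp add: algebra_simps)
qed

text \<open>The field depends only on the direction from \<open>Q\<close>, and on a circle of radius
  \<open>r\<close> the direction changes by the distance divided by \<open>r\<close>. Comparison on
  one circle suffices because flow lines keep their radius.\<close>

lemma field_lipschitz:
  assumes "cmod (p - Q) = r" "cmod (q - Q) = r" "r > 0"
  shows "cmod (X p - X q) \<le> 12 * M / r * cmod (p - q)"
proof -
  have "p \<noteq> Q" "q \<noteq> Q" using assms by auto
  then obtain \<alpha> \<beta> where p: "p - Q = of_real r * cis \<alpha>" and q: "q - Q = of_real r * cis \<beta>"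
    using polar_exists assms by metis
  have "p - q = of_real r * (cis \<alpha> - cis \<beta>)" using p q by (simp add: algebra_simps)
  then have "cmod (cis \<alpha> - cis \<beta>) = cmod (p - q) / r" using assms(3) by (simp add: norm_mult)
  moreover have "cmod (X p - X q) \<le> 12 * M * cmod (cis \<alpha> - cis \<beta>)"
    using field_lipschitz_polar[of \<beta> \<alpha>] unfolding field_polar[OF p assms(3)] field_polar[OF q assms(3)]
    by (simp add: norm_minus_commute)
  ultimately show ?thesis by simp
qed

definition flow_line :: "(real \<Rightarrow> complex) \<Rightarrow> bool" where
  "flow_line f \<longleftrightarrow> (\<forall>t\<in>{0..1}. f t \<noteq> Q \<and> (f has_vector_derivative X (f t)) (at t within {0..1}))"

lemma flow_line_radius:
  assumes "flow_line f" "t \<in> {0..1}"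
  shows "cmod (f t - Q) = cmod (f 0 - Q)"
proof -
  have "((\<lambda>t. (f t - Q) \<bullet> (f t - Q)) has_derivative (\<lambda>h. 0)) (at s within {0..1})" if "s \<in> {0..1}" for s
  proof -
    have "(f has_derivative (\<lambda>h. h *\<^sub>R X (f s))) (at s within {0..1})"
      using assms(1) that by (simp add: flow_line_def has_vector_derivative_def)
    then have "((\<lambda>t. f t - Q) has_derivative (\<lambda>h. h *\<^sub>R X (f s))) (at s within {0..1})"
      by (auto intro!: derivative_eq_intros)
    from has_derivative_inner[OF this this]
    have "((\<lambda>t. (f t - Q) \<bullet> (f t - Q)) has_derivative
        (\<lambda>h. (f s - Q) \<bullet> (h *\<^sub>R X (f s)) + h *\<^sub>R X (f s) \<bullet> (f s - Q))) (at s within {0..1})" .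
    moreover have "z \<bullet> (- of_real k * (\<i> * z)) = 0" for z k by (simp add: inner_complex_def)
    then have "(f s - Q) \<bullet> X (f s) = 0" unfolding field_X_def .
    ultimately show ?thesis by (simp add: inner_commute)
  qed
  then have "\<exists>k. \<forall>s\<in>{0..1}. (f s - Q) \<bullet> (f s - Q) = k"
    by (intro has_derivative_zero_constant) auto
  then have "(f t - Q) \<bullet> (f t - Q) = (f 0 - Q) \<bullet> (f 0 - Q)" using assms(2) by auto
  then show ?thesis by (simp add: norm_eq)
qed

text \<open>A Gronwall argument: both lines stay on the circle of radius \<open>r\<close>, where the
  field has Lipschitz constant \<open>K\<close>, so the squared distance damped by
  \<open>exp (- 2 * K * t)\<close> cannot grow.\<close>

lemma flow_line_unique:
  assumes f: "flow_line f" and g: "flow_line g" and eq: "f 0 = g 0"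
  shows "f 1 = g 1"
proof -
  define r where "r = cmod (f 0 - Q)"
  have r: "r > 0" using f by (auto simp: flow_line_def r_def)
  define K where "K = 12 * M / r"
  define u where "u = (\<lambda>t. exp (- 2 * K * t) * ((f t - g t) \<bullet> (f t - g t)))"
  have du: "(u has_real_derivative exp (- 2 * K * t) * (2 * ((f t - g t) \<bullet> (X (f t) - X (g t))) -
      2 * K * ((f t - g t) \<bullet> (f t - g t)))) (at t within {0..1})" if t: "t \<in> {0..1}" for t
  proof -
    have "(f has_derivative (\<lambda>h. h *\<^sub>R X (f t))) (at t within {0..1})"
      "(g has_derivative (\<lambda>h. h *\<^sub>R X (g t))) (at t within {0..1})"
      using f g t by (simp_all add: flow_line_def has_vector_derivative_def)
    then have "((\<lambda>t. f t - g t) has_derivative (\<lambda>h. h *\<^sub>R (X (f t) - X (g t)))) (at t within {0..1})"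
      by (auto intro!: derivative_eq_intros simp: algebra_simps)
    from has_derivative_inner[OF this this]
    have "((\<lambda>t. (f t - g t) \<bullet> (f t - g t)) has_real_derivative 2 * ((f t - g t) \<bullet> (X (f t) - X (g t)))) (at t within {0..1})"
      unfolding has_field_derivative_def
      by (rule has_derivative_eq_rhs) (auto simp: inner_commute)
    moreover have "((\<lambda>t. exp (- 2 * K * t)) has_real_derivative - 2 * K * exp (- 2 * K * t)) (at t within {0..1})"
      by (auto intro!: derivative_eq_intros)
    ultimately show ?thesis
      unfolding u_def by (rule DERIV_cong[OF DERIV_mult[rotated]]) (simp only: algebra_simps)
  qed
  obtain t where t: "t \<in> {0..1}" and mvt: "u 1 - u 0 = exp (- 2 * K * t) * (2 * ((f t - g t) \<bullet> (X (f t) - X (g t))) -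
      2 * K * ((f t - g t) \<bullet> (f t - g t))) * (1 - 0)"
    using mvt_very_simple[OF zero_le_one, of u "\<lambda>t h. exp (- 2 * K * t) * (2 * ((f t - g t) \<bullet> (X (f t) - X (g t))) -
      2 * K * ((f t - g t) \<bullet> (f t - g t))) * h"] du
    unfolding has_field_derivative_def by auto
  have "u 1 \<le> u 0"
  proof -
    have "(f t - g t) \<bullet> (X (f t) - X (g t)) \<le> cmod (f t - g t) * cmod (X (f t) - X (g t))"
      by (rule norm_cauchy_schwarz)
    also have "\<dots> \<le> cmod (f t - g t) * (K * cmod (f t - g t))"
      unfolding K_def using r t flow_line_radius[OF f, of t] flow_line_radius[OF g, of t] eq
      by (intro mult_left_mono field_lipschitz) (auto simp: r_def)
    also have "\<dots> = K * ((f t - g t) \<bullet> (f t - g t))" by (simp add: dot_square_norm power2_eq_square)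
    finally have "2 * ((f t - g t) \<bullet> (X (f t) - X (g t))) - 2 * K * ((f t - g t) \<bullet> (f t - g t)) \<le> 0" by simp
    then have "exp (- 2 * K * t) * (2 * ((f t - g t) \<bullet> (X (f t) - X (g t))) -
      2 * K * ((f t - g t) \<bullet> (f t - g t))) \<le> 0" by (intro mult_nonneg_nonpos) auto
    then show ?thesis using mvt by simp
  qed
  then have "exp (- 2 * K) * ((f 1 - g 1) \<bullet> (f 1 - g 1)) \<le> 0" by (simp add: u_def eq)
  then have "(f 1 - g 1) \<bullet> (f 1 - g 1) \<le> 0" by (simp add: mult_le_0_iff)
  then show ?thesis by (metis inner_eq_zero_iff inner_ge_zero order_antisym right_minus_eq)
qed

lemma flow_line_exists:
  assumes "x \<noteq> Q"
  obtains f where "flow_line f" "f 0 = x"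
proof -
  define r where "r = cmod (x - Q)"
  have r: "r > 0" using assms by (simp add: r_def)
  obtain \<alpha> where \<alpha>: "x - Q = of_real r * cis \<alpha>" using polar_exists[OF assms] r_def by blast
  obtain \<beta> where \<beta>: "\<beta> 0 = \<alpha>" "\<And>t. (\<beta> has_real_derivative - 2 * wid (\<beta> t) / r) (at t)"
    using angular_flow_exists[OF r] by blast
  define f where "f = (\<lambda>t. Q + of_real r * cis (\<beta> t))"
  have "f 0 = x" using \<alpha> \<beta>(1) by (simp add: f_def algebra_simps)
  moreover have "flow_line f"
    unfolding flow_line_def
  proof (intro ballI conjI)
    fix t :: real
    have p: "f t - Q = of_real r * cis (\<beta> t)" by (simp add: f_def)
    then show "f t \<noteq> Q" using r by auto
    have "(cis has_vector_derivative \<i> * cis s) (at s)" for s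
      unfolding has_vector_derivative_complex_iff
      by (auto intro!: derivative_eq_intros)
    from vector_diff_chain_at[OF \<beta>(2)[unfolded has_real_derivative_iff_has_vector_derivative] this]
    have "((\<lambda>t. cis (\<beta> t)) has_vector_derivative (- 2 * wid (\<beta> t) / r) *\<^sub>R (\<i> * cis (\<beta> t))) (at t)"
      by (simp add: o_def)
    then have "((\<lambda>t. Q + of_real r * cis (\<beta> t)) has_vector_derivative
        0 + of_real r * ((- 2 * wid (\<beta> t) / r) *\<^sub>R (\<i> * cis (\<beta> t)))) (at t)"
      by (intro has_vector_derivative_add has_vector_derivative_const has_vector_derivative_mult_right)
    moreover have "0 + of_real r * ((- 2 * wid (\<beta> t) / r) *\<^sub>R (\<i> * cis (\<beta> t))) = X (f t)"
      unfolding field_polar[OF p r] using r by (simp add: scaleR_conv_of_real)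
    ultimately show "(f has_vector_derivative X (f t)) (at t within {0..1})"
      unfolding f_def[symmetric] by (auto intro: has_vector_derivative_at_within)
  qed
  ultimately show ?thesis using that by blast
qed

text \<open>A flow line moves by at most \<open>4 * M\<close> in unit time; the Lipschitz constant
  \<open>12 * M / r\<close> turns this into a change of the field by at most
  \<open>48 * M\<^sup>2 / r\<close>.\<close>

lemma time1_flow_approx:
  assumes "x \<noteq> Q"
  shows "cmod (time1_flow c L Q x - x - X x) \<le> 48 * M\<^sup>2 / cmod (x - Q)"
    and "cmod (time1_flow c L Q x - x) \<le> 4 * M"
proof -
  obtain f where f: "flow_line f" and f0: "f 0 = x" using flow_line_exists[OF assms] by blast
  have tf: "time1_flow c L Q x = f 1"
    unfolding time1_flow_def flow_line_def[symmetric]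
  proof (rule the_equality)
    show "\<exists>\<phi>. \<phi> 0 = x \<and> \<phi> 1 = f 1 \<and> flow_line \<phi>" using f f0 by blast
    show "y = f 1" if "\<exists>\<phi>. \<phi> 0 = x \<and> \<phi> 1 = y \<and> flow_line \<phi>" for y
      using that flow_line_unique f f0 by metis
  qed
  have d: "(f has_vector_derivative X (f t)) (at t within {0..1})" and nQ: "f t \<noteq> Q" if "t \<in> {0..1}" for t
    using f that by (auto simp: flow_line_def)
  have move: "cmod (f t - f 0) \<le> 4 * M" if "t \<in> {0..1}" for t
    by (rule vector_derivative_bound[OF d _ that]) (use field_norm nQ in auto)
  show "cmod (time1_flow c L Q x - x) \<le> 4 * M" using move[of 1] by (simp add: tf f0)
  have r: "0 < cmod (x - Q)" using assms by simp
  have "cmod ((f 1 - 1 *\<^sub>R X x) - (f 0 - 0 *\<^sub>R X x)) \<le> 48 * M\<^sup>2 / cmod (x - Q)"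
  proof (rule vector_derivative_bound[where f = "\<lambda>t. f t - t *\<^sub>R X x" and f' = "\<lambda>t. X (f t) - X x"])
    fix t :: real assume t: "t \<in> {0..1}"
    show "((\<lambda>t. f t - t *\<^sub>R X x) has_vector_derivative X (f t) - X x) (at t within {0..1})"
      using d[OF t] by (auto intro!: derivative_eq_intros)
    have "cmod (X (f t) - X x) \<le> 12 * M / cmod (x - Q) * cmod (f t - x)"
      using flow_line_radius[OF f t] f0 r by (intro field_lipschitz) auto
    also have "\<dots> \<le> 12 * M / cmod (x - Q) * (4 * M)"
      using move[OF t] f0 M_pos by (intro mult_left_mono) auto
    finally show "cmod (X (f t) - X x) \<le> 48 * M\<^sup>2 / cmod (x - Q)" by (simp add: power2_eq_square)
  qed simp
  then show "cmod (time1_flow c L Q x - x - X x) \<le> 48 * M\<^sup>2 / cmod (x - Q)"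
    by (simp add: tf f0 algebra_simps)
qed

end

section \<open>Asymptotics far from the oval\<close>

lemma one_minus_cos_approx: "\<bar>1 - cos x - x\<^sup>2 / 2\<bar> \<le> (x::real) ^ 4 / 24"
proof -
  obtain t where t: "cos x = (\<Sum>m<4. cos_coeff m * x ^ m) + cos (t + 1 / 2 * real 4 * pi) / fact 4 * x ^ 4"
    using Maclaurin_cos_expansion[of x 4] by blast
  have s: "(\<Sum>m<4. cos_coeff m * x ^ m) = 1 - x\<^sup>2 / 2"
  proof -
    have "{..<4::nat} = {0, 1, 2, 3}" by auto
    then show ?thesis by (simp add: cos_coeff_def)
  qed
  have "1 - cos x - x\<^sup>2 / 2 = - (cos (t + 1 / 2 * real 4 * pi) / 24 * x ^ 4)"
    unfolding t s by (simp add: fact_numeral)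
  also have "\<bar>\<dots>\<bar> = \<bar>cos (t + 1 / 2 * real 4 * pi)\<bar> * (x ^ 4 / 24)"
    by (simp add: abs_mult)
  also have "\<dots> \<le> 1 * (x ^ 4 / 24)" by (intro mult_right_mono) auto
  finally show ?thesis by simp
qed

lemma sin_approx: "\<bar>sin x - x\<bar> \<le> \<bar>x::real\<bar> ^ 3 / 6"
proof -
  have "(\<Sum>m<3. sin_coeff m * x ^ m) = x"
    by (simp add: sin_coeff_def eval_nat_numeral)
  then show ?thesis using Maclaurin_sin_bound[of x 3] by (simp add: fact_numeral)
qed

lemma sin_ge_half:
  assumes "0 < x" "x \<le> (1::real)"
  shows "x / 2 \<le> sin x"
proof -
  have "x ^ 3 \<le> x" using assms power_decreasing[of 1 3 x] by simp
  moreover have "\<bar>sin x - x\<bar> \<le> x ^ 3 / 6" using sin_approx[of x] assms by simp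
  ultimately show ?thesis by linarith
qed

text \<open>Multiplied by \<open>sin x\<close>, the error is of fourth order; the bound
  \<open>x / 2 \<le> sin x\<close> then costs only one power.\<close>

lemma tan_half_approx:
  assumes x: "0 < x" "x \<le> (1::real)"
  shows "\<bar>(1 - cos x) / sin x - x / 2\<bar> \<le> x ^ 3 / 4"
proof -
  have s: "x / 2 \<le> sin x" using sin_ge_half[OF x] .
  then have sp: "0 < sin x" using x by linarith
  have "(1 - cos x) - x / 2 * sin x = (1 - cos x - x\<^sup>2 / 2) - x / 2 * (sin x - x)"
    by (simp add: power2_eq_square algebra_simps diff_divide_distrib add_divide_distrib)
  then have "\<bar>(1 - cos x) - x / 2 * sin x\<bar> \<le> \<bar>1 - cos x - x\<^sup>2 / 2\<bar> + \<bar>x / 2 * (sin x - x)\<bar>"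
    by (simp only: abs_triangle_ineq4)
  also have "\<dots> \<le> x ^ 4 / 24 + x / 2 * (x ^ 3 / 6)"
    using one_minus_cos_approx[of x] sin_approx[of x] x
    by (intro add_mono) (auto simp: abs_mult intro!: mult_left_mono)
  also have "\<dots> = x ^ 3 / 4 * (x / 2)" by (simp add: eval_nat_numeral)
  also have "\<dots> \<le> x ^ 3 / 4 * sin x" using s x by (intro mult_left_mono) auto
  finally have "\<bar>(1 - cos x) - x / 2 * sin x\<bar> / sin x \<le> x ^ 3 / 4"
    using sp by (simp add: divide_le_eq)
  moreover have "(1 - cos x) / sin x - x / 2 = ((1 - cos x) - x / 2 * sin x) / sin x"
    using sp by (simp add: field_simps)
  ultimately show ?thesis using sp by (simp add: abs_divide)
qed

lemma abs_sum8:
  fixes p q r s t u x y :: real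
  shows "\<bar>p + q + 3 * r - s - t - 3 * u - (x + y)\<bar>
    \<le> \<bar>p\<bar> + \<bar>q\<bar> + 3 * \<bar>r\<bar> + \<bar>s\<bar> + \<bar>t\<bar> + 3 * \<bar>u\<bar> + \<bar>x\<bar> + \<bar>y\<bar>"
proof -
  have "\<bar>p + q + 3 * r\<bar> \<le> \<bar>p\<bar> + \<bar>q\<bar> + 3 * \<bar>r\<bar>" "\<bar>x + y\<bar> \<le> \<bar>x\<bar> + \<bar>y\<bar>" by linarith+
  moreover have "\<bar>a - s - t - 3 * u - b\<bar> \<le> \<bar>a\<bar> + \<bar>s\<bar> + \<bar>t\<bar> + 3 * \<bar>u\<bar> + \<bar>b\<bar>" for a b by linarith
  ultimately show ?thesis by (smt (verit))
qed

text \<open>Here \<open>\<epsilon>\<close> and \<open>\<eta>\<close> are the angles at two consecutive vertices and \<open>R\<close> is the radius of the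
  auxiliary circle. Eliminating \<open>w\<close> and \<open>d\<close>, the main part of the error is \<open>R * (\<epsilon> - \<eta>)\<^sup>2 / (4 * \<eta>)\<close>,
  and equating the two values of \<open>w\<close> gives \<open>\<epsilon> - \<eta> = O(\<eta>\<^sup>2)\<close>.\<close>

lemma step_length_estimate:
  fixes B D N n :: real
  assumes pos: "0 \<le> B" "0 \<le> D" "0 \<le> N" "0 < n"
  obtains C where "0 \<le> C"
    "\<And>w d R \<epsilon> \<eta>. \<lbrakk>0 < \<epsilon>; \<epsilon> \<le> 1; 0 < \<eta>; \<eta> \<le> 1; 0 < R;
      \<bar>R * (1 - cos \<epsilon>) - (w + \<epsilon> * d)\<bar> \<le> B * \<epsilon>\<^sup>2; \<bar>R * (1 - cos \<eta>) - (w - \<eta> * d)\<bar> \<le> B * \<eta>\<^sup>2;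
      \<bar>d\<bar> \<le> D; R * \<epsilon>\<^sup>2 \<le> N; R * \<eta>\<^sup>2 \<le> N; n \<le> R * \<eta>\<^sup>2\<rbrakk> \<Longrightarrow>
      \<bar>R * (1 - cos \<epsilon>) / sin \<epsilon> + R * (1 - cos \<eta>) / sin \<eta> - (2 * w / \<eta> - d)\<bar> \<le> C * \<eta>"
proof -
  \<comment> \<open>\<open>G\<close> will bound the difference of the angles in units of
    \<open>\<eta>\<^sup>2\<close>, and \<open>k\<close> the quotient
    \<open>\<epsilon> / \<eta>\<close>. \<open>C\<close> has one summand for each term of the error
    identity.\<close>
  define G where "G = 2 * (D + B + N) / n"
  define k where "k = 1 + G"
  define C where "C = N * G\<^sup>2 / 2 + N * k\<^sup>2 + 3 * N + G * D + B * k\<^sup>2 + 3 * B + N * k + N"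
  have G: "0 \<le> G" using pos by (simp add: G_def)
  have k: "0 \<le> k" using G by (simp add: k_def)
  have "\<bar>R * (1 - cos \<epsilon>) / sin \<epsilon> + R * (1 - cos \<eta>) / sin \<eta> - (2 * w / \<eta> - d)\<bar> \<le> C * \<eta>"
    if \<epsilon>: "0 < \<epsilon>" "\<epsilon> \<le> 1" and \<eta>: "0 < \<eta>" "\<eta> \<le> 1" and R: "0 < R"
      and h1: "\<bar>R * (1 - cos \<epsilon>) - (w + \<epsilon> * d)\<bar> \<le> B * \<epsilon>\<^sup>2" and h2: "\<bar>R * (1 - cos \<eta>) - (w - \<eta> * d)\<bar> \<le> B * \<eta>\<^sup>2"
      and d: "\<bar>d\<bar> \<le> D" and N1: "R * \<epsilon>\<^sup>2 \<le> N" and N2: "R * \<eta>\<^sup>2 \<le> N" and n: "n \<le> R * \<eta>\<^sup>2" for w d R \<epsilon> \<eta>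
  proof -
    define f1 where "f1 = R * (1 - cos \<epsilon>) - (w + \<epsilon> * d)"
    define f2 where "f2 = R * (1 - cos \<eta>) - (w - \<eta> * d)"
    define e1 where "e1 = R * (1 - cos \<epsilon>) / sin \<epsilon> - R * \<epsilon> / 2"
    define e2 where "e2 = R * (1 - cos \<eta>) / sin \<eta> - R * \<eta> / 2"
    define e3 where "e3 = R * (1 - cos \<epsilon>) - R * \<epsilon>\<^sup>2 / 2"
    define e4 where "e4 = R * (1 - cos \<eta>) - R * \<eta>\<^sup>2 / 2"
    have f: "\<bar>f1\<bar> \<le> B * \<epsilon>\<^sup>2" "\<bar>f2\<bar> \<le> B * \<eta>\<^sup>2" using h1 h2 by (auto simp: f1_def f2_def)
    have eb: "\<bar>R * (1 - cos x) - R * x\<^sup>2 / 2\<bar> \<le> N * x\<^sup>2"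
      "\<bar>R * (1 - cos x) / sin x - R * x / 2\<bar> \<le> N * x / 4" if x: "0 < x" "x \<le> 1" "R * x\<^sup>2 \<le> N" for x
    proof -
      have "R * (1 - cos x) - R * x\<^sup>2 / 2 = R * (1 - cos x - x\<^sup>2 / 2)" by (simp add: algebra_simps)
      also have "\<bar>\<dots>\<bar> \<le> R * (x ^ 4 / 24)"
        using one_minus_cos_approx[of x] R by (simp add: abs_mult)
      also have "\<dots> = (R * x\<^sup>2) * (x\<^sup>2 / 24)" by (simp add: eval_nat_numeral)
      also have "\<dots> \<le> N * (x\<^sup>2 / 24)" using x by (intro mult_right_mono) auto
      also have "\<dots> \<le> N * x\<^sup>2" using pos by (intro mult_left_mono) auto
      finally show "\<bar>R * (1 - cos x) - R * x\<^sup>2 / 2\<bar> \<le> N * x\<^sup>2" .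
      have "R * (1 - cos x) / sin x - R * x / 2 = R * ((1 - cos x) / sin x - x / 2)" by (simp add: algebra_simps)
      also have "\<bar>\<dots>\<bar> \<le> R * (x ^ 3 / 4)"
        using tan_half_approx[OF x(1,2)] R by (simp add: abs_mult)
      also have "\<dots> = (R * x\<^sup>2) * (x / 4)" by (simp add: eval_nat_numeral)
      also have "\<dots> \<le> N * (x / 4)" using x by (intro mult_right_mono) auto
      finally show "\<bar>R * (1 - cos x) / sin x - R * x / 2\<bar> \<le> N * x / 4" by simp
    qed
    have e: "\<bar>e1\<bar> \<le> N * \<epsilon> / 4" "\<bar>e2\<bar> \<le> N * \<eta> / 4" "\<bar>e3\<bar> \<le> N * \<epsilon>\<^sup>2" "\<bar>e4\<bar> \<le> N * \<eta>\<^sup>2"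
      unfolding e1_def e2_def e3_def e4_def using eb \<epsilon> \<eta> N1 N2 by auto
    have sq: "\<epsilon>\<^sup>2 \<le> \<epsilon>" "\<eta>\<^sup>2 \<le> \<eta>" 
      using \<epsilon> \<eta> power_decreasing[of 1 2 \<epsilon>] power_decreasing[of 1 2 \<eta>] by auto
    have diff: "\<bar>\<epsilon> - \<eta>\<bar> \<le> G * \<eta>\<^sup>2"
    proof -
      \<comment> \<open>The two equations for \<open>w\<close> are subtracted. The factor
        \<open>\<epsilon> + \<eta>\<close> then cancels, and
        \<open>n \<le> R * \<eta>\<^sup>2\<close> converts the bound on
        \<open>R * \<bar>\<epsilon> - \<eta>\<bar>\<close> into one of order
        \<open>\<eta>\<^sup>2\<close>.\<close>
      have "R * (\<epsilon> - \<eta>) * (\<epsilon> + \<eta>) / 2 = (\<epsilon> + \<eta>) * d + f1 - f2 - e3 + e4"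
        unfolding f1_def f2_def e3_def e4_def by (simp add: power2_eq_square algebra_simps diff_divide_distrib add_divide_distrib)
      then have "\<bar>R * (\<epsilon> - \<eta>) * (\<epsilon> + \<eta>) / 2\<bar> \<le> \<bar>(\<epsilon> + \<eta>) * d\<bar> + \<bar>f1\<bar> + \<bar>f2\<bar> + \<bar>e3\<bar> + \<bar>e4\<bar>" by linarith
      also have "\<bar>(\<epsilon> + \<eta>) * d\<bar> \<le> (\<epsilon> + \<eta>) * D"
        using d \<epsilon> \<eta> by (simp add: abs_mult mult_left_mono)
      also have "\<bar>f1\<bar> \<le> B * \<epsilon>" using f(1) mult_left_mono[OF sq(1) pos(1)] by linarith
      also have "\<bar>f2\<bar> \<le> B * \<eta>" using f(2) mult_left_mono[OF sq(2) pos(1)] by linarith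
      also have "\<bar>e3\<bar> \<le> N * \<epsilon>" using e(3) mult_left_mono[OF sq(1) pos(3)] by linarith
      also have "\<bar>e4\<bar> \<le> N * \<eta>" using e(4) mult_left_mono[OF sq(2) pos(3)] by linarith
      also have "(\<epsilon> + \<eta>) * D + B * \<epsilon> + B * \<eta> + N * \<epsilon> + N * \<eta> = (D + B + N) * (\<epsilon> + \<eta>)" by (simp add: algebra_simps)
      finally have "R * \<bar>\<epsilon> - \<eta>\<bar> / 2 * (\<epsilon> + \<eta>) \<le> (D + B + N) * (\<epsilon> + \<eta>)"
        using R \<epsilon> \<eta> by (simp add: abs_mult)
      then have Re: "R * \<bar>\<epsilon> - \<eta>\<bar> / 2 \<le> D + B + N" using \<epsilon> \<eta> by (simp add: mult_le_cancel_right)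
      have "n * \<bar>\<epsilon> - \<eta>\<bar> \<le> R * \<eta>\<^sup>2 * \<bar>\<epsilon> - \<eta>\<bar>" using n by (intro mult_right_mono) auto
      also have "\<dots> = 2 * \<eta>\<^sup>2 * (R * \<bar>\<epsilon> - \<eta>\<bar> / 2)" by simp
      also have "\<dots> \<le> 2 * \<eta>\<^sup>2 * (D + B + N)" using Re by (intro mult_left_mono) auto
      finally show ?thesis using pos(4) by (simp add: G_def field_simps)
    qed
    have "\<epsilon> \<le> \<eta> + G * \<eta>" using diff mult_left_mono[OF sq(2) G] by linarith
    then have ek: "\<epsilon> \<le> k * \<eta>" by (simp add: k_def algebra_simps)
    then have ek2: "\<epsilon>\<^sup>2 \<le> k\<^sup>2 * \<eta>\<^sup>2" using \<epsilon> by (metis power_mono power_mult_distrib less_imp_le)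
    let ?T = "2 * w / \<eta> - d" and ?S = "R * (1 - cos \<epsilon>) / sin \<epsilon> + R * (1 - cos \<eta>) / sin \<eta>"
    have "2 * \<eta> * (?T - ?S) = R * (\<epsilon> - \<eta>)\<^sup>2 / 2 + e3 + 3 * e4 - (\<epsilon> - \<eta>) * d - f1 - 3 * f2 - 2 * \<eta> * (e1 + e2)"
    proof -
      have S: "?S = e1 + e2 + R * \<epsilon> / 2 + R * \<eta> / 2" by (simp add: e1_def e2_def)
      have T: "\<eta> * ?T = 2 * w - \<eta> * d" using \<eta> by (simp add: algebra_simps)
      have "2 * \<eta> * (?T - ?S) = 2 * (\<eta> * ?T) - 2 * \<eta> * ?S" by (simp add: algebra_simps)
      then show ?thesis unfolding T S f1_def f2_def e3_def e4_def by (simp add: power2_eq_square algebra_simps diff_divide_distrib add_divide_distrib)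
    qed
    then have "\<bar>2 * \<eta> * (?T - ?S)\<bar> \<le> \<bar>R * (\<epsilon> - \<eta>)\<^sup>2 / 2\<bar> + \<bar>e3\<bar> + 3 * \<bar>e4\<bar> + \<bar>(\<epsilon> - \<eta>) * d\<bar> + \<bar>f1\<bar> + 3 * \<bar>f2\<bar> + \<bar>2 * \<eta> * e1\<bar> + \<bar>2 * \<eta> * e2\<bar>"
      unfolding distrib_left[of "2 * \<eta>"] by (rule ssubst) (rule abs_sum8)
    also have "\<bar>R * (\<epsilon> - \<eta>)\<^sup>2 / 2\<bar> \<le> N * G\<^sup>2 / 2 * \<eta>\<^sup>2"
    proof -
      have "(\<epsilon> - \<eta>)\<^sup>2 \<le> (G * \<eta>\<^sup>2)\<^sup>2" using diff by (metis abs_ge_zero power2_abs power_mono)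
      then have "R * (\<epsilon> - \<eta>)\<^sup>2 \<le> R * (G * \<eta>\<^sup>2)\<^sup>2" using R by (intro mult_left_mono) auto
      also have "\<dots> = (R * \<eta>\<^sup>2) * (G\<^sup>2 * \<eta>\<^sup>2)" by (simp add: power2_eq_square)
      also have "\<dots> \<le> N * (G\<^sup>2 * \<eta>\<^sup>2)" using N2 by (intro mult_right_mono) auto
      finally show ?thesis using R by (simp add: mult.assoc)
    qed
    also have "\<bar>e3\<bar> \<le> N * k\<^sup>2 * \<eta>\<^sup>2" using e(3) mult_left_mono[OF ek2 pos(3)] by simp
    also have "3 * \<bar>e4\<bar> \<le> 3 * N * \<eta>\<^sup>2" using e(4) by simp
    also have "\<bar>(\<epsilon> - \<eta>) * d\<bar> \<le> G * D * \<eta>\<^sup>2"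
      using mult_mono[OF diff d] G by (simp add: abs_mult mult_ac)
    also have "\<bar>f1\<bar> \<le> B * k\<^sup>2 * \<eta>\<^sup>2" using f(1) mult_left_mono[OF ek2 pos(1)] by simp
    also have "3 * \<bar>f2\<bar> \<le> 3 * B * \<eta>\<^sup>2" using f(2) by simp
    also have "\<bar>2 * \<eta> * e1\<bar> \<le> N * k * \<eta>\<^sup>2"
    proof -
      have "\<bar>e1\<bar> \<le> N * (k * \<eta>) / 4" using e(1) mult_left_mono[OF ek pos(3)] by linarith
      then have "2 * \<eta> * \<bar>e1\<bar> \<le> 2 * \<eta> * (N * (k * \<eta>) / 4)" using \<eta> by (intro mult_left_mono) auto
      also have "\<dots> \<le> N * k * \<eta>\<^sup>2" using pos k \<eta> by (simp add: power2_eq_square)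
      finally show ?thesis using \<eta> by (simp add: abs_mult)
    qed
    also have "\<bar>2 * \<eta> * e2\<bar> \<le> N * \<eta>\<^sup>2"
    proof -
      have "2 * \<eta> * \<bar>e2\<bar> \<le> 2 * \<eta> * (N * \<eta> / 4)" using e(2) \<eta> by (intro mult_left_mono) auto
      also have "\<dots> \<le> N * \<eta>\<^sup>2" using pos \<eta> by (simp add: power2_eq_square)
      finally show ?thesis using \<eta> by (simp add: abs_mult)
    qed
    finally have "\<bar>2 * \<eta> * (?T - ?S)\<bar> \<le> C * \<eta>\<^sup>2" by (simp add: C_def algebra_simps)
    then have "2 * \<eta> * \<bar>?S - ?T\<bar> \<le> 2 * \<eta> * (C * \<eta> / 2)"
      using \<eta> by (simp add: abs_mult abs_minus_commute power2_eq_square)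
    then have "\<bar>?S - ?T\<bar> \<le> C * \<eta> / 2" using \<eta> by (simp add: mult_le_cancel_left)
    moreover have "0 \<le> C" using pos G k by (simp add: C_def)
    ultimately show ?thesis using \<eta> by (smt (verit) mult_nonneg_nonneg field_sum_of_halves)
  qed
  moreover have "0 \<le> C" using pos G k by (simp add: C_def)
  ultimately show ?thesis using that by blast
qed

lemma second_order_bound:
  fixes f f' f'' :: "real \<Rightarrow> real"
  assumes f: "\<And>x. (f has_real_derivative f' x) (at x)" and f': "\<And>x. (f' has_real_derivative f'' x) (at x)"
    and b: "\<And>x. \<bar>f'' x\<bar> \<le> B"
  shows "\<bar>f y - f x - (y - x) * f' x\<bar> \<le> B * (y - x)\<^sup>2" and "\<bar>f' y - f' x\<bar> \<le> B * \<bar>y - x\<bar>"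
proof -
  have mvt: "\<exists>z. \<bar>z - x\<bar> \<le> \<bar>y - x\<bar> \<and> g y - g x = (y - x) * g' z"
    if g: "\<And>x. (g has_real_derivative g' x) (at x)" for g g' :: "real \<Rightarrow> real" and x y
  proof -
    consider "x < y" | "x = y" | "y < x" by linarith
    then show ?thesis
    proof cases
      case 1
      obtain z where "x < z" "z < y" "g y - g x = (y - x) * g' z" using MVT2[OF 1, of g g'] g by blast
      then show ?thesis using 1 by (intro exI[of _ z]) auto
    next
      case 3
      then obtain z where "y < z" "z < x" "g x - g y = (x - y) * g' z" using MVT2[OF 3, of g g'] g by blast
      then show ?thesis using 3 by (intro exI[of _ z]) (auto simp: algebra_simps)
    qed auto
  qed
  show *: "\<bar>f' y - f' x\<bar> \<le> B * \<bar>y - x\<bar>" for x y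
  proof -
    obtain z where "f' y - f' x = (y - x) * f'' z" using mvt[OF f'] by blast
    then show ?thesis using b[of z] by (simp add: abs_mult mult.commute[of B] mult_left_mono)
  qed
  obtain z where z: "\<bar>z - x\<bar> \<le> \<bar>y - x\<bar>" "f y - f x = (y - x) * f' z" using mvt[OF f] by blast
  have B: "0 \<le> B" using b[of 0] by linarith
  have "f y - f x - (y - x) * f' x = (y - x) * (f' z - f' x)" using z(2) by (simp add: algebra_simps)
  also have "\<bar>\<dots>\<bar> \<le> \<bar>y - x\<bar> * (B * \<bar>z - x\<bar>)" using *[of z x] by (simp add: abs_mult mult_left_mono)
  also have "\<dots> \<le> \<bar>y - x\<bar> * (B * \<bar>y - x\<bar>)" using z(1) B by (intro mult_left_mono) auto
  also have "\<dots> = B * (\<bar>y - x\<bar> * \<bar>y - x\<bar>)" by simp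
  finally show "\<bar>f y - f x - (y - x) * f' x\<bar> \<le> B * (y - x)\<^sup>2" by (simp add: power2_eq_square)
qed

lemma tan_half_identities:
  assumes "0 < \<delta>" "\<delta> < pi"
  shows "0 < tan (\<delta> / 2)" "(1 - cos \<delta>) / sin \<delta> = tan (\<delta> / 2)" "(1 - cos \<delta>) / (1 + cos \<delta>) = (tan (\<delta> / 2))\<^sup>2"
proof -
  define y where "y = \<delta> / 2"
  have d: "\<delta> = 2 * y" by (simp add: y_def)
  have c: "0 < cos y" and s: "0 < sin y" using assms by (auto simp: y_def intro!: cos_gt_zero_pi sin_gt_zero)
  show "0 < tan (\<delta> / 2)" using c s by (simp add: y_def[symmetric] tan_def)
  have 1: "1 - cos \<delta> = 2 * sin y * sin y" unfolding d cos_double_sin by (simp add: power2_eq_square)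
  have 2: "1 + cos \<delta> = 2 * cos y * cos y" unfolding d cos_double_cos by (simp add: power2_eq_square)
  have 3: "sin \<delta> = 2 * sin y * cos y" unfolding d sin_double by simp
  show "(1 - cos \<delta>) / sin \<delta> = tan (\<delta> / 2)" unfolding 1 3 y_def[symmetric] tan_def using c s by simp
  show "(1 - cos \<delta>) / (1 + cos \<delta>) = (tan (\<delta> / 2))\<^sup>2"
    unfolding 1 2 y_def[symmetric] tan_def by (simp add: power2_eq_square)
qed

section \<open>Expansions about opposite tangents and displacement of two steps\<close>

context angle_curve
begin

text \<open>This is the derivative of \<open>wid\<close>: the shadow of the opposite point, with the
  sign of \<open>height_deriv1\<close>.\<close>

definition drift :: "real \<Rightarrow> real" where "drift \<alpha> = - shadow \<alpha> (\<alpha> + pi)"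

lemma wid_deriv: "(wid has_real_derivative drift \<alpha>) (at \<alpha>)"
  and drift_deriv: "(drift has_real_derivative \<rho> \<alpha> + \<rho> (\<alpha> + pi) - wid \<alpha>) (at \<alpha>)"
proof -
  have x: "((\<lambda>\<alpha>. px (\<alpha> + pi)) has_real_derivative - \<rho> (\<alpha> + pi) * cos \<alpha>) (at \<alpha>)"
    and y: "((\<lambda>\<alpha>. py (\<alpha> + pi)) has_real_derivative - \<rho> (\<alpha> + pi) * sin \<alpha>) (at \<alpha>)"
    using DERIV_shift[THEN iffD1, OF px_deriv[of "\<alpha> + pi"]] DERIV_shift[THEN iffD1, OF py_deriv[of "\<alpha> + pi"]]
    by simp_all
  have "(wid has_real_derivative
      - sin \<alpha> * (py (\<alpha> + pi) - py \<alpha>) - cos \<alpha> * (px (\<alpha> + pi) - px \<alpha>)) (at \<alpha>)"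
    unfolding wid_def[abs_def] height_expand
    by (auto intro!: derivative_eq_intros x y px_deriv py_deriv simp: algebra_simps)
  then show "(wid has_real_derivative drift \<alpha>) (at \<alpha>)" by (simp add: drift_def shadow_expand algebra_simps)
  have "(drift has_real_derivative
      (cos \<alpha> * (\<rho> \<alpha> * cos \<alpha> + \<rho> (\<alpha> + pi) * cos \<alpha>) + sin \<alpha> * (\<rho> \<alpha> * sin \<alpha> + \<rho> (\<alpha> + pi) * sin \<alpha>)) - wid \<alpha>) (at \<alpha>)"
    unfolding drift_def[abs_def] shadow_expand wid_def height_expand
    by (auto intro!: derivative_eq_intros x y px_deriv py_deriv simp: algebra_simps)
  moreover have "cos \<alpha> * (\<rho> \<alpha> * cos \<alpha> + \<rho> (\<alpha> + pi) * cos \<alpha>) + sin \<alpha> * (\<rho> \<alpha> * sin \<alpha> + \<rho> (\<alpha> + pi) * sin \<alpha>)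
      = (\<rho> \<alpha> + \<rho> (\<alpha> + pi)) * ((sin \<alpha>)\<^sup>2 + (cos \<alpha>)\<^sup>2)"
    by (simp only: power2_eq_square ring_distribs mult_ac add_ac)
  ultimately show "(drift has_real_derivative \<rho> \<alpha> + \<rho> (\<alpha> + pi) - wid \<alpha>) (at \<alpha>)" by simp
qed

lemma drift_bound: "\<bar>drift \<alpha>\<bar> \<le> 4 * M"
proof -
  have "\<bar>drift \<alpha>\<bar> \<le> cmod (cnj (cis \<alpha>) * (\<gamma> (\<alpha> + pi) - \<gamma> \<alpha>))"
    unfolding drift_def shadow_def abs_minus_cancel by (rule abs_Re_le_cmod)
  also have "\<dots> = cmod (\<gamma> (\<alpha> + pi) - \<gamma> \<alpha>)" by (simp add: norm_mult)
  finally show ?thesis using gamma_diff_bound order_trans by blast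
qed

lemma opposite:
  shows "height (\<theta> - pi) \<theta> = wid \<theta>" "shadow (\<theta> - pi) \<theta> = - drift \<theta>"
    and "height (\<theta> + pi) \<theta> = wid \<theta>" "shadow (\<theta> + pi) \<theta> = - drift \<theta>"
proof -
  have g: "\<gamma> (\<theta> - pi) = \<gamma> (\<theta> + pi)" using per[of "\<theta> - pi"] by (simp add: algebra_simps)
  have c: "cis (\<theta> - pi) = - cis \<theta>" by (simp add: complex_eq_iff)
  show "height (\<theta> - pi) \<theta> = wid \<theta>" "height (\<theta> + pi) \<theta> = wid \<theta>"
    by (simp_all add: wid_eq height_def c g cis_plus_pi cross2_linear)
  show "shadow (\<theta> - pi) \<theta> = - drift \<theta>" "shadow (\<theta> + pi) \<theta> = - drift \<theta>"
    by (simp_all add: drift_def shadow_def c g cis_plus_pi algebra_simps)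
qed

lemma wid_plus_pi: "wid (\<alpha> + pi) = wid \<alpha>" and drift_plus_pi: "drift (\<alpha> + pi) = drift \<alpha>"
proof -
  have g: "\<gamma> (\<alpha> + pi + pi) = \<gamma> \<alpha>" using per[of \<alpha>] by (simp add: algebra_simps)
  show "wid (\<alpha> + pi) = wid \<alpha>" "drift (\<alpha> + pi) = drift \<alpha>"
    by (simp_all only: wid_def drift_def height_def shadow_def g cis_plus_pi)
      (simp_all add: cross2_linear algebra_simps)
qed

text \<open>At \<open>\<theta> - pi\<close> and \<open>\<theta> + pi\<close> the tangent is opposite
  to the one at \<open>\<theta>\<close>, so the expansion starts with the width. The second
  derivative, a difference of \<open>\<rho>\<close> and a height, is at most \<open>2 * M\<close> in
  absolute value.\<close>

lemma height_taylor:
  "\<bar>height (\<theta> - pi + \<epsilon>) \<theta> - (wid \<theta> + \<epsilon> * drift \<theta>)\<bar> \<le> 2 * M * \<epsilon>\<^sup>2"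
  "\<bar>height (\<theta> + pi - \<epsilon>) \<theta> - (wid \<theta> - \<epsilon> * drift \<theta>)\<bar> \<le> 2 * M * \<epsilon>\<^sup>2"
proof -
  have b: "\<bar>- (height x \<theta> - \<rho> x)\<bar> \<le> 2 * M" for x
    using height_nonneg[of x \<theta>] height_le_2M[of x \<theta>] rho_pos[of x] le_M[of x] M_pos by linarith
  note t = second_order_bound(1)[OF height_deriv1 DERIV_minus[OF shadow_deriv1] b]
  show "\<bar>height (\<theta> - pi + \<epsilon>) \<theta> - (wid \<theta> + \<epsilon> * drift \<theta>)\<bar> \<le> 2 * M * \<epsilon>\<^sup>2"
    using t[of "\<theta> - pi + \<epsilon>" "\<theta> - pi"] unfolding opposite by (simp add: algebra_simps)
  show "\<bar>height (\<theta> + pi - \<epsilon>) \<theta> - (wid \<theta> - \<epsilon> * drift \<theta>)\<bar> \<le> 2 * M * \<epsilon>\<^sup>2"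
    using t[of "\<theta> + pi - \<epsilon>" "\<theta> + pi"] unfolding opposite by (simp add: algebra_simps)
qed

lemma wid_taylor:
  "\<bar>wid (\<theta> + pi - \<eta>) - (wid \<theta> - \<eta> * drift \<theta>)\<bar> \<le> 2 * M * \<eta>\<^sup>2"
  "\<bar>drift (\<theta> + pi - \<eta>) - drift \<theta>\<bar> \<le> 2 * M * \<bar>\<eta>\<bar>"
proof -
  have b: "\<bar>\<rho> x + \<rho> (x + pi) - wid x\<bar> \<le> 2 * M" for x
    using wid_pos[of x] wid_le[of x] rho_pos[of x] le_M[of x] rho_pos[of "x + pi"] le_M[of "x + pi"] by linarith
  have *: "wid (\<theta> + pi - \<eta>) = wid (\<theta> - \<eta>)" "drift (\<theta> + pi - \<eta>) = drift (\<theta> - \<eta>)"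
    using wid_plus_pi[of "\<theta> - \<eta>"] drift_plus_pi[of "\<theta> - \<eta>"] by (simp_all add: algebra_simps)
  show "\<bar>wid (\<theta> + pi - \<eta>) - (wid \<theta> - \<eta> * drift \<theta>)\<bar> \<le> 2 * M * \<eta>\<^sup>2"
    using second_order_bound(1)[OF wid_deriv drift_deriv b, of "\<theta> - \<eta>" \<theta>] unfolding * by (simp add: algebra_simps)
  show "\<bar>drift (\<theta> + pi - \<eta>) - drift \<theta>\<bar> \<le> 2 * M * \<bar>\<eta>\<bar>"
    using second_order_bound(2)[OF wid_deriv drift_deriv b, of "\<theta> - \<eta>" \<theta>] unfolding * by simp
qed

lemma step_length:
  obtains C where "0 \<le> C"
    "\<And>\<epsilon> \<theta> \<eta>. \<lbrakk>0 < \<epsilon>; \<epsilon> \<le> 1; 0 < \<eta>; \<eta> \<le> 1; ratio \<theta> (\<theta> + pi - \<eta>) = ratio \<theta> (\<theta> - pi + \<epsilon>)\<rbrakk> \<Longrightarrow>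
      \<bar>len_pos (\<theta> - pi + \<epsilon>) \<theta> + len_neg \<theta> (\<theta> + pi - \<eta>) - (2 * wid \<theta> / \<eta> - drift \<theta>)\<bar> \<le> C * \<eta> \<and>
      \<bar>len_pos (\<theta> - pi + \<epsilon>) \<theta> + len_neg \<theta> (\<theta> + pi - \<eta>) - (2 * wid \<theta> / \<epsilon> + drift \<theta>)\<bar> \<le> C * \<epsilon>"
proof -
  obtain C where C: "0 \<le> C" and est:
    "\<And>w d R \<epsilon> \<eta>. \<lbrakk>0 < \<epsilon>; \<epsilon> \<le> 1; 0 < \<eta>; \<eta> \<le> 1; 0 < R;
      \<bar>R * (1 - cos \<epsilon>) - (w + \<epsilon> * d)\<bar> \<le> (2 * M) * \<epsilon>\<^sup>2; \<bar>R * (1 - cos \<eta>) - (w - \<eta> * d)\<bar> \<le> (2 * M) * \<eta>\<^sup>2;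
      \<bar>d\<bar> \<le> 4 * M; R * \<epsilon>\<^sup>2 \<le> 8 * M; R * \<eta>\<^sup>2 \<le> 8 * M; m \<le> R * \<eta>\<^sup>2\<rbrakk> \<Longrightarrow>
      \<bar>R * (1 - cos \<epsilon>) / sin \<epsilon> + R * (1 - cos \<eta>) / sin \<eta> - (2 * w / \<eta> - d)\<bar> \<le> C * \<eta>"
    using step_length_estimate[of "2 * M" "4 * M" "8 * M" m] M_pos m_pos by (metis less_imp_le mult_pos_pos zero_less_numeral)
  show ?thesis
  proof (rule that[OF C])
    fix \<epsilon> \<theta> \<eta> :: real
    assume \<epsilon>: "0 < \<epsilon>" "\<epsilon> \<le> 1" and \<eta>: "0 < \<eta>" "\<eta> \<le> 1" and eq: "ratio \<theta> (\<theta> + pi - \<eta>) = ratio \<theta> (\<theta> - pi + \<epsilon>)"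
    define R where "R = ratio \<theta> (\<theta> - pi + \<epsilon>)"
    have lt: "\<epsilon> < pi" "\<eta> < pi" using \<epsilon> \<eta> pi_gt3 by linarith+
    have h1: "height (\<theta> - pi + \<epsilon>) \<theta> = R * (1 - cos \<epsilon>)"
      using ratio_eq_iff[of "\<theta> - pi + \<epsilon>" \<theta> R] \<epsilon> lt by (simp add: R_def cos_diff)
    have h2: "height (\<theta> + pi - \<eta>) \<theta> = R * (1 - cos \<eta>)"
      using ratio_eq_iff[of "\<theta> + pi - \<eta>" \<theta> R] \<eta> lt eq by (simp add: R_def cos_diff)
    have l: "len_pos (\<theta> - pi + \<epsilon>) \<theta> = R * (1 - cos \<epsilon>) / sin \<epsilon>" "len_neg \<theta> (\<theta> + pi - \<eta>) = R * (1 - cos \<eta>) / sin \<eta>"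
      by (simp_all add: len_pos_def len_neg_def h1 h2 sin_diff)
    have cb: "x\<^sup>2 / 4 \<le> 1 - cos x" "1 - cos x \<le> x\<^sup>2" "0 \<le> cos x" if x: "0 < x" "x \<le> 1" for x :: real
    proof -
      have "x ^ 4 \<le> x\<^sup>2" using x by (intro power_decreasing) auto
      moreover have "0 \<le> x\<^sup>2" by simp
      ultimately show "x\<^sup>2 / 4 \<le> 1 - cos x" "1 - cos x \<le> x\<^sup>2" using one_minus_cos_approx[of x] by linarith+
      show "0 \<le> cos x" using x pi_gt3 by (intro cos_ge_zero) auto
    qed
    have hp: "0 < height (\<theta> - pi + \<epsilon>) \<theta>" using \<epsilon> lt by (intro height_pos_of_abs) auto
    have "0 < x\<^sup>2 / 4" if "0 < x" for x :: real using that by simp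
    then have "0 < 1 - cos \<epsilon>" using cb(1)[OF \<epsilon>] \<epsilon> by (meson less_le_trans)
    then have R: "0 < R" using hp unfolding h1 by (simp add: zero_less_mult_iff)
    \<comment> \<open>The factor 8 combines \<open>x\<^sup>2 / 4 \<le> 1 - cos x\<close> with the
      bound \<open>2 * M\<close> on heights.\<close>
    have up: "R * x\<^sup>2 \<le> 8 * M" if x: "0 < x" "x \<le> 1" and h: "R * (1 - cos x) \<le> 2 * M" for x
      using mult_left_mono[OF cb(1)[OF x], of R] R h by linarith
    have N: "R * \<epsilon>\<^sup>2 \<le> 8 * M" "R * \<eta>\<^sup>2 \<le> 8 * M"
      using up[OF \<epsilon>] up[OF \<eta>] height_le_2M[of "\<theta> - pi + \<epsilon>" \<theta>] height_le_2M[of "\<theta> + pi - \<eta>" \<theta>] unfolding h1 h2 by auto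
    \<comment> \<open>The tangent differs from that at \<open>\<theta>\<close> by the angle
      \<open>pi - x\<close>, hence \<open>1 + cos x\<close> in the lower bound for the
      height.\<close>
    have lo: "m \<le> R * x\<^sup>2" if x: "0 < x" "x \<le> 1" and h: "m * (1 + cos x) \<le> R * (1 - cos x)" for x
    proof -
      have "m \<le> m * (1 + cos x)" using cb(3)[OF x] m_pos by (simp add: algebra_simps)
      also note h
      also have "R * (1 - cos x) \<le> R * x\<^sup>2" using cb(2)[OF x] R by (intro mult_left_mono) auto
      finally show ?thesis .
    qed
    have n: "m \<le> R * \<epsilon>\<^sup>2" "m \<le> R * \<eta>\<^sup>2"
    proof -
      have c: "\<theta> - (\<theta> - pi + \<epsilon>) = pi - \<epsilon>" "\<theta> - (\<theta> + pi - \<eta>) = - (pi - \<eta>)" by simp_all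
      show "m \<le> R * \<epsilon>\<^sup>2" "m \<le> R * \<eta>\<^sup>2"
        using height_ge[of \<theta> "\<theta> - pi + \<epsilon>"] height_ge[of \<theta> "\<theta> + pi - \<eta>"] lo[OF \<epsilon>] lo[OF \<eta>]
        unfolding h1 h2 c cos_minus by (simp_all add: cos_diff)
    qed
    note t1 = height_taylor(1)[of \<theta> \<epsilon>, unfolded h1] and t2 = height_taylor(2)[of \<theta> \<eta>, unfolded h2]
    have "\<bar>R * (1 - cos \<epsilon>) / sin \<epsilon> + R * (1 - cos \<eta>) / sin \<eta> - (2 * wid \<theta> / \<eta> - drift \<theta>)\<bar> \<le> C * \<eta>"
      by (rule est[OF \<epsilon> \<eta> R t1 t2 drift_bound N n(2)])
    \<comment> \<open>The hypotheses are invariant under exchanging the two angles and reversing the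
      sign of the drift.\<close>
    moreover have "\<bar>R * (1 - cos \<eta>) / sin \<eta> + R * (1 - cos \<epsilon>) / sin \<epsilon> - (2 * wid \<theta> / \<epsilon> - (- drift \<theta>))\<bar> \<le> C * \<epsilon>"
      by (rule est[OF \<eta> \<epsilon> R _ _ _ N(2,1) n(1)]) (use t1 t2 drift_bound[of \<theta>] in auto)
    ultimately show "\<bar>len_pos (\<theta> - pi + \<epsilon>) \<theta> + len_neg \<theta> (\<theta> + pi - \<eta>) - (2 * wid \<theta> / \<eta> - drift \<theta>)\<bar> \<le> C * \<eta> \<and>
      \<bar>len_pos (\<theta> - pi + \<epsilon>) \<theta> + len_neg \<theta> (\<theta> + pi - \<eta>) - (2 * wid \<theta> / \<epsilon> + drift \<theta>)\<bar> \<le> C * \<epsilon>"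
      unfolding l by (simp add: add.commute)
  qed
qed

lemma vertex_step:
  assumes "\<theta> < \<psi>" "\<psi> < \<theta> + pi"
  shows "vertex \<theta> \<psi> - vertex \<phi> \<theta> = of_real (len_pos \<phi> \<theta> + len_neg \<theta> \<psi>) * cis \<theta>"
  unfolding vertex_neg[OF assms] by (simp add: vertex_def algebra_simps)

lemma two_step_displacement:
  obtains C where "0 \<le> C"
    "\<And>\<epsilon> \<theta> \<eta> \<psi> \<zeta>. \<lbrakk>0 < \<epsilon>; \<epsilon> \<le> 1; 0 < \<eta>; \<eta> \<le> 1; 0 < \<zeta>; \<zeta> \<le> 1; \<psi> = \<theta> + pi - \<eta>;
      ratio \<theta> \<psi> = ratio \<theta> (\<theta> - pi + \<epsilon>); ratio \<psi> (\<psi> + pi - \<zeta>) = ratio \<psi> \<theta>\<rbrakk> \<Longrightarrow>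
      cmod (vertex \<psi> (\<psi> + pi - \<zeta>) - vertex (\<theta> - pi + \<epsilon>) \<theta> - of_real (2 * wid \<theta>) * (\<i> * cis \<theta>)) \<le> C * \<eta>"
proof -
  obtain C where C: "0 \<le> C" and est: "\<And>\<epsilon> \<theta> \<eta>. \<lbrakk>0 < \<epsilon>; \<epsilon> \<le> 1; 0 < \<eta>; \<eta> \<le> 1; ratio \<theta> (\<theta> + pi - \<eta>) = ratio \<theta> (\<theta> - pi + \<epsilon>)\<rbrakk> \<Longrightarrow>
      \<bar>len_pos (\<theta> - pi + \<epsilon>) \<theta> + len_neg \<theta> (\<theta> + pi - \<eta>) - (2 * wid \<theta> / \<eta> - drift \<theta>)\<bar> \<le> C * \<eta> \<and>
      \<bar>len_pos (\<theta> - pi + \<epsilon>) \<theta> + len_neg \<theta> (\<theta> + pi - \<eta>) - (2 * wid \<theta> / \<epsilon> + drift \<theta>)\<bar> \<le> C * \<epsilon>"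
    using step_length by blast
  define C1 where "C1 = 2 * C + 6 * M"
  define C2 where "C2 = C1 + C + 4 * M"
  define C3 where "C3 = C1 + (4 * M + C2) + C2"
  have C1: "0 \<le> C1" "0 \<le> C2" "0 \<le> C3" using C M_pos by (auto simp: C1_def C2_def C3_def)
  show ?thesis
  proof (rule that[OF C1(3)])
    fix \<epsilon> \<theta> \<eta> \<psi> \<zeta> :: real
    assume \<epsilon>: "0 < \<epsilon>" "\<epsilon> \<le> 1" and \<eta>: "0 < \<eta>" "\<eta> \<le> 1" and \<zeta>: "0 < \<zeta>" "\<zeta> \<le> 1" and \<psi>: "\<psi> = \<theta> + pi - \<eta>"
      and r1: "ratio \<theta> \<psi> = ratio \<theta> (\<theta> - pi + \<epsilon>)" and r2: "ratio \<psi> (\<psi> + pi - \<zeta>) = ratio \<psi> \<theta>"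
    have lt: "\<epsilon> < pi" "\<eta> < pi" "\<zeta> < pi" using \<epsilon> \<eta> \<zeta> pi_gt3 by linarith+
    have \<theta>: "\<theta> = \<psi> - pi + \<eta>" using \<psi> by simp
    define l1 where "l1 = len_pos (\<theta> - pi + \<epsilon>) \<theta> + len_neg \<theta> \<psi>"
    define l2 where "l2 = len_pos \<theta> \<psi> + len_neg \<psi> (\<psi> + pi - \<zeta>)"
    have e1: "\<bar>l1 - (2 * wid \<theta> / \<eta> - drift \<theta>)\<bar> \<le> C * \<eta>"
      using est[OF \<epsilon> \<eta>, of \<theta>] r1 unfolding \<psi>[symmetric] l1_def by blast
    \<comment> \<open>The second step is expanded at its starting vertex, the first at its final
      one; it is the same vertex, with angle \<open>\<eta>\<close>.\<close>
    have e2: "\<bar>l2 - (2 * wid \<psi> / \<eta> + drift \<psi>)\<bar> \<le> C * \<eta>"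
      using est[OF \<eta> \<zeta>, of \<psi>] r2 unfolding \<theta>[symmetric] l2_def by blast
    have "(2 * wid \<psi> / \<eta> + drift \<psi>) - (2 * wid \<theta> / \<eta> - drift \<theta>)
        = 2 * (wid \<psi> - (wid \<theta> - \<eta> * drift \<theta>)) / \<eta> + (drift \<psi> - drift \<theta>)"
      using \<eta> by (simp add: field_simps)
    moreover have "\<bar>2 * (wid \<psi> - (wid \<theta> - \<eta> * drift \<theta>)) / \<eta>\<bar> \<le> 4 * M * \<eta>"
      using wid_taylor(1)[of \<theta> \<eta>] \<eta> unfolding \<psi>[symmetric]
      by (simp add: abs_mult divide_le_eq power2_eq_square)
    moreover have "\<bar>drift \<psi> - drift \<theta>\<bar> \<le> 2 * M * \<eta>" using wid_taylor(2)[of \<theta> \<eta>] \<eta> unfolding \<psi>[symmetric] by simp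
    ultimately have "\<bar>(2 * wid \<psi> / \<eta> + drift \<psi>) - (2 * wid \<theta> / \<eta> - drift \<theta>)\<bar> \<le> 6 * M * \<eta>" by linarith
    then have l12: "\<bar>l1 - l2\<bar> \<le> C1 * \<eta>" using e1 e2 unfolding C1_def distrib_right by linarith
    have l1: "\<bar>l1 * \<eta> - 2 * wid \<theta>\<bar> \<le> (C + 4 * M) * \<eta>"
    proof -
      have "l1 * \<eta> - 2 * wid \<theta> = \<eta> * (l1 - (2 * wid \<theta> / \<eta> - drift \<theta>) - drift \<theta>)" using \<eta> by (simp add: field_simps)
      also have "\<bar>\<dots>\<bar> \<le> \<eta> * (C * \<eta> + 4 * M)"
      proof -
        have "\<bar>l1 - (2 * wid \<theta> / \<eta> - drift \<theta>) - drift \<theta>\<bar> \<le> C * \<eta> + 4 * M"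
          using e1 drift_bound[of \<theta>] by linarith
        then show ?thesis using \<eta> by (simp only: abs_mult abs_of_pos) (simp add: mult_left_mono)
      qed
      also have "\<dots> \<le> \<eta> * (C + 4 * M)"
        using \<eta> C mult_left_mono[of \<eta> 1 C] by (intro mult_left_mono) auto
      finally show ?thesis by (simp add: mult.commute)
    qed
    have l2: "\<bar>l2 * \<eta> - 2 * wid \<theta>\<bar> \<le> C2 * \<eta>"
    proof -
      have "\<bar>(l1 - l2) * \<eta>\<bar> \<le> C1 * \<eta>"
        unfolding abs_mult abs_of_pos[OF \<eta>(1)] by (rule order_trans[OF mult_left_le l12]) (use \<eta> in auto)
      then show ?thesis using l1 unfolding C2_def by (simp add: algebra_simps)
    qed
    have l2b: "\<bar>l2\<bar> * \<eta> \<le> 4 * M + C2"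
    proof -
      have "C2 * \<eta> \<le> C2" using C1 \<eta> by (simp add: mult_left_le)
      then have "\<bar>l2 * \<eta>\<bar> \<le> 4 * M + C2" using l2 wid_le[of \<theta>] wid_pos[of \<theta>] by linarith
      then show ?thesis using \<eta> by (simp add: abs_mult)
    qed
    \<comment> \<open>The two steps fail to be opposite by the angle \<open>\<eta>\<close>. To first
      order this contributes \<open>\<i> * \<eta>\<close> times a length near
      \<open>2 * wid \<theta> / \<eta>\<close>, which is the sideways displacement claimed.\<close>
    have cisb: "cmod (1 - cis (- \<eta>) - \<i> * of_real \<eta>) \<le> \<eta>\<^sup>2"
    proof -
      have p: "\<eta> ^ 4 \<le> \<eta>\<^sup>2" "\<eta> ^ 3 \<le> \<eta>\<^sup>2" using \<eta> by (auto intro!: power_decreasing)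
      have "cmod (1 - cis (- \<eta>) - \<i> * of_real \<eta>) \<le> \<bar>1 - cos \<eta>\<bar> + \<bar>sin \<eta> - \<eta>\<bar>"
        using cmod_le[of "1 - cis (- \<eta>) - \<i> * of_real \<eta>"] by simp
      also have "\<dots> \<le> \<eta>\<^sup>2"
      proof -
        have "\<bar>sin \<eta> - \<eta>\<bar> \<le> \<eta>\<^sup>2 / 6" using sin_approx[of \<eta>] \<eta> p(2) by simp
        moreover have "\<bar>1 - cos \<eta>\<bar> \<le> \<eta>\<^sup>2 / 2 + \<eta>\<^sup>2 / 24" using one_minus_cos_approx[of \<eta>] p(1) zero_le_power2[of \<eta>] by linarith
        moreover have "0 \<le> \<eta>\<^sup>2" by simp
        ultimately show ?thesis by linarith
      qed
      finally show ?thesis .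
    qed
    have cis: "cis \<psi> = - (cis \<theta> * cis (- \<eta>))" by (simp add: \<psi> cis_mult complex_eq_iff cos_diff sin_diff)
    have s2: "vertex \<psi> (\<psi> + pi - \<zeta>) - vertex \<theta> \<psi> = of_real l2 * cis \<psi>"
      unfolding l2_def using \<zeta> lt by (intro vertex_step) auto
    have s1: "vertex \<theta> \<psi> - vertex (\<theta> - pi + \<epsilon>) \<theta> = of_real l1 * cis \<theta>"
      unfolding l1_def using \<eta> lt by (intro vertex_step) (auto simp: \<psi>)
    have "vertex \<psi> (\<psi> + pi - \<zeta>) - vertex (\<theta> - pi + \<epsilon>) \<theta> = of_real l1 * cis \<theta> + of_real l2 * cis \<psi>"
      unfolding s1[symmetric] s2[symmetric] by simp
    then have "vertex \<psi> (\<psi> + pi - \<zeta>) - vertex (\<theta> - pi + \<epsilon>) \<theta> - of_real (2 * wid \<theta>) * (\<i> * cis \<theta>) =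
      cis \<theta> * (of_real (l1 - l2) + of_real l2 * (1 - cis (- \<eta>) - \<i> * of_real \<eta>) + \<i> * of_real (l2 * \<eta> - 2 * wid \<theta>))"
      unfolding cis by (simp add: algebra_simps)
    also have "cmod \<dots> = cmod (of_real (l1 - l2) + of_real l2 * (1 - cis (- \<eta>) - \<i> * of_real \<eta>) + \<i> * of_real (l2 * \<eta> - 2 * wid \<theta>))"
      by (simp only: norm_mult norm_cis mult_1)
    also have "\<dots> \<le> cmod (of_real (l1 - l2)) + cmod (of_real l2 * (1 - cis (- \<eta>) - \<i> * of_real \<eta>)) + cmod (\<i> * of_real (l2 * \<eta> - 2 * wid \<theta>))"
      by (meson norm_triangle_ineq norm_triangle_le add_right_mono order_trans)
    also have "\<dots> = \<bar>l1 - l2\<bar> + \<bar>l2\<bar> * cmod (1 - cis (- \<eta>) - \<i> * of_real \<eta>) + \<bar>l2 * \<eta> - 2 * wid \<theta>\<bar>"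
      by (simp only: norm_mult norm_of_real norm_ii mult_1)
    also have "\<dots> \<le> C1 * \<eta> + (4 * M + C2) * \<eta> + C2 * \<eta>"
    proof (intro add_mono l12 l2)
      have "\<bar>l2\<bar> * cmod (1 - cis (- \<eta>) - \<i> * of_real \<eta>) \<le> \<bar>l2\<bar> * \<eta>\<^sup>2" using cisb by (intro mult_left_mono) auto
      also have "\<dots> = (\<bar>l2\<bar> * \<eta>) * \<eta>" by (simp add: power2_eq_square)
      also have "\<dots> \<le> (4 * M + C2) * \<eta>" using l2b \<eta> by (intro mult_right_mono) auto
      finally show "\<bar>l2\<bar> * cmod (1 - cis (- \<eta>) - \<i> * of_real \<eta>) \<le> (4 * M + C2) * \<eta>" .
    qed
    finally show "cmod (vertex \<psi> (\<psi> + pi - \<zeta>) - vertex (\<theta> - pi + \<epsilon>) \<theta> - of_real (2 * wid \<theta>) * (\<i> * cis \<theta>)) \<le> C3 * \<eta>"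
      by (simp add: C3_def algebra_simps)
  qed
qed

text \<open>On a circle of radius \<open>k\<close> both tangent lengths are \<open>k * t\<close> and
  both ratios are \<open>k * t\<^sup>2\<close>; the height bounds compare the oval with the circles
  of radius \<open>m\<close> and \<open>M\<close>.\<close>

lemma tan_bounds:
  assumes "\<phi> < \<theta>" "\<theta> < \<phi> + pi"
  defines "t \<equiv> tan ((\<theta> - \<phi>) / 2)"
  shows "0 < t" "m * t \<le> len_pos \<phi> \<theta>" "len_pos \<phi> \<theta> \<le> M * t" "len_neg \<phi> \<theta> \<le> M * t"
    "m * t\<^sup>2 \<le> ratio \<theta> \<phi>" "ratio \<theta> \<phi> \<le> M * t\<^sup>2" "m * t\<^sup>2 \<le> ratio \<phi> \<theta>" "ratio \<phi> \<theta> \<le> M * t\<^sup>2"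
proof -
  have b: "0 < \<theta> - \<phi>" "\<theta> - \<phi> < pi" using assms by auto
  note id = tan_half_identities[OF b, folded t_def]
  have s: "0 < sin (\<theta> - \<phi>)" using assms by (intro sin_pos_between)
  have c: "0 < 1 + cos (\<theta> - \<phi>)" using b by (intro one_plus_cos_pos) auto
  have cc: "cos (\<phi> - \<theta>) = cos (\<theta> - \<phi>)" using cos_minus[of "\<theta> - \<phi>"] by simp
  show "0 < t" by (rule id)
  have h: "m * (1 - cos (\<theta> - \<phi>)) \<le> height \<phi> \<theta>" "height \<phi> \<theta> \<le> M * (1 - cos (\<theta> - \<phi>))"
    "m * (1 - cos (\<theta> - \<phi>)) \<le> height \<theta> \<phi>" "height \<theta> \<phi> \<le> M * (1 - cos (\<theta> - \<phi>))"
    using height_ge[of \<theta> \<phi>] height_le[of \<phi> \<theta>] height_ge[of \<phi> \<theta>] height_le[of \<theta> \<phi>] cc by auto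
  show "m * t \<le> len_pos \<phi> \<theta>" "len_pos \<phi> \<theta> \<le> M * t" "len_neg \<phi> \<theta> \<le> M * t"
    unfolding len_pos_def len_neg_def id(2)[symmetric] using h s by (simp_all add: divide_right_mono)
  show "m * t\<^sup>2 \<le> ratio \<theta> \<phi>" "ratio \<theta> \<phi> \<le> M * t\<^sup>2" "m * t\<^sup>2 \<le> ratio \<phi> \<theta>" "ratio \<phi> \<theta> \<le> M * t\<^sup>2"
    unfolding ratio_def id(3)[symmetric] cc using h c by (simp_all add: divide_right_mono)
qed

text \<open>The common ratio lies between \<open>m\<close> and \<open>M\<close> times the square of
  either tangent. Since \<open>M / m\<close> is at least 1, it may stand for its own square
  root.\<close>

lemma tan_step:
  assumes "\<phi> < \<theta>" "\<theta> < \<phi> + pi" "\<theta> < \<psi>" "\<psi> < \<theta> + pi" "ratio \<theta> \<psi> = ratio \<theta> \<phi>"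
  defines "t \<equiv> tan ((\<theta> - \<phi>) / 2)" and "t' \<equiv> tan ((\<psi> - \<theta>) / 2)"
  shows "t' \<le> M / m * t" "t \<le> M / m * t'"
proof -
  note b = tan_bounds[OF assms(1,2), folded t_def] tan_bounds[OF assms(3,4), folded t'_def]
  have "m \<le> M" using m_le[of 0] le_M[of 0] by linarith
  have *: "x \<le> M / m * y" if "m * x\<^sup>2 \<le> M * y\<^sup>2" "0 < x" "0 < y" for x y
  proof (rule power2_le_imp_le)
    have "x\<^sup>2 \<le> M / m * y\<^sup>2" using that m_pos by (simp add: field_simps)
    also have "\<dots> \<le> (M / m)\<^sup>2 * y\<^sup>2"
      using \<open>m \<le> M\<close> m_pos by (intro mult_right_mono self_le_power) auto
    finally show "x\<^sup>2 \<le> (M / m * y)\<^sup>2" by (simp only: power_mult_distrib)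
    show "0 \<le> M / m * y" using that m_pos M_pos by simp
  qed
  show "t' \<le> M / m * t" using *[of t' t] b assms(5) by linarith
  show "t \<le> M / m * t'" using *[of t t'] b assms(5) by linarith
qed

text \<open>With \<open>e\<close> the missing angle, the tangent equals
  \<open>(1 + cos e) / sin e\<close>, which is at most \<open>4 / e\<close> for
  \<open>e \<le> 1\<close>.\<close>

lemma far_angle:
  assumes "\<phi> < \<theta>" "\<theta> < \<phi> + pi" and far: "tan ((pi - 1) / 2) < tan ((\<theta> - \<phi>) / 2)"
  shows "pi - (\<theta> - \<phi>) \<le> 1" "(pi - (\<theta> - \<phi>)) * tan ((\<theta> - \<phi>) / 2) \<le> 4"
proof -
  show le: "pi - (\<theta> - \<phi>) \<le> 1"
  proof (rule ccontr)
    assume "\<not> ?thesis"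
    then have "tan ((\<theta> - \<phi>) / 2) < tan ((pi - 1) / 2)"
      using assms pi_gt3 by (intro tan_monotone) auto
    then show False using far by simp
  qed
  define e where "e = pi - (\<theta> - \<phi>)"
  have e: "0 < e" "e \<le> 1" using assms le by (auto simp: e_def)
  have d: "\<theta> - \<phi> = pi - e" by (simp add: e_def)
  have s: "e / 2 \<le> sin e" by (rule sin_ge_half[OF e])
  then have sp: "0 < sin e" using e by linarith
  have "tan ((\<theta> - \<phi>) / 2) = (1 + cos e) / sin e"
    using tan_half_identities(2)[of "\<theta> - \<phi>"] e pi_gt3 unfolding d by (simp add: cos_diff sin_diff)
  also have "\<dots> \<le> 2 / (e / 2)" using s sp e by (intro frac_le) auto
  finally have "e * tan ((\<theta> - \<phi>) / 2) \<le> e * (2 / (e / 2))" using e by (intro mult_left_mono) auto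
  then show "(pi - (\<theta> - \<phi>)) * tan ((\<theta> - \<phi>) / 2) \<le> 4" using e by (simp add: e_def[symmetric])
qed

end

section \<open>The estimate for two iterates, near the oval and far away\<close>

theorem theorem4p1:
  fixes c :: "real \<Rightarrow> complex" and L :: real and Q :: complex
  assumes "oval c L"
    and "Q \<in> interior (oval_domain c L)"
  shows "\<exists>C::real. \<forall>x. x \<notin> oval_domain c L \<longrightarrow>
           cmod ((outer_length_billiard c ^^ 2) x - time1_flow c L Q x) \<le> C / cmod (x - Q)"
proof -
  obtain \<gamma> \<rho> \<Theta> v m M where ac: "\<And>s. (\<gamma> has_vector_derivative of_real (\<rho> s) * cis s) (at s)"
    "\<And>s. \<gamma> (s + 2 * pi) = \<gamma> s" "0 < m" "\<And>s. m \<le> \<rho> s" "\<And>s. \<rho> s \<le> M"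
    and ch: "\<And>t. c t = \<gamma> (\<Theta> t)" "\<And>t. tangent_vec c t = of_real (v t) * cis (\<Theta> t)" "\<And>t. v t > 0"
    "surj \<Theta>" and dom: "oval_domain c L = convex hull (range \<gamma>)"
    by (rule oval_angle_parametrisation[OF assms(1)]) (rule that)
  interpret oval_chart \<gamma> \<rho> m M c \<Theta> v
    by unfold_locales (fact ac ch)+
  interpret oval_field \<gamma> \<rho> m M c L Q
    by unfold_locales (fact dom)
  obtain K where K: "0 \<le> K" and disp:
    "\<And>\<epsilon> \<theta> \<eta> \<psi> \<zeta>. \<lbrakk>0 < \<epsilon>; \<epsilon> \<le> 1; 0 < \<eta>; \<eta> \<le> 1; 0 < \<zeta>; \<zeta> \<le> 1; \<psi> = \<theta> + pi - \<eta>;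
      ratio \<theta> \<psi> = ratio \<theta> (\<theta> - pi + \<epsilon>); ratio \<psi> (\<psi> + pi - \<zeta>) = ratio \<psi> \<theta>\<rbrakk> \<Longrightarrow>
      cmod (vertex \<psi> (\<psi> + pi - \<zeta>) - vertex (\<theta> - pi + \<epsilon>) \<theta> - of_real (2 * wid \<theta>) * (\<i> * cis \<theta>)) \<le> K * \<eta>"
    using two_step_displacement by blast
  define \<sigma> where "\<sigma> = M / m"
  have \<sigma>: "1 \<le> \<sigma>" using m_pos m_le[of 0] le_M[of 0] by (simp add: \<sigma>_def)
  define \<tau> where "\<tau> = tan ((pi - 1) / 2)"
  have \<tau>: "0 < \<tau>" unfolding \<tau>_def using pi_gt3 by (intro tan_gt_zero) auto
  define C0 where "C0 = 4 * M + cmod (\<gamma> 0 - Q)"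
  have C0: "0 \<le> C0" using M_pos by (simp add: C0_def)
  have bound: "cmod (\<gamma> s - Q) \<le> C0" for s
    using norm_triangle_ineq[of "\<gamma> s - \<gamma> 0" "\<gamma> 0 - Q"] gamma_diff_bound[of s 0] by (simp add: C0_def)
  \<comment> \<open>Beyond this radius \<open>t\<close> exceeds
    \<open>\<sigma>\<^sup>2 * \<tau>\<close>. Each of the two steps can lower the half-angle tangent
    by a factor \<open>\<sigma>\<close> at most, so all three tangents exceed \<open>\<tau>\<close>
    and all three missing angles are at most 1.\<close>
  define r0 where "r0 = 2 * C0 + 2 * M * (\<sigma>\<^sup>2 * \<tau>) + 1"
  have r0: "0 < r0" using C0 M_pos \<tau> by (simp add: r0_def add_nonneg_pos)
  \<comment> \<open>\<open>C1\<close> bounds the total displacement for \<open>r \<le> r0\<close>,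
    with \<open>4 * M\<close> for the flow. \<open>C2\<close> adds three coefficients of
    \<open>1 / r\<close>: the error of the two steps, the change of direction from
    \<open>\<theta> + pi\<close> to the polar angle of \<open>x\<close>, and the error of the
    flow.\<close>
  define C1 where "C1 = M * (1 + \<sigma>)\<^sup>2 * ((r0 + C0) / m) + 4 * M"
  define C2 where "C2 = K * (8 * \<sigma> * M) + 24 * M * C0 + 48 * M\<^sup>2"
  have C12: "0 \<le> C1" "0 \<le> C2" using K M_pos C0 \<sigma> r0 m_pos by (auto simp: C1_def C2_def)
  have main: "cmod ((outer_length_billiard c ^^ 2) x - time1_flow c L Q x) \<le> (C1 * r0 + C2) / cmod (x - Q)"
    if out: "x \<notin> oval_domain c L" for x
  proof -
    have "x \<noteq> Q" using out assms(2) interior_subset by blast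
    define r where "r = cmod (x - Q)"
    have r: "0 < r" using \<open>x \<noteq> Q\<close> by (simp add: r_def)
    obtain \<phi> \<theta> where \<phi>: "\<phi> < \<theta>" "\<theta> < \<phi> + pi" and x: "x = vertex \<phi> \<theta>"
      using exterior_is_vertex[OF out[unfolded dom]] by blast
    obtain \<psi> where \<psi>: "\<theta> < \<psi>" "\<psi> < \<theta> + pi" and r1: "ratio \<theta> \<psi> = ratio \<theta> \<phi>"
      and F1: "outer_length_billiard c x = vertex \<theta> \<psi>"
      using outer_length_billiard_vertex[OF \<phi>] x by blast
    obtain \<omega> where \<omega>: "\<psi> < \<omega>" "\<omega> < \<psi> + pi" and r2: "ratio \<psi> \<omega> = ratio \<psi> \<theta>"
      and F2: "outer_length_billiard c (vertex \<theta> \<psi>) = vertex \<psi> \<omega>"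
      using outer_length_billiard_vertex[OF \<psi>] by blast
    have FF: "(outer_length_billiard c ^^ 2) x = vertex \<psi> \<omega>" by (simp add: numeral_2_eq_2 F1 F2)
    define a where "a = len_pos \<phi> \<theta>"
    have xQ: "x - Q = (\<gamma> \<theta> - Q) - of_real a * cis \<theta>" by (simp add: x vertex_def a_def)
    have a: "0 < a" unfolding a_def by (rule len_pos_pos[OF \<phi>])
    have na: "cmod (of_real a * cis \<theta>) = a" using a by (simp add: norm_mult)
    have ra: "\<bar>r - a\<bar> \<le> C0"
      using norm_triangle_ineq3[of "x - Q" "- (of_real a * cis \<theta>)"] bound[of \<theta>] unfolding norm_minus_cancel na r_def
      by (simp add: xQ)
    define t where "t = tan ((\<theta> - \<phi>) / 2)"
    define t' where "t' = tan ((\<psi> - \<theta>) / 2)"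
    define t'' where "t'' = tan ((\<omega> - \<psi>) / 2)"
    note b = tan_bounds[OF \<phi>, folded t_def a_def] and b' = tan_bounds[OF \<psi>, folded t'_def]
      and b'' = tan_bounds[OF \<omega>, folded t''_def]
    note s1 = tan_step[OF \<phi> \<psi> r1, folded t_def t'_def \<sigma>_def] and s2 = tan_step[OF \<psi> \<omega> r2, folded t'_def t''_def \<sigma>_def]
    show ?thesis
    proof (cases "r \<le> r0")
      case True
      have "vertex \<psi> \<omega> - x = (vertex \<psi> \<omega> - vertex \<theta> \<psi>) + (vertex \<theta> \<psi> - x)" by simp
      also have "cmod \<dots> \<le> (len_pos \<theta> \<psi> + len_neg \<psi> \<omega>) + (a + len_neg \<theta> \<psi>)"
        unfolding x vertex_step[OF \<omega>] vertex_step[OF \<psi>]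
        by (rule order_trans[OF norm_triangle_ineq])
          (use len_pos_pos[OF \<psi>] len_neg_pos[OF \<omega>] len_neg_pos[OF \<psi>] a in \<open>simp add: norm_mult a_def flip: of_real_add\<close>)
      also have "\<dots> \<le> M * (t' + t'' + t + t')" using b b' b'' by (simp add: distrib_left)
      also have "\<dots> \<le> M * ((1 + \<sigma>)\<^sup>2 * t)"
      proof (intro mult_left_mono)
        have "\<sigma> * t' \<le> \<sigma> * (\<sigma> * t)" using s1 \<sigma> by (intro mult_left_mono) auto
        then show "t' + t'' + t + t' \<le> (1 + \<sigma>)\<^sup>2 * t"
          using s1(1) s2(1) by (simp add: power2_eq_square algebra_simps)
      qed (use M_pos in simp)
      also have "\<dots> \<le> M * ((1 + \<sigma>)\<^sup>2 * ((r0 + C0) / m))"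
      proof (intro mult_left_mono)
        have "m * t \<le> r0 + C0" using b(2) ra True by linarith
        then show "t \<le> (r0 + C0) / m" using m_pos by (simp add: field_simps)
      qed (use M_pos in auto)
      finally have "cmod (vertex \<psi> \<omega> - x) \<le> C1 - 4 * M" by (simp add: C1_def mult.assoc)
      then have "cmod (vertex \<psi> \<omega> - time1_flow c L Q x) \<le> C1"
        using norm_triangle_ineq4[of "vertex \<psi> \<omega> - x" "time1_flow c L Q x - x"] time1_flow_approx(2)[OF \<open>x \<noteq> Q\<close>] by simp
      also have "C1 \<le> (C1 * r0 + C2) / r"
      proof -
        have "C1 * r \<le> C1 * r0" using True C12 by (intro mult_left_mono) auto
        then show ?thesis using r C12 by (simp add: pos_le_divide_eq)
      qed
      finally show ?thesis by (simp add: FF r_def)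
    next
      case False
      have s2t: "0 \<le> \<sigma>\<^sup>2 * \<tau>" using \<tau> by simp
      have ar: "r \<le> 2 * a" using False ra mult_nonneg_nonneg[OF less_imp_le[OF M_pos] s2t] unfolding r0_def by linarith
      have "M * (\<sigma>\<^sup>2 * \<tau>) < a" using False ar C0 unfolding r0_def by linarith
      also have "a \<le> M * t" by (rule b)
      finally have t: "\<sigma>\<^sup>2 * \<tau> < t" using M_pos by simp
      have t2: "t \<le> \<sigma>\<^sup>2 * t''"
      proof -
        have "\<sigma> * t' \<le> \<sigma> * (\<sigma> * t'')" using s2 \<sigma> by (intro mult_left_mono) auto
        then show ?thesis using s1(2) by (simp add: power2_eq_square)
      qed
      have sq: "\<sigma> \<le> \<sigma>\<^sup>2" "1 \<le> \<sigma>\<^sup>2" using \<sigma> by (auto simp: self_le_power one_le_power)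
      have f: "\<tau> < t" using t mult_right_mono[OF sq(2) less_imp_le[OF \<tau>]] by simp
      have "\<sigma>\<^sup>2 * \<tau> < \<sigma>\<^sup>2 * t''" using t t2 by linarith
      then have f'': "\<tau> < t''" using \<sigma> by (simp add: mult_less_cancel_left_pos)
      have "\<sigma> * \<tau> \<le> \<sigma>\<^sup>2 * \<tau>" using sq \<tau> by (intro mult_right_mono) auto
      then have "\<sigma> * \<tau> < \<sigma> * t'" using t s1(2) by linarith
      then have f': "\<tau> < t'" using \<sigma> by (simp add: mult_less_cancel_left_pos)
      define \<epsilon> where "\<epsilon> = pi - (\<theta> - \<phi>)"
      define \<eta> where "\<eta> = pi - (\<psi> - \<theta>)"
      define \<zeta> where "\<zeta> = pi - (\<omega> - \<psi>)"
      have pos: "0 < \<epsilon>" "0 < \<eta>" "0 < \<zeta>" using \<phi> \<psi> \<omega> by (auto simp: \<epsilon>_def \<eta>_def \<zeta>_def)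
      have le: "\<epsilon> \<le> 1" "\<eta> \<le> 1" "\<zeta> \<le> 1" and \<eta>t: "\<eta> * t' \<le> 4"
        using far_angle[OF \<phi>] far_angle[OF \<psi>] far_angle[OF \<omega>] f f' f''
        unfolding \<epsilon>_def \<eta>_def \<zeta>_def t_def t'_def t''_def \<tau>_def by auto
      have eqs: "\<phi> = \<theta> - pi + \<epsilon>" "\<psi> = \<theta> + pi - \<eta>" "\<omega> = \<psi> + pi - \<zeta>" by (simp_all add: \<epsilon>_def \<eta>_def \<zeta>_def)
      have d: "cmod (vertex \<psi> \<omega> - x - of_real (2 * wid \<theta>) * (\<i> * cis \<theta>)) \<le> K * \<eta>"
        using disp[OF pos(1) le(1) pos(2) le(2) pos(3) le(3) eqs(2)] r1 r2 unfolding eqs(1)[symmetric] eqs(3)[symmetric] x by blast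
      \<comment> \<open>Converts an error in \<open>\<eta>\<close> into one in \<open>1 / r\<close>:
        \<open>r\<close> is at most twice the tangent length, which is at most \<open>M * t\<close>,
        and \<open>\<eta> * t'\<close> is bounded.\<close>
      have "\<eta> * r \<le> \<eta> * (2 * (M * (\<sigma> * t')))"
      proof (intro mult_left_mono)
        have "M * t \<le> M * (\<sigma> * t')" using s1 M_pos by (intro mult_left_mono) auto
        then show "r \<le> 2 * (M * (\<sigma> * t'))" using ar b(3) by linarith
      qed (use pos in simp)
      also have "\<dots> = 2 * M * \<sigma> * (\<eta> * t')" by simp
      also have "\<dots> \<le> 2 * M * \<sigma> * 4" using \<eta>t M_pos \<sigma> by (intro mult_left_mono) auto
      finally have \<eta>r: "\<eta> \<le> 8 * \<sigma> * M / r" using r by (simp add: field_simps)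
      obtain \<alpha> where \<alpha>: "x - Q = of_real r * cis \<alpha>" using polar_exists[OF \<open>x \<noteq> Q\<close>] r_def by blast
      \<comment> \<open>Seen from \<open>Q\<close>, the point \<open>x\<close> lies nearly in
        direction \<open>- cis \<theta>\<close>, so the field is compared at the angle
        \<open>\<theta> + pi\<close>. The width is the same there, and the sign change cancels the
        minus sign of the field.\<close>
      have "of_real (2 * wid \<theta>) * (\<i> * cis \<theta>) = - (of_real (2 * wid (\<theta> + pi)) * (\<i> * cis (\<theta> + pi)))"
        by (simp add: wid_plus_pi cis_plus_pi)
      then have "of_real (2 * wid \<theta>) * (\<i> * cis \<theta>) - X x
          = of_real (2 * wid \<alpha>) * (\<i> * cis \<alpha>) - of_real (2 * wid (\<theta> + pi)) * (\<i> * cis (\<theta> + pi))"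
        unfolding field_polar[OF \<alpha> r] by simp
      then have "cmod (of_real (2 * wid \<theta>) * (\<i> * cis \<theta>) - X x) \<le> 12 * M * cmod (cis \<alpha> - cis (\<theta> + pi))"
        using field_lipschitz_polar[of \<alpha> "\<theta> + pi"] by simp
      also have "\<dots> \<le> 12 * M * (2 * C0 / r)"
      proof (intro mult_left_mono)
        have "of_real r * (cis \<alpha> - cis (\<theta> + pi)) = (\<gamma> \<theta> - Q) + of_real (r - a) * cis \<theta>"
          using \<alpha> xQ unfolding cis_plus_pi by (simp add: algebra_simps)
        then have "r * cmod (cis \<alpha> - cis (\<theta> + pi)) = cmod ((\<gamma> \<theta> - Q) + of_real (r - a) * cis \<theta>)"
          using r by (metis norm_mult norm_of_real abs_of_pos)
        also have "\<dots> \<le> C0 + \<bar>r - a\<bar>"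
          by (rule order_trans[OF norm_triangle_ineq]) (use bound[of \<theta>] in \<open>simp add: norm_mult flip: of_real_diff\<close>)
        also have "\<dots> \<le> 2 * C0" using ra by simp
        finally show "cmod (cis \<alpha> - cis (\<theta> + pi)) \<le> 2 * C0 / r" using r by (simp add: field_simps)
      qed (use M_pos in simp)
      finally have e: "cmod (of_real (2 * wid \<theta>) * (\<i> * cis \<theta>) - X x) \<le> 24 * M * C0 / r" by simp
      have g: "cmod (time1_flow c L Q x - x - X x) \<le> 48 * M\<^sup>2 / r" unfolding r_def by (rule time1_flow_approx(1)[OF \<open>x \<noteq> Q\<close>])
      have "vertex \<psi> \<omega> - time1_flow c L Q x = (vertex \<psi> \<omega> - x - of_real (2 * wid \<theta>) * (\<i> * cis \<theta>))
          + (of_real (2 * wid \<theta>) * (\<i> * cis \<theta>) - X x) - (time1_flow c L Q x - x - X x)" by simp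
      also have "cmod \<dots> \<le> K * \<eta> + 24 * M * C0 / r + 48 * M\<^sup>2 / r"
        by (intro order_trans[OF norm_triangle_ineq4] add_mono order_trans[OF norm_triangle_ineq] d e g)
      also have "\<dots> \<le> K * (8 * \<sigma> * M / r) + 24 * M * C0 / r + 48 * M\<^sup>2 / r"
        using mult_left_mono[OF \<eta>r K] by simp
      also have "\<dots> = C2 / r" by (simp add: C2_def add_divide_distrib)
      also have "\<dots> \<le> (C1 * r0 + C2) / r" using C12 r0 r by (intro divide_right_mono) auto
      finally show ?thesis by (simp add: FF r_def)
    qed
  qed
  then show ?thesis by blast
qed

end
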